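(* (Complexity of classical simulation of Gaussian boson sampling with identical squeezing in all modes.) There is a classical algorithm that simulates Gaussian boson sampling with $m$ modes, an $m\times m$ unitary $U$ and the same squeezing parameter $r$ in every mode, with time complexity $$O\big(m\sinh^2 r+\mathrm{poly}(n)\,2^{8n/3}\big)$$ and polynomial space, where $n$ is the number of output photons. If $O(m2^{n})$ memory is used to store and recycle the intermediate calculations, the time complexity can be improved to $$O\big(m\sinh^2 r+\mathrm{poly}(n)\,2^{5n/2}\big).$$ The algorithm works in two steps. First, it samples an even photon number $n$ from the distribution $\{P_n\}$ truncated to $n\in\{0,2,4,\dots,N\}$, $N=c\,n_{\mathrm{most}}$, and renormalized, where $c$ is a constant and $n_{\mathrm{most}}=2\lfloor(m/2-1)\sinh^2 r\rfloor$; this accounts for the term $m\sinh^2 r$. Second, for this $n$ it samples a configuration $s=(s_1,\dots,s_m)$ of $n$ photons from the distribution $p_n(s)$; this takes time $O(\mathrm{poly}(n)\,2^{8n/3})$ with polynomial space, or time $O(\mathrm{poly}(n)\,2^{5n/2})$ with $O(m2^{n})$ space.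
   Context: Gaussian boson sampling: each of the $m$ modes of a linear optical network with $m\times m$ unitary $U$ is injected with a single-mode squeezed state with the same squeezing parameter $r$. A configuration is $s=(s_1,\dots,s_m)\in\mathbb{Z}_{\ge0}^m$ ($s_j$ is the number of photons in output mode $j$), with total photon number $n=s_1+\dots+s_m$. The output distribution factors as $p(s)=P_n\cdot p_n(s)$, where $P_n$ is the probability of generating $n$ photons: $P_n=0$ for odd $n$ and, for even $n$, $$P_n=\binom{\frac{m+n}{2}-1}{\frac n2}\frac{\tanh^n r}{\cosh^m r},\qquad p_n(s)=\frac{|\mathrm{Haf}(W_s)|^2}{s_1!\cdots s_m!\,\binom{\frac{m+n}{2}-1}{\frac n2}}\quad(s_1+\dots+s_m=n).$$ Here $\binom{a}{d}=a(a-1)\cdots(a-d+1)/d!$ for real $a$ and integer $d\ge0$; $W=UU^{T}$; $W_s$ is the $n\times n$ matrix obtained from $W$ by taking $s_j$ copies of the $j$-th column and then $s_j$ copies of the $j$-th row, for each $j$. For a symmetric $n\times n$ matrix $V$ with $n$ even, $\mathrm{Haf}(V)=\sum_\sigma\prod_{\{i,j\}\in\sigma}V(i,j)$, summed over all perfect matchings $\sigma$ of $\{1,\dots,n\}$. The number $n_{\mathrm{most}}$ is the most probable photon number. It is known, and used, that the Hafnian of an $n\times n$ matrix can be computed in time $O(n^3 2^{n/2})$. $\mathrm{poly}(n)$ denotes a polynomial in $n$.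
   Formalization: The time for sampling the configuration is poly(n)(m^2 + 2^{8n/3}), resp. poly(n)(m^2 + 2^{5n/2}): reading U and writing s cannot be done in time independent of m. The time for sampling n is O(m sinh^2 r + 1), since r = 0 still costs a step. *)

theory Defs
  imports
    "HOL-Probability.Probability_Mass_Function"
    "HOL-Library.Disjoint_Sets"
    "HOL-Computational_Algebra.Polynomial"
    "Jordan_Normal_Form.Schur_Decomposition"
begin

section \<open>Gaussian boson sampling with identical squeezing\<close>

text \<open>Modes and matrix indices are numbered from 0. A configuration is a list \<open>s\<close> with
  \<open>length s = m\<close>; its photon number is \<open>sum_list s\<close>.\<close>

definition unitary :: "complex mat \<Rightarrow> bool" where
  "unitary U \<longleftrightarrow> square_mat U \<and> U * mat_adjoint U = 1\<^sub>m (dim_row U)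
                    \<and> mat_adjoint U * U = 1\<^sub>m (dim_row U)"

definition perfect_matchings :: "'a set \<Rightarrow> 'a set set set" where
  "perfect_matchings A = {M. partition_on A M \<and> (\<forall>e\<in>M. card e = 2)}"

text \<open>Only used for symmetric matrices, so the orientation of an edge is irrelevant; the entry
  above the diagonal is chosen.\<close>

definition Haf :: "complex mat \<Rightarrow> complex" where
  "Haf V = (\<Sum>M\<in>perfect_matchings {..<dim_row V}. \<Prod>e\<in>M. V $$ (Min e, Max e))"

definition photon_modes :: "nat list \<Rightarrow> nat list" where
  "photon_modes s = concat (map (\<lambda>j. replicate (s ! j) j) [0..<length s])"

definition repeat_mat :: "'a mat \<Rightarrow> nat list \<Rightarrow> 'a mat" where
  "repeat_mat W s = (let e = photon_modes s
     in Matrix.mat (length e) (length e) (\<lambda>(i, j). W $$ (e ! i, e ! j)))"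

definition pair_binom :: "nat \<Rightarrow> nat \<Rightarrow> real" where
  "pair_binom m n = ((real m + real n) / 2 - 1) gchoose (n div 2)"

definition photon_prob :: "nat \<Rightarrow> real \<Rightarrow> nat \<Rightarrow> real" where
  "photon_prob m r n =
     (if even n then pair_binom m n * tanh r ^ n / cosh r ^ m else 0)"

text \<open>The conditional distribution \<open>p\<^sub>n\<close>, extended by 0 to lists that are not \<open>n\<close>-photon
  configurations.\<close>

definition config_prob :: "complex mat \<Rightarrow> nat \<Rightarrow> nat list \<Rightarrow> real" where
  "config_prob U n s =
     (if length s = dim_row U \<and> sum_list s = n
      then (cmod (Haf (repeat_mat (U * transpose_mat U) s)))\<^sup>2
           / ((\<Prod>j<length s. fact (s ! j)) * pair_binom (dim_row U) n)
      else 0)"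

definition gbs_prob :: "complex mat \<Rightarrow> real \<Rightarrow> nat list \<Rightarrow> real" where
  "gbs_prob U r s = photon_prob (dim_row U) r (sum_list s) * config_prob U (sum_list s) s"

text \<open>For \<open>m = 1\<close> the floor is negative and \<open>n_most\<close> is 0, which is then indeed the most probable
  photon number.\<close>

definition n_most :: "nat \<Rightarrow> real \<Rightarrow> nat" where
  "n_most m r = nat (2 * \<lfloor>(real m / 2 - 1) * (sinh r)\<^sup>2\<rfloor>)"

definition photon_range :: "nat \<Rightarrow> real \<Rightarrow> real \<Rightarrow> nat set" where
  "photon_range m r c = {n. even n \<and> real n \<le> c * real (n_most m r)}"

definition truncated_photon_prob :: "nat \<Rightarrow> real \<Rightarrow> real \<Rightarrow> nat \<Rightarrow> real" where
  "truncated_photon_prob m r c n =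
     (if n \<in> photon_range m r c
      then photon_prob m r n / (\<Sum>k\<in>photon_range m r c. photon_prob m r k) else 0)"

definition truncated_gbs_prob :: "complex mat \<Rightarrow> real \<Rightarrow> real \<Rightarrow> nat list \<Rightarrow> real" where
  "truncated_gbs_prob U r c s =
     (if sum_list s \<in> photon_range (dim_row U) r c
      then gbs_prob U r s
           / (\<Sum>k\<in>photon_range (dim_row U) r c. photon_prob (dim_row U) r k) else 0)"


section \<open>Classical randomized algorithms with exact arithmetic\<close>

text \<open>
  Algorithms are finite programs for a randomized random access machine with exact complex
  arithmetic. It has two indexed memories, one for natural numbers (indices and counters) and one
  for complex numbers, a read-only input and a write-only output tape. Every operation takes unit
  time. There is no rounding and no conversion from numbers to indices, and on indices only
  addition and truncated subtraction, since such operations at unit cost are known to make exact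
  arithmetic machines unreasonably strong; for the same reason the exponential function is
  restricted to real arguments. The only random primitive is a coin whose bias is a computed
  number.
\<close>

record input =
  network :: "complex mat"
  squeezing :: real
  cutoff :: real

datatype iexp =
    IConst nat
  | Modes
  | ILoad iexp
  | IAdd iexp iexp
  | ISub iexp iexp

datatype cexp =
    OfIndex iexp
  | Network iexp iexp
  | Squeezing
  | Cutoff
  | CLoad iexp
  | CAdd cexp cexp
  | CSub cexp cexp
  | CMul cexp cexp
  | CDiv cexp cexp
  | CConj cexp
  | CExp cexp

datatype bexp =
    ILess iexp iexp
  | CLess cexp cexp
  | BNot bexp
  | BAnd bexp bexp

datatype com =
    Skip
  | IStore iexp iexp
  | CStore iexp cexp
  | Flip iexp cexp
  | Emit iexp
  | Seq com com
  | If bexp com com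
  | While bexp com

text \<open>The components \<open>steps\<close> and \<open>cells\<close> are not accessible to programs: \<open>steps\<close> is the time
  used so far, and \<open>cells\<close> is the least number such that no cell with this or a larger address has
  been written in either memory.\<close>

record state =
  imem :: "nat \<Rightarrow> nat"
  cmem :: "nat \<Rightarrow> complex"
  out :: "nat list"
  steps :: nat
  cells :: nat

fun ival :: "input \<Rightarrow> iexp \<Rightarrow> state \<Rightarrow> nat" where
  "ival P (IConst k) \<sigma> = k"
| "ival P Modes \<sigma> = dim_row (network P)"
| "ival P (ILoad a) \<sigma> = imem \<sigma> (ival P a \<sigma>)"
| "ival P (IAdd a b) \<sigma> = ival P a \<sigma> + ival P b \<sigma>"
| "ival P (ISub a b) \<sigma> = ival P a \<sigma> - ival P b \<sigma>"

fun cval :: "input \<Rightarrow> cexp \<Rightarrow> state \<Rightarrow> complex" where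
  "cval P (OfIndex a) \<sigma> = of_nat (ival P a \<sigma>)"
| "cval P (Network a b) \<sigma> =
     (if ival P a \<sigma> < dim_row (network P) \<and> ival P b \<sigma> < dim_col (network P)
      then network P $$ (ival P a \<sigma>, ival P b \<sigma>) else 0)"
| "cval P Squeezing \<sigma> = of_real (squeezing P)"
| "cval P Cutoff \<sigma> = of_real (cutoff P)"
| "cval P (CLoad a) \<sigma> = cmem \<sigma> (ival P a \<sigma>)"
| "cval P (CAdd x y) \<sigma> = cval P x \<sigma> + cval P y \<sigma>"
| "cval P (CSub x y) \<sigma> = cval P x \<sigma> - cval P y \<sigma>"
| "cval P (CMul x y) \<sigma> = cval P x \<sigma> * cval P y \<sigma>"
| "cval P (CDiv x y) \<sigma> = cval P x \<sigma> / cval P y \<sigma>"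
| "cval P (CConj x) \<sigma> = cnj (cval P x \<sigma>)"
| "cval P (CExp x) \<sigma> = of_real (exp (Re (cval P x \<sigma>)))"

fun bval :: "input \<Rightarrow> bexp \<Rightarrow> state \<Rightarrow> bool" where
  "bval P (ILess a b) \<sigma> \<longleftrightarrow> ival P a \<sigma> < ival P b \<sigma>"
| "bval P (CLess x y) \<sigma> \<longleftrightarrow> Re (cval P x \<sigma>) < Re (cval P y \<sigma>)"
| "bval P (BNot b) \<sigma> \<longleftrightarrow> \<not> bval P b \<sigma>"
| "bval P (BAnd b b') \<sigma> \<longleftrightarrow> bval P b \<sigma> \<and> bval P b' \<sigma>"

text \<open>The cost of an expression is its number of nodes.\<close>

fun icost :: "iexp \<Rightarrow> nat" where
  "icost (ILoad a) = icost a + 1"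
| "icost (IAdd a b) = icost a + icost b + 1"
| "icost (ISub a b) = icost a + icost b + 1"
| "icost _ = 1"

fun ccost :: "cexp \<Rightarrow> nat" where
  "ccost (OfIndex a) = icost a + 1"
| "ccost (Network a b) = icost a + icost b + 1"
| "ccost (CLoad a) = icost a + 1"
| "ccost (CAdd x y) = ccost x + ccost y + 1"
| "ccost (CSub x y) = ccost x + ccost y + 1"
| "ccost (CMul x y) = ccost x + ccost y + 1"
| "ccost (CDiv x y) = ccost x + ccost y + 1"
| "ccost (CConj x) = ccost x + 1"
| "ccost (CExp x) = ccost x + 1"
| "ccost _ = 1"

fun bcost :: "bexp \<Rightarrow> nat" where
  "bcost (ILess a b) = icost a + icost b + 1"
| "bcost (CLess x y) = ccost x + ccost y + 1"
| "bcost (BNot b) = bcost b + 1"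
| "bcost (BAnd b b') = bcost b + bcost b' + 1"

definition tick :: "nat \<Rightarrow> state \<Rightarrow> state" where
  "tick k \<sigma> = \<sigma>\<lparr>steps := steps \<sigma> + k\<rparr>"

definition iwrite :: "nat \<Rightarrow> nat \<Rightarrow> state \<Rightarrow> state" where
  "iwrite a v \<sigma> = \<sigma>\<lparr>imem := (imem \<sigma>)(a := v), cells := max (cells \<sigma>) (a + 1)\<rparr>"

definition cwrite :: "nat \<Rightarrow> complex \<Rightarrow> state \<Rightarrow> state" where
  "cwrite a v \<sigma> = \<sigma>\<lparr>cmem := (cmem \<sigma>)(a := v), cells := max (cells \<sigma>) (a + 1)\<rparr>"

text \<open>
  \<open>exec P p \<sigma> D\<close>: on input \<open>P\<close>, program \<open>p\<close> started in state \<open>\<sigma>\<close> terminates for all outcomes of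
  its coin flips, and \<open>D\<close> is the distribution of its final state. The bias of a coin is clamped to
  the unit interval by \<open>bernoulli_pmf\<close>.
\<close>

inductive exec :: "input \<Rightarrow> com \<Rightarrow> state \<Rightarrow> state pmf \<Rightarrow> bool" for P :: input where
  Skip: "exec P Skip \<sigma> (return_pmf (tick 1 \<sigma>))"
| IStore: "exec P (IStore a e) \<sigma>
     (return_pmf (tick (icost a + icost e + 1) (iwrite (ival P a \<sigma>) (ival P e \<sigma>) \<sigma>)))"
| CStore: "exec P (CStore a x) \<sigma>
     (return_pmf (tick (icost a + ccost x + 1) (cwrite (ival P a \<sigma>) (cval P x \<sigma>) \<sigma>)))"
| Flip: "exec P (Flip a x) \<sigma>
     (map_pmf (\<lambda>b. tick (icost a + ccost x + 1) (iwrite (ival P a \<sigma>) (of_bool b) \<sigma>))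
        (bernoulli_pmf (Re (cval P x \<sigma>))))"
| Emit: "exec P (Emit e) \<sigma>
     (return_pmf (tick (icost e + 1) (\<sigma>\<lparr>out := out \<sigma> @ [ival P e \<sigma>]\<rparr>)))"
| Seq: "exec P p \<sigma> D \<Longrightarrow> (\<And>\<tau>. \<tau> \<in> set_pmf D \<Longrightarrow> exec P q \<tau> (K \<tau>))
     \<Longrightarrow> exec P (Seq p q) \<sigma> (bind_pmf D K)"
| IfTrue: "bval P b \<sigma> \<Longrightarrow> exec P p (tick (Suc (bcost b)) \<sigma>) D \<Longrightarrow> exec P (If b p q) \<sigma> D"
| IfFalse: "\<not> bval P b \<sigma> \<Longrightarrow> exec P q (tick (Suc (bcost b)) \<sigma>) D \<Longrightarrow> exec P (If b p q) \<sigma> D"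
| WhileFalse: "\<not> bval P b \<sigma>
     \<Longrightarrow> exec P (While b p) \<sigma> (return_pmf (tick (Suc (bcost b)) \<sigma>))"
| WhileTrue: "bval P b \<sigma> \<Longrightarrow> exec P p (tick (Suc (bcost b)) \<sigma>) D
     \<Longrightarrow> (\<And>\<tau>. \<tau> \<in> set_pmf D \<Longrightarrow> exec P (While b p) \<tau> (K \<tau>))
     \<Longrightarrow> exec P (While b p) \<sigma> (bind_pmf D K)"

inductive_cases exec_SkipE: "exec P Skip \<sigma> D"
inductive_cases exec_IStoreE: "exec P (IStore a e) \<sigma> D"
inductive_cases exec_CStoreE: "exec P (CStore a x) \<sigma> D"
inductive_cases exec_FlipE: "exec P (Flip a x) \<sigma> D"
inductive_cases exec_EmitE: "exec P (Emit e) \<sigma> D"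
inductive_cases exec_SeqE: "exec P (Seq p q) \<sigma> D"
inductive_cases exec_IfE: "exec P (If b p q) \<sigma> D"
inductive_cases exec_WhileE: "exec P (While b p) \<sigma> D"

lemma exec_unique: "exec P p \<sigma> D \<Longrightarrow> exec P p \<sigma> D' \<Longrightarrow> D = D'"
proof (induction arbitrary: D' rule: exec.induct)
  case (Skip \<sigma>)
  then show ?case by (rule exec_SkipE) simp
next
  case (IStore a e \<sigma>)
  then show ?case by (rule exec_IStoreE) simp
next
  case (CStore a x \<sigma>)
  then show ?case by (rule exec_CStoreE) simp
next
  case (Flip a x \<sigma>)
  then show ?case by (rule exec_FlipE) simp
next
  case (Emit e \<sigma>)
  then show ?case by (rule exec_EmitE) simp
next
  case (Seq p \<sigma> D q K)
  from Seq.prems show ?case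
  proof (rule exec_SeqE)
    fix E L
    assume E: "D' = bind_pmf E L" "exec P p \<sigma> E" "\<And>\<tau>. \<tau> \<in> set_pmf E \<Longrightarrow> exec P q \<tau> (L \<tau>)"
    have "D = E" using E(2) by (rule Seq.IH(1))
    then show ?thesis
      unfolding E(1) using E(3) by (intro bind_pmf_cong Seq.IH(2)) simp_all
  qed
next
  case (IfTrue b \<sigma> p D q)
  from IfTrue.prems show ?case
  proof (rule exec_IfE)
    assume "exec P p (tick (Suc (bcost b)) \<sigma>) D'"
    then show ?thesis by (rule IfTrue.IH)
  qed (use IfTrue.hyps(1) in simp)
next
  case (IfFalse b \<sigma> q D p)
  from IfFalse.prems show ?case
  proof (rule exec_IfE)
    assume "exec P q (tick (Suc (bcost b)) \<sigma>) D'"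
    then show ?thesis by (rule IfFalse.IH)
  qed (use IfFalse.hyps(1) in simp)
next
  case (WhileFalse b \<sigma> p)
  from WhileFalse.prems show ?case
    by (rule exec_WhileE) (use WhileFalse.hyps in simp_all)
next
  case (WhileTrue b \<sigma> p D K)
  from WhileTrue.prems show ?case
  proof (rule exec_WhileE)
    fix E L
    assume E: "D' = bind_pmf E L" "exec P p (tick (Suc (bcost b)) \<sigma>) E"
      "\<And>\<tau>. \<tau> \<in> set_pmf E \<Longrightarrow> exec P (While b p) \<tau> (L \<tau>)"
    have "D = E" using E(2) by (rule WhileTrue.IH(1))
    then show ?thesis
      unfolding E(1) using E(3) by (intro bind_pmf_cong WhileTrue.IH(2)) simp_all
  qed (use WhileTrue.hyps(1) in simp)
qed

text \<open>Initial state with argument \<open>n\<close>, which is passed in index cell 0.\<close>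

definition start :: "nat \<Rightarrow> state" where
  "start n = \<lparr>imem = (\<lambda>_. 0)(0 := n), cmem = (\<lambda>_. 0), out = [], steps = 0, cells = 0\<rparr>"

text \<open>Started in \<open>\<sigma>\<close>, the program produces a result \<open>x\<close> with probability \<open>f x\<close>; every run ending
  with result \<open>x\<close> takes at most \<open>T x\<close> steps and at most \<open>S x\<close> memory cells.\<close>

definition samples ::
  "input \<Rightarrow> com \<Rightarrow> state \<Rightarrow> (state \<Rightarrow> 'a) \<Rightarrow> ('a \<Rightarrow> real) \<Rightarrow> ('a \<Rightarrow> real) \<Rightarrow> ('a \<Rightarrow> real) \<Rightarrow> bool"
where
  "samples P p \<sigma> result f T S \<longleftrightarrow>
     (\<exists>D. exec P p \<sigma> D
        \<and> (\<forall>x. pmf (map_pmf result D) x = f x)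
        \<and> (\<forall>\<tau>\<in>set_pmf D. real (steps \<tau>) \<le> T (result \<tau>) \<and> real (cells \<tau>) \<le> S (result \<tau>)))"

text \<open>The bound \<open>poly(n) 2^(a n)\<close> for sampling \<open>n\<close> photons, where the input of \<open>m\<^sup>2\<close> matrix entries
  may in addition be read \<open>poly(n)\<close> times. Some dependence on \<open>m\<close> is unavoidable: already for two
  photons the output distribution depends on all entries of a row of the matrix.\<close>

definition config_time :: "real poly \<Rightarrow> real \<Rightarrow> nat \<Rightarrow> nat \<Rightarrow> real" where
  "config_time p a m n = poly p (real n) * ((real m)\<^sup>2 + 2 powr (a * real n))"

end

theory Submission
  imports Defs "HOL-Library.Nat_Bijection" "HOL-Combinatorics.Multiset_Permutations"
begin

text \<open>
  Photons are resampled one at a time, as in the algorithm of Clifford and Clifford for boson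
  sampling. Give the \<open>n\<close> photons first-quantized slots. In the input modes the amplitude of a slot
  assignment is the number of perfect matchings of equal modes, and its squared modulus is the law of
  a Polya urn. Applying \<open>U\<close> to one slot is unitary, so it preserves the total weight of all
  assignments that agree in the other slots; hence forgetting the input mode of slot \<open>k\<close> and drawing
  an output mode with probability proportional to the new squared amplitude gives the exact law
  with one more slot in the output modes. After \<open>n\<close> steps the amplitude is the Hafnian of \<open>W\<^sub>s\<close>.

  The amplitude is linear in the row of slot \<open>k\<close>, with coefficients that are Hafnians on \<open>n - 2\<close>
  points. All of them come from a single sum over the \<open>2\<^sup>n\<close> sets of slots, because the alternating sum of
  the powers of the quadratic form \<open>\<Sum>\<^sub>i\<^sub>j V i j\<close> over subsets leaves only perfect matchings. With the
  form computed as \<open>\<Sum>\<^sub>l (\<Sum>\<^sub>i A i l)\<^sup>2\<close>, a step takes time \<open>poly(n) (m\<^sup>2 + m 2\<^sup>n)\<close>, and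
  \<open>2 m 2\<^sup>n \<le> m\<^sup>2 + 4\<^sup>n\<close>; the memory is linear in \<open>n\<close>, so one program meets both bounds.
\<close>

section \<open>Hafnians and inclusion-exclusion\<close>

definition hafnian :: "(nat \<Rightarrow> nat \<Rightarrow> complex) \<Rightarrow> nat set \<Rightarrow> complex" where
  "hafnian V A = (\<Sum>M\<in>perfect_matchings A. \<Prod>e\<in>M. V (Min e) (Max e))"

lemma perfect_matchings_empty [simp]: "perfect_matchings {} = {{}}"
  by (auto simp: perfect_matchings_def partition_on_def)

lemma finite_perfect_matchings:
  assumes "finite A" shows "finite (perfect_matchings A)"
proof (rule finite_subset)
  show "perfect_matchings A \<subseteq> Pow (Pow A)"
    by (auto simp: perfect_matchings_def partition_on_def)
qed (use assms in simp)

lemma perfect_matchings_insert: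
  assumes "k \<notin> A"
  shows "perfect_matchings (insert k A)
    = (\<Union>x\<in>A. insert {k, x} ` perfect_matchings (A - {x}))"
proof (intro subset_antisym subsetI)
  fix M assume M: "M \<in> perfect_matchings (insert k A)"
  then have p: "partition_on (insert k A) M" and c: "\<And>e. e \<in> M \<Longrightarrow> card e = 2"
    by (auto simp: perfect_matchings_def)
  from p obtain e where e: "e \<in> M" "k \<in> e"
    by (auto simp: partition_on_def)
  obtain x where x: "e = {k, x}" "x \<noteq> k"
    using c[OF e(1)] e(2) by (auto simp: card_2_iff doubleton_eq_iff)
  have "e \<subseteq> insert k A" using p e(1) unfolding partition_on_def by blast
  then have xA: "x \<in> A" using x by blast
  have "disjnt e e'" if "e' \<in> M - {e}" for e'
    using disjointD[OF partition_onD2[OF p] e(1)] that by (auto simp: disjnt_def)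
  then have "disjnt e (\<Union> (M - {e}))" by (auto simp: disjnt_iff)
  moreover have "insert e (M - {e}) = M" using e(1) by (rule insert_Diff)
  ultimately have "partition_on (insert k A - e) (M - {e})"
    using p partition_on_insert[of e "M - {e}" "insert k A"] by simp
  moreover have "insert k A - e = A - {x}" using x assms by auto
  ultimately have "M - {e} \<in> perfect_matchings (A - {x})"
    using c by (auto simp: perfect_matchings_def)
  moreover have "M = insert {k, x} (M - {e})" using e x by auto
  ultimately show "M \<in> (\<Union>x\<in>A. insert {k, x} ` perfect_matchings (A - {x}))"
    using xA by blast
next
  fix M assume "M \<in> (\<Union>x\<in>A. insert {k, x} ` perfect_matchings (A - {x}))"
  then obtain x M' where x: "x \<in> A" "M' \<in> perfect_matchings (A - {x})" "M = insert {k, x} M'"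
    by auto
  have kx: "k \<noteq> x" using x(1) assms by auto
  have "partition_on (insert k A) M"
    unfolding x(3)
  proof (subst partition_on_insert)
    show "disjnt {k, x} (\<Union> M')"
      using x assms by (auto simp: perfect_matchings_def partition_on_def disjnt_def)
    have "insert k A - {k, x} = A - {x}" using assms kx by auto
    with x show "partition_on (insert k A - {k, x}) M' \<and> {k, x} \<subseteq> insert k A \<and> {k, x} \<noteq> {}"
      by (auto simp: perfect_matchings_def)
  qed
  then show "M \<in> perfect_matchings (insert k A)"
    using x kx by (auto simp: perfect_matchings_def)
qed

lemma hafnian_expand:
  assumes sym: "\<And>i j. V i j = V j i" and fin: "finite A" and k: "k \<in> A"
  shows "hafnian V A = (\<Sum>x\<in>A - {k}. V k x * hafnian V (A - {k, x}))"
proof -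
  define B where "B = A - {k}"
  have B: "finite B" "k \<notin> B" "A = insert k B" using fin k by (auto simp: B_def)
  have no: "{k, x} \<notin> M" if "M \<in> perfect_matchings (B - {y})" for x y M
    using that B(2) by (auto simp: perfect_matchings_def partition_on_def)
  have inj: "inj_on (insert {k, x}) (perfect_matchings (B - {x}))" for x
    using no unfolding inj_on_def by (metis insert_ident)
  have disj: "insert {k, x} ` perfect_matchings (B - {x})
      \<inter> insert {k, y} ` perfect_matchings (B - {y}) = {}" if "x \<noteq> y" for x y
  proof (rule ccontr)
    assume "\<not> ?thesis"
    then obtain M M' where M: "M \<in> perfect_matchings (B - {x})" "M' \<in> perfect_matchings (B - {y})"
      "insert {k, x} M = insert {k, y} M'" by auto
    then have "{k, x} \<in> insert {k, y} M'" by blast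
    then show False using no[OF M(2)] that by (auto simp: doubleton_eq_iff)
  qed
  have edge: "V (Min {k, x}) (Max {k, x}) = V k x" for x
    using sym by (cases "k \<le> x") (auto simp: min_def max_def)
  have "hafnian V A = (\<Sum>x\<in>B. \<Sum>M\<in>insert {k, x} ` perfect_matchings (B - {x}).
      \<Prod>e\<in>M. V (Min e) (Max e))"
    unfolding hafnian_def B(3) perfect_matchings_insert[OF B(2)]
    using B(1) disj by (intro sum.UNION_disjoint) (auto intro!: finite_perfect_matchings)
  also have "\<dots> = (\<Sum>x\<in>B. \<Sum>M\<in>perfect_matchings (B - {x}).
      \<Prod>e\<in>insert {k, x} M. V (Min e) (Max e))"
    by (intro sum.cong refl sum.reindex[OF inj, unfolded comp_def])
  also have "\<dots> = (\<Sum>x\<in>B. \<Sum>M\<in>perfect_matchings (B - {x}).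
      V k x * (\<Prod>e\<in>M. V (Min e) (Max e)))"
  proof (intro sum.cong refl)
    fix x M assume M: "x \<in> B" "M \<in> perfect_matchings (B - {x})"
    have "finite M"
      using M B(1) finite_elements[of "B - {x}" M] by (auto simp: perfect_matchings_def)
    then show "(\<Prod>e\<in>insert {k, x} M. V (Min e) (Max e)) = V k x * (\<Prod>e\<in>M. V (Min e) (Max e))"
      using no[OF M(2)] edge by simp
  qed
  also have "\<dots> = (\<Sum>x\<in>B. V k x * hafnian V (A - {k, x}))"
    unfolding hafnian_def sum_distrib_left B(3)
    using B(2) by (intro sum.cong) (auto intro!: arg_cong[of _ _ perfect_matchings])
  finally show ?thesis unfolding B_def .
qed

lemma hafnian_cong:
  assumes "\<And>i j. i \<in> A \<Longrightarrow> j \<in> A \<Longrightarrow> V i j = V' i j"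
  shows "hafnian V A = hafnian V' A"
  unfolding hafnian_def
proof (intro sum.cong prod.cong refl)
  fix M e assume "M \<in> perfect_matchings A" "e \<in> M"
  then have "card e = 2" "e \<subseteq> A" by (auto simp: perfect_matchings_def partition_on_def)
  moreover from this have "finite e" "e \<noteq> {}" by (auto intro: card_ge_0_finite)
  ultimately show "V (Min e) (Max e) = V' (Min e) (Max e)"
    by (intro assms) (meson Min_in Max_in subsetD)+
qed

lemma hafnian_empty [simp]: "hafnian V {} = 1"
  by (simp add: hafnian_def)

lemma hafnian_image:
  assumes sym: "\<And>i j. V i j = V j i" and "finite A" "inj_on f A"
  shows "hafnian V (f ` A) = hafnian (\<lambda>i j. V (f i) (f j)) A"
  using assms(2,3)
proof (induction "card A" arbitrary: A rule: less_induct)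
  case less
  show ?case
  proof (cases "A = {}")
    case False
    then obtain k where k: "k \<in> A" by auto
    have "hafnian V (f ` A) = (\<Sum>x\<in>f ` A - {f k}. V (f k) x * hafnian V (f ` A - {f k, x}))"
      by (rule hafnian_expand) (use sym less k in auto)
    also have "f ` A - {f k} = f ` (A - {k})"
      using less.prems k by (auto simp: inj_on_def)
    also have "(\<Sum>x\<in>f ` (A - {k}). V (f k) x * hafnian V (f ` A - {f k, x}))
        = (\<Sum>x\<in>A - {k}. V (f k) (f x) * hafnian V (f ` A - {f k, f x}))"
      by (rule sum.reindex[unfolded comp_def]) (use less.prems in \<open>auto simp: inj_on_def\<close>)
    also have "\<dots> = (\<Sum>x\<in>A - {k}. V (f k) (f x) * hafnian (\<lambda>i j. V (f i) (f j)) (A - {k, x}))"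
    proof (intro sum.cong refl)
      fix x assume x: "x \<in> A - {k}"
      have "f ` A - {f k, f x} = f ` (A - {k, x})"
        using less.prems k x by (auto simp: inj_on_def)
      moreover have "card (A - {k, x}) < card A"
        using less.prems k by (intro psubset_card_mono) auto
      ultimately show "V (f k) (f x) * hafnian V (f ` A - {f k, f x})
          = V (f k) (f x) * hafnian (\<lambda>i j. V (f i) (f j)) (A - {k, x})"
        using less.hyps[of "A - {k, x}"] less.prems by (auto simp: inj_on_diff)
    qed
    also have "\<dots> = hafnian (\<lambda>i j. V (f i) (f j)) A"
      by (rule hafnian_expand[symmetric]) (use sym less k in auto)
    finally show ?thesis .
  qed simp
qed

lemma sum_alternating_supersets:
  fixes F :: "nat set \<Rightarrow> complex"
  assumes "finite A" "B \<subseteq> A"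
  shows "(\<Sum>S\<in>Pow A. (-1) ^ card S * (of_bool (B \<subseteq> S) * F S))
    = (-1) ^ card B * (\<Sum>S\<in>Pow (A - B). (-1) ^ card S * F (S \<union> B))"
proof -
  have "(\<Sum>S\<in>Pow A. (-1) ^ card S * (of_bool (B \<subseteq> S) * F S))
      = (\<Sum>S\<in>{S \<in> Pow A. B \<subseteq> S}. (-1) ^ card S * F S)"
    using assms by (intro sum.mono_neutral_cong_right) auto
  also have "\<dots> = (\<Sum>S\<in>Pow (A - B). (-1) ^ card (S \<union> B) * F (S \<union> B))"
    by (rule sum.reindex_bij_witness[of _ "\<lambda>S. S \<union> B" "\<lambda>S. S - B"])
      (use assms in \<open>auto simp: Un_absorb2\<close>)
  also have "\<dots> = (\<Sum>S\<in>Pow (A - B). (-1) ^ card B * ((-1) ^ card S * F (S \<union> B)))"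
  proof (intro sum.cong refl)
    fix S assume "S \<in> Pow (A - B)"
    then have "card (S \<union> B) = card S + card B"
      using assms by (intro card_Un_disjoint) (auto dest: finite_subset)
    then show "(-1) ^ card (S \<union> B) * F (S \<union> B) = (-1) ^ card B * ((-1) ^ card S * F (S \<union> B))"
      by (simp add: power_add)
  qed
  finally show ?thesis by (simp add: sum_distrib_left)
qed

definition alternating_power_sum ::
  "(nat \<Rightarrow> nat \<Rightarrow> complex) \<Rightarrow> nat set \<Rightarrow> nat set \<Rightarrow> nat \<Rightarrow> complex" where
  "alternating_power_sum V A T p
     = (\<Sum>S\<in>Pow A. (-1) ^ card S * (\<Sum>i\<in>S \<union> T. \<Sum>j\<in>S \<union> T. V i j) ^ p)"

lemma alternating_power_sum_Suc:
  assumes "finite A" "finite T" "A \<inter> T = {}"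
  shows "alternating_power_sum V A T (Suc p)
    = (\<Sum>i\<in>A \<union> T. \<Sum>j\<in>A \<union> T. V i j * ((-1) ^ card (A \<inter> {i, j})
         * alternating_power_sum V (A - {i, j}) (T \<union> (A \<inter> {i, j})) p))"
proof -
  let ?Q = "\<lambda>S. \<Sum>i\<in>S \<union> T. \<Sum>j\<in>S \<union> T. V i j"
  have Q: "?Q S = (\<Sum>i\<in>A \<union> T. \<Sum>j\<in>A \<union> T. V i j * of_bool (A \<inter> {i, j} \<subseteq> S))"
    if "S \<in> Pow A" for S
  proof -
    have fin: "finite (A \<union> T)" and sub: "S \<union> T \<subseteq> A \<union> T" using assms that by auto
    have "?Q S = (\<Sum>i\<in>A \<union> T. \<Sum>j\<in>A \<union> T. V i j * of_bool (i \<in> S \<union> T \<and> j \<in> S \<union> T))"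
    proof -
      have "(\<Sum>i\<in>A \<union> T. \<Sum>j\<in>A \<union> T. V i j * of_bool (i \<in> S \<union> T \<and> j \<in> S \<union> T))
          = (\<Sum>i\<in>S \<union> T. \<Sum>j\<in>A \<union> T. V i j * of_bool (i \<in> S \<union> T \<and> j \<in> S \<union> T))"
        by (rule sum.mono_neutral_right) (use fin sub in auto)
      also have "\<dots> = ?Q S"
        by (rule sum.cong[OF refl], rule sum.mono_neutral_cong_right) (use fin sub in auto)
      finally show ?thesis by simp
    qed
    also have "\<dots> = (\<Sum>i\<in>A \<union> T. \<Sum>j\<in>A \<union> T. V i j * of_bool (A \<inter> {i, j} \<subseteq> S))"
      using assms(3) that by (intro sum.cong refl) auto
    finally show ?thesis .
  qed
  have "alternating_power_sum V A T (Suc p) = (\<Sum>S\<in>Pow A. \<Sum>i\<in>A \<union> T. \<Sum>j\<in>A \<union> T.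
      V i j * ((-1) ^ card S * (of_bool (A \<inter> {i, j} \<subseteq> S) * ?Q S ^ p)))"
    unfolding alternating_power_sum_def
  proof (intro sum.cong refl)
    fix S assume S: "S \<in> Pow A"
    have "?Q S ^ Suc p = (\<Sum>i\<in>A \<union> T. \<Sum>j\<in>A \<union> T. V i j * of_bool (A \<inter> {i, j} \<subseteq> S)) * ?Q S ^ p"
      by (simp only: power_Suc Q[OF S])
    also have "\<dots> = (\<Sum>i\<in>A \<union> T. \<Sum>j\<in>A \<union> T. V i j * (of_bool (A \<inter> {i, j} \<subseteq> S) * ?Q S ^ p))"
      by (simp only: sum_distrib_right mult.assoc)
    finally show "(-1) ^ card S * ?Q S ^ Suc p = (\<Sum>i\<in>A \<union> T. \<Sum>j\<in>A \<union> T.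
        V i j * ((-1) ^ card S * (of_bool (A \<inter> {i, j} \<subseteq> S) * ?Q S ^ p)))"
      by (simp only: sum_distrib_left mult.left_commute)
  qed
  also have "\<dots> = (\<Sum>i\<in>A \<union> T. \<Sum>j\<in>A \<union> T. V i j * (\<Sum>S\<in>Pow A.
      (-1) ^ card S * (of_bool (A \<inter> {i, j} \<subseteq> S) * ?Q S ^ p)))"
  proof -
    have swap: "(\<Sum>S\<in>X. \<Sum>i\<in>Y. \<Sum>j\<in>Y. f i j * g S i j) = (\<Sum>i\<in>Y. \<Sum>j\<in>Y. f i j * (\<Sum>S\<in>X. g S i j))"
      for X :: "nat set set" and Y :: "nat set" and f :: "nat \<Rightarrow> nat \<Rightarrow> complex" and g
      unfolding sum_distrib_left by (subst sum.swap, rule sum.cong[OF refl], rule sum.swap)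
    show ?thesis by (rule swap)
  qed
  also have "\<dots> = (\<Sum>i\<in>A \<union> T. \<Sum>j\<in>A \<union> T. V i j * ((-1) ^ card (A \<inter> {i, j})
         * alternating_power_sum V (A - {i, j}) (T \<union> (A \<inter> {i, j})) p))"
  proof (intro sum.cong refl arg_cong[of _ _ "(*) (V _ _)"])
    fix i j
    have "A - A \<inter> {i, j} = A - {i, j}" by auto
    then show "(\<Sum>S\<in>Pow A. (-1) ^ card S * (of_bool (A \<inter> {i, j} \<subseteq> S) * ?Q S ^ p))
      = (-1) ^ card (A \<inter> {i, j}) * alternating_power_sum V (A - {i, j}) (T \<union> (A \<inter> {i, j})) p"
      using sum_alternating_supersets[OF assms(1), of "A \<inter> {i, j}" "\<lambda>S. ?Q S ^ p"]
      by (simp add: alternating_power_sum_def Un_ac)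
  qed
  finally show ?thesis .
qed

lemma sum_alternating_Pow:
  assumes "finite A" "A \<noteq> {}"
  shows "(\<Sum>S\<in>Pow A. (-1) ^ card S :: complex) = 0"
proof -
  obtain k where k: "k \<in> A" using assms by auto
  have A: "A = insert k (A - {k})" using k by auto
  have "(\<Sum>S\<in>Pow A. (-1) ^ card S :: complex)
      = (\<Sum>S\<in>Pow (A - {k}). (-1) ^ card S) + (\<Sum>S\<in>insert k ` Pow (A - {k}). (-1) ^ card S)"
    by (subst A, subst Pow_insert, rule sum.union_disjoint) (use assms in auto)
  also have "(\<Sum>S\<in>insert k ` Pow (A - {k}). (-1) ^ card S :: complex)
      = (\<Sum>S\<in>Pow (A - {k}). (-1) ^ card (insert k S))"
    by (rule sum.reindex[unfolded comp_def]) (auto simp: inj_on_def)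
  also have "\<dots> = (\<Sum>S\<in>Pow (A - {k}). - ((-1) ^ card S))"
  proof (intro sum.cong refl)
    fix S assume S: "S \<in> Pow (A - {k})"
    then have "finite S" using assms(1) by (auto dest: finite_subset)
    with S show "(-1) ^ card (insert k S) = - ((-1) ^ card S :: complex)"
      by (subst card_insert_disjoint) auto
  qed
  finally show ?thesis by (simp add: sum_negf)
qed

lemma alternating_power_sum_eq_0:
  assumes "finite A" "finite T" "A \<inter> T = {}" "card A > 2 * p"
  shows "alternating_power_sum V A T p = 0"
  using assms
proof (induction p arbitrary: A T)
  case 0
  then show ?case by (simp add: alternating_power_sum_def sum_alternating_Pow card_gt_0_iff)
next
  case (Suc p)
  have "alternating_power_sum V (A - {i, j}) (T \<union> (A \<inter> {i, j})) p = 0" for i j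
  proof (rule Suc.IH)
    have "card {i, j} \<le> 2" by (simp add: card_insert_if)
    then show "2 * p < card (A - {i, j})"
      using Suc.prems diff_card_le_card_Diff[of "{i, j}" A] by simp
  qed (use Suc.prems in auto)
  then show ?case using Suc.prems by (simp add: alternating_power_sum_Suc)
qed

lemma alternating_power_sum_eq_hafnian:
  assumes sym: "\<And>i j. V i j = V j i"
    and "finite A" "finite T" "A \<inter> T = {}" "card A = 2 * p"
  shows "alternating_power_sum V A T p = 2 ^ p * fact p * hafnian V A"
  using assms(2-)
proof (induction p arbitrary: A T)
  case 0
  then show ?case by (simp add: alternating_power_sum_def)
next
  case (Suc p)
  let ?t = "\<lambda>i j. V i j * ((-1) ^ card (A \<inter> {i, j})
         * alternating_power_sum V (A - {i, j}) (T \<union> (A \<inter> {i, j})) p)"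
  have zero: "?t i j = 0" if "\<not> (i \<in> A \<and> j \<in> A - {i})" for i j
  proof -
    have "card (A \<inter> {i, j}) \<le> 1"
    proof -
      have "A \<inter> {i, j} \<subseteq> {i} \<or> A \<inter> {i, j} \<subseteq> {j}" using that by auto
      then show ?thesis using card_mono[of "{i}" "A \<inter> {i, j}"] card_mono[of "{j}" "A \<inter> {i, j}"] by auto
    qed
    moreover have "card (A - {i, j}) = card A - card (A \<inter> {i, j})"
      by (metis Suc.prems(1) card_Diff_subset_Int finite_Int)
    ultimately have "alternating_power_sum V (A - {i, j}) (T \<union> (A \<inter> {i, j})) p = 0"
      by (intro alternating_power_sum_eq_0) (use Suc.prems in auto)
    then show ?thesis by simp
  qed
  have main: "?t i j = 2 ^ p * fact p * (V i j * hafnian V (A - {i, j}))"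
    if "i \<in> A" "j \<in> A - {i}" for i j
  proof -
    have "card (A - {i, j}) = card A - card {i, j}"
      using that Suc.prems by (intro card_Diff_subset) auto
    moreover have c: "card {i, j} = 2" using that by auto
    moreover have "A \<inter> {i, j} = {i, j}" using that by auto
    ultimately have "alternating_power_sum V (A - {i, j}) (T \<union> {i, j}) p
        = 2 ^ p * fact p * hafnian V (A - {i, j})"
      using Suc.prems by (intro Suc.IH) auto
    with c show ?thesis using that by (simp add: Int_absorb1)
  qed
  have "alternating_power_sum V A T (Suc p) = (\<Sum>i\<in>A \<union> T. \<Sum>j\<in>A \<union> T. ?t i j)"
    using Suc.prems by (intro alternating_power_sum_Suc) auto
  also have "\<dots> = (\<Sum>i\<in>A. \<Sum>j\<in>A \<union> T. ?t i j)"
    by (rule sum.mono_neutral_right, (use Suc.prems in auto)[2], intro ballI sum.neutral zero) auto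
  also have "\<dots> = (\<Sum>i\<in>A. \<Sum>j\<in>A - {i}. ?t i j)"
    by (rule sum.cong[OF refl], rule sum.mono_neutral_right, (use Suc.prems in auto)[2], intro ballI zero) auto
  also have "\<dots> = (\<Sum>i\<in>A. \<Sum>j\<in>A - {i}. 2 ^ p * fact p * (V i j * hafnian V (A - {i, j})))"
    by (intro sum.cong refl main)
  also have "\<dots> = (\<Sum>i\<in>A. 2 ^ p * fact p * hafnian V A)"
    by (rule sum.cong[OF refl])
      (simp only: hafnian_expand[where V = V, OF sym Suc.prems(1), symmetric] flip: sum_distrib_left)
  also have "\<dots> = 2 ^ Suc p * fact (Suc p) * hafnian V A"
    using Suc.prems by (simp add: algebra_simps)
  finally show ?case .
qed

section \<open>Running programs\<close>

definition mem_state :: "(nat \<Rightarrow> nat) \<Rightarrow> (nat \<Rightarrow> complex) \<Rightarrow> nat list \<Rightarrow> state" where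
  "mem_state I C W = \<lparr>imem = I, cmem = C, out = W, steps = 0, cells = 0\<rparr>"

lemma mem_state_simps [simp]:
  "imem (mem_state I C W) = I" "cmem (mem_state I C W) = C" "out (mem_state I C W) = W"
  by (simp_all add: mem_state_def)

lemma ival_mem_state: "ival P a \<sigma> = ival P a (mem_state (imem \<sigma>) (cmem \<sigma>) (out \<sigma>))"
  by (induction a) simp_all

lemma cval_mem_state: "cval P x \<sigma> = cval P x (mem_state (imem \<sigma>) (cmem \<sigma>) (out \<sigma>))"
proof (induction x)
  case (OfIndex a)
  show ?case using ival_mem_state[of P a \<sigma>] by simp
next
  case (Network a b)
  show ?case using ival_mem_state[of P a \<sigma>] ival_mem_state[of P b \<sigma>] by simp
next
  case (CLoad a)
  show ?case using ival_mem_state[of P a \<sigma>] by simp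
qed simp_all

lemma bval_mem_state: "bval P b \<sigma> = bval P b (mem_state (imem \<sigma>) (cmem \<sigma>) (out \<sigma>))"
proof (induction b)
  case (ILess a b)
  show ?case using ival_mem_state[of P a \<sigma>] ival_mem_state[of P b \<sigma>] by simp
next
  case (CLess a b)
  show ?case using cval_mem_state[of P a \<sigma>] cval_mem_state[of P b \<sigma>] by simp
qed simp_all

type_synonym 'a view = "(nat \<Rightarrow> nat) \<Rightarrow> (nat \<Rightarrow> complex) \<Rightarrow> nat list \<Rightarrow> 'a"

definition ends_with ::
  "nat \<Rightarrow> nat \<Rightarrow> state \<Rightarrow> 'a view \<Rightarrow> 'a pmf \<Rightarrow> bool view \<Rightarrow> state pmf \<Rightarrow> bool" where
  "ends_with B T \<sigma> f E Q D \<longleftrightarrow> map_pmf (\<lambda>\<tau>. f (imem \<tau>) (cmem \<tau>) (out \<tau>)) D = E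
     \<and> (\<forall>\<tau>\<in>set_pmf D. Q (imem \<tau>) (cmem \<tau>) (out \<tau>)
          \<and> steps \<tau> \<le> steps \<sigma> + T \<and> cells \<tau> \<le> max (cells \<sigma>) B)"

text \<open>\<open>I\<close>, \<open>C\<close> and \<open>W\<close> are the initial index memory, complex memory and output; \<open>T\<close> bounds the
  time and \<open>B\<close> the addresses that are written. The clock and the cell count are hidden from \<open>f\<close> and
  \<open>Q\<close>, so that invariants need not mention them.\<close>

definition run_dist ::
  "input \<Rightarrow> nat \<Rightarrow> com \<Rightarrow> nat \<Rightarrow> ('a view \<Rightarrow> 'a pmf \<Rightarrow> bool view \<Rightarrow> bool) view" where
  "run_dist P B p T I C W f E Q \<longleftrightarrow> (\<forall>\<sigma>. imem \<sigma> = I \<and> cmem \<sigma> = C \<and> out \<sigma> = W \<longrightarrow>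
     (\<exists>D. exec P p \<sigma> D \<and> ends_with B T \<sigma> f E Q D))"

definition run :: "input \<Rightarrow> nat \<Rightarrow> com \<Rightarrow> nat \<Rightarrow> (bool view \<Rightarrow> bool) view" where
  "run P B p T I C W Q \<longleftrightarrow> run_dist P B p T I C W (\<lambda>_ _ _. ()) (return_pmf ()) Q"

lemma run_distD:
  assumes "run_dist P B p T I C W f E Q" "imem \<sigma> = I" "cmem \<sigma> = C" "out \<sigma> = W"
  obtains D where "exec P p \<sigma> D" "map_pmf (\<lambda>\<tau>. f (imem \<tau>) (cmem \<tau>) (out \<tau>)) D = E"
    "\<And>\<tau>. \<tau> \<in> set_pmf D \<Longrightarrow> Q (imem \<tau>) (cmem \<tau>) (out \<tau>)"
    "\<And>\<tau>. \<tau> \<in> set_pmf D \<Longrightarrow> steps \<tau> \<le> steps \<sigma> + T"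
    "\<And>\<tau>. \<tau> \<in> set_pmf D \<Longrightarrow> cells \<tau> \<le> max (cells \<sigma>) B"
  using assms unfolding run_dist_def ends_with_def by blast

lemma run_distI:
  assumes "\<And>\<sigma>. imem \<sigma> = I \<Longrightarrow> cmem \<sigma> = C \<Longrightarrow> out \<sigma> = W \<Longrightarrow>
     \<exists>D. exec P p \<sigma> D \<and> ends_with B T \<sigma> f E Q D"
  shows "run_dist P B p T I C W f E Q"
  using assms unfolding run_dist_def by blast

lemma run_dist_map:
  assumes "run_dist P B p T I C W f E Q" "T \<le> T'"
    and "\<And>I C W. Q I C W \<Longrightarrow> f I C W \<in> set_pmf E \<Longrightarrow> Q' I C W \<and> g I C W = h (f I C W)"
  shows "run_dist P B p T' I C W g (map_pmf h E) Q'"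
proof (rule run_distI)
  fix \<sigma> :: state assume "imem \<sigma> = I" "cmem \<sigma> = C" "out \<sigma> = W"
  from assms(1) this obtain D where D: "exec P p \<sigma> D"
    "map_pmf (\<lambda>\<tau>. f (imem \<tau>) (cmem \<tau>) (out \<tau>)) D = E"
    "\<And>\<tau>. \<tau> \<in> set_pmf D \<Longrightarrow> Q (imem \<tau>) (cmem \<tau>) (out \<tau>)"
    "\<And>\<tau>. \<tau> \<in> set_pmf D \<Longrightarrow> steps \<tau> \<le> steps \<sigma> + T"
    "\<And>\<tau>. \<tau> \<in> set_pmf D \<Longrightarrow> cells \<tau> \<le> max (cells \<sigma>) B"
    by (rule run_distD) blast
  have Q': "Q' (imem \<tau>) (cmem \<tau>) (out \<tau>)"
    and g: "g (imem \<tau>) (cmem \<tau>) (out \<tau>) = h (f (imem \<tau>) (cmem \<tau>) (out \<tau>))" if "\<tau> \<in> set_pmf D" for \<tau>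
    using assms(3)[OF D(3)[OF that]] D(2) that by auto
  have "map_pmf (\<lambda>\<tau>. g (imem \<tau>) (cmem \<tau>) (out \<tau>)) D = map_pmf h E"
    unfolding D(2)[symmetric] map_pmf_comp by (intro map_pmf_cong refl g)
  then show "\<exists>D. exec P p \<sigma> D \<and> ends_with B T' \<sigma> g (map_pmf h E) Q' D"
    unfolding ends_with_def using D(1,4,5) Q' assms(2) by (fastforce intro!: exI[of _ D])
qed

lemma run_dist_weaken:
  assumes "run_dist P B p T I C W f E Q" "T \<le> T'"
    and "\<And>I C W. Q I C W \<Longrightarrow> f I C W \<in> set_pmf E \<Longrightarrow> Q' I C W"
  shows "run_dist P B p T' I C W f E Q'"
  using run_dist_map[OF assms(1,2), where h = id and g = f and Q' = Q'] assms(3)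
  by (simp add: pmf.map_id)

lemma run_weaken:
  assumes "run P B p T I C W Q" "T \<le> T'" and "\<And>I C W. Q I C W \<Longrightarrow> Q' I C W"
  shows "run P B p T' I C W Q'"
  using assms unfolding run_def by (rule run_dist_weaken)

lemma run_le: "run P B p T I C W Q \<Longrightarrow> T \<le> T' \<Longrightarrow> run P B p T' I C W Q"
  by (rule run_weaken)

lemma run_dist_le: "run_dist P B p T I C W f E Q \<Longrightarrow> T \<le> T' \<Longrightarrow> run_dist P B p T' I C W f E Q"
  by (rule run_dist_weaken)

lemma run_dist_of_run:
  assumes "run P B p T I C W (\<lambda>I C W. Q I C W \<and> f I C W = x)"
  shows "run_dist P B p T I C W f (return_pmf x) Q"
  using run_dist_map[OF assms[unfolded run_def], where h = "\<lambda>_. x" and g = f and Q' = Q] by simp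

lemma run_of_run_dist:
  assumes "run_dist P B p T I C W f E Q"
  shows "run P B p T I C W (\<lambda>I C W. Q I C W \<and> f I C W \<in> set_pmf E)"
  unfolding run_def
  using run_dist_map[OF assms, where h = "\<lambda>_. ()" and g = "\<lambda>_ _ _. ()"
      and Q' = "\<lambda>I C W. Q I C W \<and> f I C W \<in> set_pmf E"] by simp

lemma run_dist_seq:
  assumes p: "run_dist P B p T I C W f E R"
    and q: "\<And>I C W. R I C W \<Longrightarrow> f I C W \<in> set_pmf E \<Longrightarrow> run_dist P B q T' I C W g (K (f I C W)) Q"
  shows "run_dist P B (Seq p q) (T + T') I C W g (bind_pmf E K) Q"
proof (rule run_distI)
  fix \<sigma> :: state assume "imem \<sigma> = I" "cmem \<sigma> = C" "out \<sigma> = W"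
  from p this obtain D where D: "exec P p \<sigma> D"
    "map_pmf (\<lambda>\<tau>. f (imem \<tau>) (cmem \<tau>) (out \<tau>)) D = E"
    "\<And>\<tau>. \<tau> \<in> set_pmf D \<Longrightarrow> R (imem \<tau>) (cmem \<tau>) (out \<tau>)"
    "\<And>\<tau>. \<tau> \<in> set_pmf D \<Longrightarrow> steps \<tau> \<le> steps \<sigma> + T"
    "\<And>\<tau>. \<tau> \<in> set_pmf D \<Longrightarrow> cells \<tau> \<le> max (cells \<sigma>) B"
    by (rule run_distD) blast
  let ?f = "\<lambda>\<tau>. f (imem \<tau>) (cmem \<tau>) (out \<tau>)" and ?g = "\<lambda>\<tau>. g (imem \<tau>) (cmem \<tau>) (out \<tau>)"
  have "\<exists>L. \<forall>\<tau>\<in>set_pmf D. exec P q \<tau> (L \<tau>) \<and> ends_with B T' \<tau> g (K (?f \<tau>)) Q (L \<tau>)"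
  proof (rule bchoice, rule ballI)
    fix \<tau> assume \<tau>: "\<tau> \<in> set_pmf D"
    then have "?f \<tau> \<in> set_pmf E" using D(2) by auto
    from q[OF D(3)[OF \<tau>] this] show "\<exists>L. exec P q \<tau> L \<and> ends_with B T' \<tau> g (K (?f \<tau>)) Q L"
      unfolding run_dist_def by blast
  qed
  then obtain L where L: "\<And>\<tau>. \<tau> \<in> set_pmf D \<Longrightarrow> exec P q \<tau> (L \<tau>) \<and> map_pmf ?g (L \<tau>) = K (?f \<tau>)
      \<and> (\<forall>\<tau>'\<in>set_pmf (L \<tau>). Q (imem \<tau>') (cmem \<tau>') (out \<tau>')
            \<and> steps \<tau>' \<le> steps \<tau> + T' \<and> cells \<tau>' \<le> max (cells \<tau>) B)"
    unfolding ends_with_def by blast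
  have "exec P (Seq p q) \<sigma> (bind_pmf D L)" using D(1) L by (intro exec.Seq) auto
  moreover have "map_pmf ?g (bind_pmf D L) = bind_pmf E K"
    unfolding map_bind_pmf D(2)[symmetric] bind_map_pmf using L by (intro bind_pmf_cong) auto
  moreover have "Q (imem \<tau>') (cmem \<tau>') (out \<tau>') \<and> steps \<tau>' \<le> steps \<sigma> + (T + T')
      \<and> cells \<tau>' \<le> max (cells \<sigma>) B" if \<tau>': "\<tau>' \<in> set_pmf (bind_pmf D L)" for \<tau>'
  proof -
    obtain \<tau> where "\<tau> \<in> set_pmf D" "\<tau>' \<in> set_pmf (L \<tau>)" using \<tau>' by auto
    then show ?thesis using L[of \<tau>] D(4,5)[of \<tau>] by (fastforce simp: max_def split: if_splits)
  qed
  ultimately show "\<exists>D. exec P (Seq p q) \<sigma> D \<and> ends_with B (T + T') \<sigma> g (bind_pmf E K) Q D"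
    unfolding ends_with_def by blast
qed

lemma run_dist_det_seq:
  assumes "run P B p T I C W (\<lambda>I C W. run_dist P B q T' I C W f E Q)"
  shows "run_dist P B (Seq p q) (T + T') I C W f E Q"
proof -
  have "run_dist P B (Seq p q) (T + T') I C W f (bind_pmf (return_pmf ()) (\<lambda>_. E)) Q"
    using assms unfolding run_def by (rule run_dist_seq)
  then show ?thesis by (simp add: bind_return_pmf)
qed

lemma run_seq:
  assumes "run P B p T I C W (\<lambda>I C W. run P B q T' I C W Q)"
  shows "run P B (Seq p q) (T + T') I C W Q"
  using assms unfolding run_def[of _ _ "Seq p q"] run_def[of _ _ q] by (rule run_dist_det_seq)

lemma run_step:
  assumes "\<And>\<sigma>. imem \<sigma> = I \<Longrightarrow> cmem \<sigma> = C \<Longrightarrow> out \<sigma> = W \<Longrightarrow> exec P p \<sigma> (return_pmf (tick T (h \<sigma>)))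
      \<and> Q (imem (h \<sigma>)) (cmem (h \<sigma>)) (out (h \<sigma>)) \<and> steps (h \<sigma>) = steps \<sigma> \<and> cells (h \<sigma>) \<le> max (cells \<sigma>) B"
  shows "run P B p T I C W Q"
  unfolding run_def
proof (rule run_distI)
  fix \<sigma> :: state assume "imem \<sigma> = I" "cmem \<sigma> = C" "out \<sigma> = W"
  note step = assms[OF this]
  show "\<exists>D. exec P p \<sigma> D \<and> ends_with B T \<sigma> (\<lambda>_ _ _. ()) (return_pmf ()) Q D"
    by (intro exI conjI, rule conjunct1[OF step]) (use step in \<open>simp add: ends_with_def tick_def\<close>)
qed

lemma run_Skip: "Q I C W \<Longrightarrow> run P B Skip 1 I C W Q"
  by (rule run_step[where h = "\<lambda>\<sigma>. \<sigma>"]) (use exec.Skip[of P] in auto)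

lemma run_IStore:
  assumes "ival P a (mem_state I C W) < B"
    and "Q (I(ival P a (mem_state I C W) := ival P e (mem_state I C W))) C W"
  shows "run P B (IStore a e) (icost a + icost e + 1) I C W Q"
  by (rule run_step[where h = "\<lambda>\<sigma>. iwrite (ival P a \<sigma>) (ival P e \<sigma>) \<sigma>"])
    (use assms ival_mem_state[of P] exec.IStore[of P a e] in \<open>auto simp: iwrite_def\<close>)

lemma run_CStore:
  assumes "ival P a (mem_state I C W) < B"
    and "Q I (C(ival P a (mem_state I C W) := cval P x (mem_state I C W))) W"
  shows "run P B (CStore a x) (icost a + ccost x + 1) I C W Q"
  by (rule run_step[where h = "\<lambda>\<sigma>. cwrite (ival P a \<sigma>) (cval P x \<sigma>) \<sigma>"])
    (use assms ival_mem_state[of P] cval_mem_state[of P] exec.CStore[of P a x] in \<open>auto simp: cwrite_def\<close>)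

lemma run_Emit:
  assumes "Q I C (W @ [ival P e (mem_state I C W)])"
  shows "run P B (Emit e) (icost e + 1) I C W Q"
  by (rule run_step[where h = "\<lambda>\<sigma>. \<sigma>\<lparr>out := out \<sigma> @ [ival P e \<sigma>]\<rparr>"])
    (use assms ival_mem_state[of P] exec.Emit[of P e] in auto)

lemma run_dist_Flip:
  assumes "ival P a (mem_state I C W) < B"
    and "\<And>b. Q (I(ival P a (mem_state I C W) := of_bool b)) C W"
  shows "run_dist P B (Flip a x) (icost a + ccost x + 1) I C W f
    (map_pmf (\<lambda>b. f (I(ival P a (mem_state I C W) := of_bool b)) C W)
       (bernoulli_pmf (Re (cval P x (mem_state I C W))))) Q" (is "run_dist _ _ _ ?T _ _ _ _ ?E _")
proof (rule run_distI)
  fix \<sigma> :: state assume "imem \<sigma> = I" "cmem \<sigma> = C" "out \<sigma> = W"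
  then show "\<exists>D. exec P (Flip a x) \<sigma> D \<and> ends_with B ?T \<sigma> f ?E Q D"
    using assms ival_mem_state[of P a \<sigma>] cval_mem_state[of P x \<sigma>] exec.Flip[of P a x \<sigma>]
    by (auto intro!: exI simp: ends_with_def tick_def iwrite_def map_pmf_comp)
qed

lemma run_dist_tick:
  assumes "\<And>(\<sigma> :: state) D. imem \<sigma> = I \<Longrightarrow> cmem \<sigma> = C \<Longrightarrow> out \<sigma> = W \<Longrightarrow> exec P q (tick k \<sigma>) D \<Longrightarrow> exec P p \<sigma> D"
    and "run_dist P B q T I C W f E Q"
  shows "run_dist P B p (k + T) I C W f E Q"
proof (rule run_distI)
  fix \<sigma> :: state assume \<sigma>: "imem \<sigma> = I" "cmem \<sigma> = C" "out \<sigma> = W"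
  then have "imem (tick k \<sigma>) = I" "cmem (tick k \<sigma>) = C" "out (tick k \<sigma>) = W"
    by (simp_all add: tick_def)
  then obtain D where D: "exec P q (tick k \<sigma>) D" "ends_with B T (tick k \<sigma>) f E Q D"
    using assms(2) unfolding run_dist_def by blast
  then show "\<exists>D. exec P p \<sigma> D \<and> ends_with B (k + T) \<sigma> f E Q D"
    using assms(1)[OF \<sigma> D(1)] by (auto simp: ends_with_def tick_def add.assoc)
qed

lemma run_dist_If:
  assumes "bval P b (mem_state I C W) \<Longrightarrow> run_dist P B p T I C W f E Q"
    and "\<not> bval P b (mem_state I C W) \<Longrightarrow> run_dist P B q T I C W f E Q"
  shows "run_dist P B (If b p q) (Suc (bcost b) + T) I C W f E Q"
proof (cases "bval P b (mem_state I C W)")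
  case True
  then show ?thesis
    using bval_mem_state[of P b] by (intro run_dist_tick[OF exec.IfTrue assms(1)]) auto
next
  case False
  then show ?thesis
    using bval_mem_state[of P b] by (intro run_dist_tick[OF exec.IfFalse assms(2)]) auto
qed

lemma run_If:
  assumes "bval P b (mem_state I C W) \<Longrightarrow> run P B p T I C W Q"
    and "\<not> bval P b (mem_state I C W) \<Longrightarrow> run P B q T I C W Q"
  shows "run P B (If b p q) (Suc (bcost b) + T) I C W Q"
  using assms unfolding run_def by (rule run_dist_If)

primrec kernel_chain :: "(nat \<Rightarrow> 'a \<Rightarrow> 'a pmf) \<Rightarrow> nat \<Rightarrow> nat \<Rightarrow> 'a \<Rightarrow> 'a pmf" where
  "kernel_chain K 0 i x = return_pmf x"
| "kernel_chain K (Suc r) i x = bind_pmf (K i x) (kernel_chain K r (Suc i))"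

lemma kernel_chain_Suc: "kernel_chain K (Suc r) i x = bind_pmf (kernel_chain K r i x) (K (i + r))"
proof (induction r arbitrary: i x)
  case 0
  have "kernel_chain K 0 (Suc i) = return_pmf" by (rule ext) simp
  then show ?case by (simp add: bind_return_pmf bind_return_pmf')
next
  case (Suc r)
  have "kernel_chain K (Suc (Suc r)) i x
      = bind_pmf (K i x) (\<lambda>y. bind_pmf (kernel_chain K r (Suc i) y) (K (Suc i + r)))"
    unfolding kernel_chain.simps(2)[of K "Suc r"] by (intro bind_pmf_cong refl Suc.IH)
  also have "\<dots> = bind_pmf (kernel_chain K (Suc r) i x) (K (i + Suc r))"
    by (simp add: bind_assoc_pmf)
  finally show ?case .
qed

lemma run_dist_While:
  assumes cond: "\<And>i I C W. i \<le> N \<Longrightarrow> Inv i I C W \<Longrightarrow> bval P b (mem_state I C W) \<longleftrightarrow> i < N"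
    and body: "\<And>i I C W. i < N \<Longrightarrow> Inv i I C W \<Longrightarrow>
      run_dist P B p T I C W (f (Suc i)) (K i (f i I C W)) (Inv (Suc i))"
    and init: "Inv 0 I C W"
  shows "run_dist P B (While b p) (N * (T + Suc (bcost b)) + Suc (bcost b)) I C W (f N)
    (kernel_chain K N 0 (f 0 I C W)) (Inv N)"
proof -
  have "run_dist P B (While b p) (r * (T + Suc (bcost b)) + Suc (bcost b)) I C W (f N)
    (kernel_chain K r i (f i I C W)) (Inv N)" if "i + r = N" "Inv i I C W" for r i I C W
    using that
  proof (induction r arbitrary: i I C W)
    case 0
    then have n: "\<not> bval P b (mem_state I C W)" using cond[of i] by simp
    show ?case
    proof (rule run_distI)
      fix \<sigma> :: state assume \<sigma>: "imem \<sigma> = I" "cmem \<sigma> = C" "out \<sigma> = W"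
      then have "exec P (While b p) \<sigma> (return_pmf (tick (Suc (bcost b)) \<sigma>))"
        using n bval_mem_state[of P b \<sigma>] by (intro exec.WhileFalse) simp
      with \<sigma> 0 show "\<exists>D. exec P (While b p) \<sigma> D \<and> ends_with B (0 * (T + Suc (bcost b)) + Suc (bcost b)) \<sigma>
          (f N) (kernel_chain K 0 i (f i I C W)) (Inv N) D"
        by (intro exI[of _ "return_pmf (tick (Suc (bcost b)) \<sigma>)"]) (simp add: ends_with_def tick_def)
    qed
  next
    case (Suc r)
    then have n: "bval P b (mem_state I C W)" "i < N" using cond[of i] by simp_all
    have "run_dist P B (Seq p (While b p)) (T + (r * (T + Suc (bcost b)) + Suc (bcost b))) I C W (f N)
      (bind_pmf (K i (f i I C W)) (kernel_chain K r (Suc i))) (Inv N)"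
      by (rule run_dist_seq[OF body[OF n(2)]]) (use Suc in auto)
    then have "run_dist P B (While b p) (Suc (bcost b) + (T + (r * (T + Suc (bcost b)) + Suc (bcost b))))
      I C W (f N) (bind_pmf (K i (f i I C W)) (kernel_chain K r (Suc i))) (Inv N)"
    proof (rule run_dist_tick[rotated])
      fix \<sigma> :: state and D assume \<sigma>: "imem \<sigma> = I" "cmem \<sigma> = C" "out \<sigma> = W"
        "exec P (Seq p (While b p)) (tick (Suc (bcost b)) \<sigma>) D"
      from \<sigma>(4) show "exec P (While b p) \<sigma> D"
      proof (rule exec_SeqE)
        fix D' L assume "D = bind_pmf D' L" "exec P p (tick (Suc (bcost b)) \<sigma>) D'"
          "\<And>\<tau>. \<tau> \<in> set_pmf D' \<Longrightarrow> exec P (While b p) \<tau> (L \<tau>)"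
        then show ?thesis
          using n \<sigma>(1-3) bval_mem_state[of P b \<sigma>] by (auto intro: exec.WhileTrue)
      qed
    qed
    then show ?case by (simp add: algebra_simps)
  qed
  from this[of 0 N] init show ?thesis by simp
qed

definition For :: "nat \<Rightarrow> iexp \<Rightarrow> com \<Rightarrow> com" where
  "For v b p = Seq (IStore (IConst v) (IConst 0)) (While (ILess (ILoad (IConst v)) b)
     (Seq p (IStore (IConst v) (IAdd (ILoad (IConst v)) (IConst 1)))))"

lemma run_dist_For:
  assumes bound: "\<And>i I C W. i \<le> N \<Longrightarrow> Inv i I C W \<Longrightarrow> I v = i \<Longrightarrow> ival P b (mem_state I C W) = N"
    and body: "\<And>i I C W. i < N \<Longrightarrow> Inv i I C W \<Longrightarrow> I v = i \<Longrightarrow>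
      run_dist P B p T I C W (\<lambda>I. f (Suc i) (I(v := Suc i))) (K i (f i I C W)) (\<lambda>I C W. I v = i \<and> Inv (Suc i) (I(v := Suc i)) C W)"
    and init: "Inv 0 (I(v := 0)) C W" "v < B"
  shows "run_dist P B (For v b p) (N * (T + icost b + 10) + icost b + 10) I C W (f N)
    (kernel_chain K N 0 (f 0 (I(v := 0)) C W)) (\<lambda>I C W. Inv N I C W \<and> I v = N)"
proof -
  let ?I = "\<lambda>i I C W. Inv i I C W \<and> I v = i"
  let ?inc = "IStore (IConst v) (IAdd (ILoad (IConst v)) (IConst 1))"
  let ?b = "ILess (ILoad (IConst v)) b"
  have body': "run_dist P B (Seq p ?inc) (T + 6) I C W (f (Suc i)) (K i (f i I C W)) (?I (Suc i))"
    if "i < N" "?I i I C W" for i I C W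
  proof -
    have "run_dist P B ?inc 6 I' C' W' (f (Suc i)) (return_pmf (f (Suc i) (I'(v := Suc i)) C' W')) (?I (Suc i))"
      if "I' v = i \<and> Inv (Suc i) (I'(v := Suc i)) C' W'" for I' C' W'
      by (rule run_dist_weaken[OF run_dist_of_run[OF run_IStore]]) (use that init(2) in auto)
    then have "run_dist P B (Seq p ?inc) (T + 6) I C W (f (Suc i)) (bind_pmf (K i (f i I C W)) return_pmf) (?I (Suc i))"
      by (intro run_dist_seq[OF body[of i I C W]]) (use that in auto)
    then show ?thesis by (simp add: bind_return_pmf')
  qed
  have w: "run_dist P B (While ?b (Seq p ?inc)) (N * (T + 6 + Suc (bcost ?b)) + Suc (bcost ?b)) (I(v := 0)) C W (f N)
    (kernel_chain K N 0 (f 0 (I(v := 0)) C W)) (?I N)"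
  proof (rule run_dist_While)
    show "bval P ?b (mem_state I C W) \<longleftrightarrow> i < N" if "i \<le> N" "?I i I C W" for i I C W
      using bound[OF that(1), of I C W] that(2) by simp
    show "?I 0 (I(v := 0)) C W" using init by simp
  qed (rule body')
  have "run_dist P B (For v b p) (3 + (N * (T + 6 + Suc (bcost ?b)) + Suc (bcost ?b))) I C W (f N)
    (kernel_chain K N 0 (f 0 (I(v := 0)) C W)) (?I N)"
    unfolding For_def
    by (rule run_dist_det_seq, rule run_weaken[OF run_IStore])
      (use w init(2) in auto)
  then show ?thesis by (rule run_dist_weaken) (auto simp: algebra_simps)
qed

lemma run_For:
  assumes bound: "\<And>i I C W. i \<le> N \<Longrightarrow> Inv i I C W \<Longrightarrow> I v = i \<Longrightarrow> ival P b (mem_state I C W) = N"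
    and body: "\<And>i I C W. i < N \<Longrightarrow> Inv i I C W \<Longrightarrow> I v = i \<Longrightarrow>
      run P B p T I C W (\<lambda>I C W. I v = i \<and> Inv (Suc i) (I(v := Suc i)) C W)"
    and init: "Inv 0 (I(v := 0)) C W" "v < B"
    and final: "\<And>I C W. Inv N I C W \<Longrightarrow> I v = N \<Longrightarrow> Q I C W"
  shows "run P B (For v b p) (N * (T + icost b + 10) + icost b + 10) I C W Q"
proof -
  have "run_dist P B (For v b p) (N * (T + icost b + 10) + icost b + 10) I C W (\<lambda>_ _ _. ())
    (kernel_chain (\<lambda>_ _. return_pmf ()) N 0 ()) (\<lambda>I C W. Inv N I C W \<and> I v = N)"
    by (rule run_dist_For[where f = "\<lambda>_ _ _ _. ()" and K = "\<lambda>_ _. return_pmf ()" and Inv = Inv,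
          OF bound body[unfolded run_def] init])
  then show ?thesis
    by (rule run_weaken[OF run_of_run_dist]) (auto intro: final)
qed

definition reservoir_kernel :: "(nat \<Rightarrow> real) \<Rightarrow> nat \<Rightarrow> nat \<Rightarrow> nat pmf" where
  "reservoir_kernel w i x
     = map_pmf (\<lambda>b. if b then i else x) (bernoulli_pmf (w i / (\<Sum>j\<le>i. w j)))"

lemma pmf_reservoir:
  assumes w: "\<And>i. i < N \<Longrightarrow> 0 \<le> w i" and pos: "0 < (\<Sum>j<N. w j)"
  shows "pmf (kernel_chain (reservoir_kernel w) N 0 x) y
    = (if y < N then w y / (\<Sum>j<N. w j) else 0)"
  using assms
proof (induction N arbitrary: y)
  case (Suc N)
  let ?S = "\<Sum>j<N. w j"
  define q where "q = w N / (\<Sum>j<Suc N. w j)"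
  have S0: "0 \<le> ?S" using Suc.prems(1) by (intro sum_nonneg) auto
  have S: "(\<Sum>j\<le>N. w j) = (\<Sum>j<Suc N. w j)" by (simp add: lessThan_Suc_atMost)
  have q: "0 \<le> q" "q \<le> 1"
    using Suc.prems S0 by (auto simp: q_def divide_simps)
  let ?D = "kernel_chain (reservoir_kernel w) N 0 x"
  have step: "kernel_chain (reservoir_kernel w) (Suc N) 0 x
      = bind_pmf (bernoulli_pmf q) (\<lambda>b. if b then return_pmf N else ?D)"
  proof -
    have "kernel_chain (reservoir_kernel w) (Suc N) 0 x
        = bind_pmf ?D (\<lambda>z. bind_pmf (bernoulli_pmf q) (\<lambda>b. return_pmf (if b then N else z)))"
      unfolding kernel_chain_Suc
      by (simp add: reservoir_kernel_def[abs_def] S q_def map_pmf_def)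
    also have "\<dots> = bind_pmf (bernoulli_pmf q) (\<lambda>b. bind_pmf ?D (\<lambda>z. return_pmf (if b then N else z)))"
      by (rule bind_commute_pmf)
    also have "\<dots> = bind_pmf (bernoulli_pmf q) (\<lambda>b. if b then return_pmf N else ?D)"
      by (intro bind_pmf_cong refl) (simp add: bind_return_pmf')
    finally show ?thesis .
  qed
  have pmf: "pmf (kernel_chain (reservoir_kernel w) (Suc N) 0 x) y
      = q * of_bool (y = N) + (1 - q) * pmf ?D y"
    unfolding step pmf_bind using q by (simp add: indicator_def)
  show ?case
  proof (cases "?S = 0")
    case True
    then have q1: "q = 1" using Suc.prems(2) by (simp add: q_def)
    have "w y = 0" if "y < N"
      using True that Suc.prems(1) by (subst (asm) sum_nonneg_eq_0_iff) auto
    then show ?thesis using pmf q1 Suc.prems(2) True by (auto simp: less_Suc_eq)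
  next
    case False
    then have "pmf ?D y = (if y < N then w y / ?S else 0)"
      using S0 Suc.prems(1) by (intro Suc.IH) auto
    moreover have "1 - q = ?S / (\<Sum>j<Suc N. w j)" using Suc.prems(2) by (simp add: q_def divide_simps)
    ultimately show ?thesis using pmf False by (auto simp: q_def less_Suc_eq)
  qed
qed simp

text \<open>Reservoir sampling: the \<open>i\<close>-th candidate, whose weight \<open>p\<close> leaves in complex cell 1,
  replaces the current choice with probability \<open>w i / (w 0 + \<dots> + w i)\<close>. The division
  \<open>0 / 0 = 0\<close> makes this correct for vanishing initial weights.\<close>

definition Reservoir :: "iexp \<Rightarrow> com \<Rightarrow> com" where
  "Reservoir b p = Seq (IStore (IConst 3) (IConst 0)) (Seq (CStore (IConst 0) (OfIndex (IConst 0)))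
     (For 2 b (Seq p
       (Seq (CStore (IConst 0) (CAdd (CLoad (IConst 0)) (CLoad (IConst 1))))
       (Seq (Flip (IConst 4) (CDiv (CLoad (IConst 1)) (CLoad (IConst 0))))
          (If (ILess (IConst 0) (ILoad (IConst 4))) (IStore (IConst 3) (ILoad (IConst 2))) Skip))))))"

lemma run_dist_Reservoir:
  assumes bound: "\<And>i I C W. i \<le> N \<Longrightarrow> J i I C W \<Longrightarrow> ival P b (mem_state I C W) = N"
    and weight: "\<And>i I C W. i < N \<Longrightarrow> J i I C W \<Longrightarrow> I 2 = i \<Longrightarrow>
      run P B p T I C W (\<lambda>I' C' W'. J (Suc i) I' C' W' \<and> I' 2 = i \<and> I' 3 = I 3 \<and> C' 0 = C 0
        \<and> C' 1 = of_real (w i))"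
    and J: "\<And>i I C W a x. J i I C W \<Longrightarrow> a \<in> {2, 3, 4} \<Longrightarrow> J i (I(a := x)) C W"
      "\<And>i I C W s. J i I C W \<Longrightarrow> J i I (C(0 := s)) W"
    and init: "J 0 I C W" "4 < B"
  shows "run_dist P B (Reservoir b p) (N * (T + icost b + 34) + icost b + 20) I C W (\<lambda>I C W. I 3)
    (kernel_chain (reservoir_kernel w) N 0 0) (J N)"
proof -
  let ?S = "\<lambda>i. complex_of_real (\<Sum>j<i. w j)"
  let ?Inv = "\<lambda>i I C W. J i I C W \<and> C 0 = ?S i"
  let ?add = "CStore (IConst 0) (CAdd (CLoad (IConst 0)) (CLoad (IConst 1)))"
  let ?flip = "Flip (IConst 4) (CDiv (CLoad (IConst 1)) (CLoad (IConst 0)))"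
  let ?if = "If (ILess (IConst 0) (ILoad (IConst 4))) (IStore (IConst 3) (ILoad (IConst 2))) Skip"
  have body: "run_dist P B (Seq p (Seq ?add (Seq ?flip ?if))) (T + 24) I C W
      (\<lambda>I C W. I 3) (reservoir_kernel w i (I 3)) (\<lambda>I C W. I 2 = i \<and> ?Inv (Suc i) (I(2 := Suc i)) C W)"
    if i: "i < N" "?Inv i I C W" "I 2 = i" for i I C W
  proof -
    let ?post = "\<lambda>I C W. I 2 = i \<and> ?Inv (Suc i) I C W"
    have if_: "run_dist P B ?if 9 I C W (\<lambda>I C W. I 3) (return_pmf (if 0 < I 4 then i else I 3)) ?post"
      if "?post I C W" for I C W
    proof (rule run_dist_of_run, rule run_le, rule run_If)
      show "run P B (IStore (IConst 3) (ILoad (IConst 2))) 4 I C W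
          (\<lambda>I' C W. ?post I' C W \<and> I' 3 = (if 0 < I 4 then i else I 3))"
        if "bval P (ILess (IConst 0) (ILoad (IConst 4))) (mem_state I C W)"
        by (rule run_le, rule run_IStore) (use that \<open>?post I C W\<close> init(2) J in auto)
      show "run P B Skip 4 I C W
          (\<lambda>I' C W. ?post I' C W \<and> I' 3 = (if 0 < I 4 then i else I 3))"
        if "\<not> bval P (ILess (IConst 0) (ILoad (IConst 4))) (mem_state I C W)"
        by (rule run_le, rule run_Skip) (use that \<open>?post I C W\<close> in auto)
    qed simp
    have flip: "run_dist P B (Seq ?flip ?if) 16 I C W (\<lambda>I C W. I 3)
        (reservoir_kernel w i (I 3)) ?post"
      if p: "?post I C W" "C 1 = of_real (w i)" for I C W
    proof -
      have "C 1 / C 0 = complex_of_real (w i / (\<Sum>j\<le>i. w j))"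
        using p by (simp add: lessThan_Suc_atMost)
      then have q: "Re (C 1 / C 0) = w i / (\<Sum>j\<le>i. w j)" by simp
      have "run_dist P B ?flip 7 I C W (\<lambda>I' C W. if 0 < I' 4 then i else I' 3)
          (map_pmf (\<lambda>b. if 0 < (I(4 := of_bool b)) 4 then i else (I(4 := of_bool b)) 3)
            (bernoulli_pmf (Re (C 1 / C 0)))) ?post"
        by (rule run_dist_le, rule run_dist_Flip[of P "IConst 4" I C W B ?post
            "CDiv (CLoad (IConst 1)) (CLoad (IConst 0))" "\<lambda>I' C W. if 0 < I' 4 then i else I' 3",
            unfolded ival.simps cval.simps mem_state_simps])
          (use p init(2) J in auto)
      also have "map_pmf (\<lambda>b. if 0 < (I(4 := of_bool b)) 4 then i else (I(4 := of_bool b)) 3)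
            (bernoulli_pmf (Re (C 1 / C 0))) = reservoir_kernel w i (I 3)"
        unfolding reservoir_kernel_def q by (intro map_pmf_cong refl) auto
      finally have "run_dist P B (Seq ?flip ?if) (7 + 9) I C W (\<lambda>I C W. I 3)
          (bind_pmf (reservoir_kernel w i (I 3)) return_pmf) ?post"
        by (rule run_dist_seq) (rule if_)
      then show ?thesis by (simp add: bind_return_pmf')
    qed
    have "run P B p T I C W (\<lambda>I' C W. run_dist P B (Seq ?add (Seq ?flip ?if)) 24 I' C W
        (\<lambda>I C W. I 3) (reservoir_kernel w i (I 3)) ?post)"
    proof (rule run_weaken[OF weight[of i I C W] order.refl])
      fix I' C' W' assume a: "J (Suc i) I' C' W' \<and> I' 2 = i \<and> I' 3 = I 3 \<and> C' 0 = C 0 \<and> C' 1 = of_real (w i)"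
      have "run P B ?add 8 I' C' W'
        (\<lambda>I' C W. run_dist P B (Seq ?flip ?if) 16 I' C W (\<lambda>I C W. I 3) (reservoir_kernel w i (I 3)) ?post)"
      proof (rule run_le, rule run_CStore)
        show "run_dist P B (Seq ?flip ?if) 16 I'
          (C'(ival P (IConst 0) (mem_state I' C' W') :=
            cval P (CAdd (CLoad (IConst 0)) (CLoad (IConst 1))) (mem_state I' C' W'))) W'
          (\<lambda>I C W. I 3) (reservoir_kernel w i (I 3)) ?post"
          using flip[of I' "C'(0 := C' 0 + C' 1)" W'] a i(2) J by simp
      qed (use init(2) in auto)
      then show "run_dist P B (Seq ?add (Seq ?flip ?if)) 24 I' C' W'
          (\<lambda>I C W. I 3) (reservoir_kernel w i (I 3)) ?post"
        by (intro run_dist_le[OF run_dist_det_seq]) auto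
    qed (use i in simp_all)
    then have "run_dist P B (Seq p (Seq ?add (Seq ?flip ?if))) (T + 24) I C W
      (\<lambda>I C W. I 3) (reservoir_kernel w i (I 3)) ?post"
      by (rule run_dist_det_seq)
    then show ?thesis by (rule run_dist_weaken) (use J in auto)
  qed
  let ?loop = "For 2 b (Seq p (Seq ?add (Seq ?flip ?if)))"
  have loop: "run_dist P B ?loop (N * (T + 24 + icost b + 10) + icost b + 10) I C W (\<lambda>I C W. I 3)
    (kernel_chain (reservoir_kernel w) N 0 (I 3)) (J N)" if "?Inv 0 I C W" for I C W
  proof -
    have "run_dist P B ?loop (N * (T + 24 + icost b + 10) + icost b + 10) I C W (\<lambda>I C W. I 3)
      (kernel_chain (reservoir_kernel w) N 0 ((I(2 := 0)) 3)) (\<lambda>I C W. ?Inv N I C W \<and> I 2 = N)"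
    proof (rule run_dist_For[where f = "\<lambda>_ I C W. I 3"])
      show "run_dist P B (Seq p (Seq ?add (Seq ?flip ?if))) (T + 24) I C W
          (\<lambda>I C W. (I(2 := Suc i)) 3) (reservoir_kernel w i (I 3))
          (\<lambda>I C W. I 2 = i \<and> ?Inv (Suc i) (I(2 := Suc i)) C W)"
        if "i < N" "?Inv i I C W" "I 2 = i" for i I C W
        using body[OF that] by simp
      show "?Inv 0 (I(2 := 0)) C W" using that by (intro conjI J) auto
    qed (use bound init(2) in auto)
    then show ?thesis by (auto elim: run_dist_weaken)
  qed
  have "run_dist P B (Reservoir b p) (3 + (4 + (N * (T + 24 + icost b + 10) + icost b + 10)))
      I C W (\<lambda>I C W. I 3) (kernel_chain (reservoir_kernel w) N 0 0) (J N)"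
    unfolding Reservoir_def
    apply (rule run_dist_det_seq, rule run_le, rule run_IStore)
    using init(2) apply simp
     apply (rule run_dist_det_seq, rule run_le, rule run_CStore)
    using init(2) apply simp
    using loop[of "I(3 := 0)" "C(0 := 0)" W] J init apply simp_all
    done
  then show ?thesis by (rule run_dist_le) (simp add: algebra_simps)
qed

section \<open>Amplitudes and the law of the sampler\<close>

definition list_hafnian :: "(nat \<Rightarrow> nat \<Rightarrow> complex) \<Rightarrow> nat list \<Rightarrow> complex" where
  "list_hafnian W g = hafnian (\<lambda>i j. W (g ! i) (g ! j)) {..<length g}"

lemma list_hafnian_mset:
  assumes sym: "\<And>a b. W a b = W b a" and eq: "mset f = mset g"
  shows "list_hafnian W f = list_hafnian W g"
proof -
  obtain p where p: "p permutes {..<length g}" "permute_list p g = f"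
    using mset_eq_permutation[OF eq] .
  have len: "length f = length g" using p(2) by auto
  have "list_hafnian W f = hafnian (\<lambda>i j. W (g ! p i) (g ! p j)) {..<length g}"
    unfolding list_hafnian_def len
    using p by (intro hafnian_cong) (auto simp: permute_list_nth)
  also have "\<dots> = hafnian (\<lambda>i j. W (g ! i) (g ! j)) (p ` {..<length g})"
    by (rule hafnian_image[symmetric]) (use sym permutes_inj_on[OF p(1)] in auto)
  finally show ?thesis using permutes_image[OF p(1)] by (simp add: list_hafnian_def)
qed

lemma list_hafnian_expand_last:
  assumes sym: "\<And>a b. W a b = W b a" and len: "length f = Suc (Suc t)"
  shows "list_hafnian W f
    = (\<Sum>j\<le>t. W (f ! Suc t) (f ! j) * list_hafnian W ((take t f)[j := f ! t]))"
proof -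
  have "list_hafnian W f = (\<Sum>j\<in>{..<Suc (Suc t)} - {Suc t}. W (f ! Suc t) (f ! j)
      * hafnian (\<lambda>i j. W (f ! i) (f ! j)) ({..<Suc (Suc t)} - {Suc t, j}))"
    unfolding list_hafnian_def len by (rule hafnian_expand) (use sym in auto)
  also have "{..<Suc (Suc t)} - {Suc t} = {..t}" by auto
  also have "(\<Sum>j\<le>t. W (f ! Suc t) (f ! j)
      * hafnian (\<lambda>i j. W (f ! i) (f ! j)) ({..<Suc (Suc t)} - {Suc t, j}))
    = (\<Sum>j\<le>t. W (f ! Suc t) (f ! j) * list_hafnian W ((take t f)[j := f ! t]))"
  proof (intro sum.cong refl arg_cong[of _ _ "(*) (W _ _)"])
    fix j assume j: "j \<in> {..t}"
    define \<pi> where "\<pi> x = (if x = j then t else x)" for x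
    have "{..<Suc (Suc t)} - {Suc t, j} = \<pi> ` {..<t}"
      using j by (auto simp: \<pi>_def image_iff less_Suc_eq)
    then have "hafnian (\<lambda>i j. W (f ! i) (f ! j)) ({..<Suc (Suc t)} - {Suc t, j})
        = hafnian (\<lambda>i k. W (f ! \<pi> i) (f ! \<pi> k)) {..<t}"
      by (simp only:, intro hafnian_image) (use sym in \<open>auto simp: inj_on_def \<pi>_def\<close>)
    also have "\<dots> = list_hafnian W ((take t f)[j := f ! t])"
      unfolding list_hafnian_def using len
      by (intro hafnian_cong[THEN trans, OF _ arg_cong[of _ _ "hafnian _"]])
        (auto simp: \<pi>_def nth_list_update)
    finally show "hafnian (\<lambda>i j. W (f ! i) (f ! j)) ({..<Suc (Suc t)} - {Suc t, j})
        = list_hafnian W ((take t f)[j := f ! t])" .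
  qed
  finally show ?thesis .
qed

definition pairing_amp :: "nat list \<Rightarrow> complex" where
  "pairing_amp = list_hafnian (\<lambda>a b. of_bool (a = b))"

lemma pairing_amp_mset: "mset f = mset g \<Longrightarrow> pairing_amp f = pairing_amp g"
  unfolding pairing_amp_def by (rule list_hafnian_mset) auto

lemma count_mset_eq_sum: "of_nat (count (mset g) c) = (\<Sum>j<length g. of_bool (g ! j = c) :: 'a :: semiring_1)"
proof (induction g rule: rev_induct)
  case (snoc x g)
  have "(\<Sum>j<length g. of_bool ((g @ [x]) ! j = c) :: 'a) = (\<Sum>j<length g. of_bool (g ! j = c))"
    by (intro sum.cong refl) (simp add: nth_append)
  then show ?case using snoc.IH by (simp add: add.commute del: sum_of_bool_eq)
qed simp

lemma pairing_amp_snoc2: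
  "pairing_amp (g @ [c, c]) = pairing_amp g * of_nat (Suc (count (mset g) c))"
proof -
  let ?t = "length g"
  have "pairing_amp (g @ [c, c]) = (\<Sum>j\<le>?t. of_bool ((g @ [c, c]) ! Suc ?t = (g @ [c, c]) ! j)
      * pairing_amp ((take ?t (g @ [c, c]))[j := (g @ [c, c]) ! ?t]))"
    unfolding pairing_amp_def by (rule list_hafnian_expand_last) auto
  also have "\<dots> = (\<Sum>j\<le>?t. of_bool (j = ?t \<or> (j < ?t \<and> g ! j = c)) * pairing_amp g)"
  proof (intro sum.cong refl)
    fix j assume "j \<in> {..?t}"
    then consider "j = ?t" | "j < ?t" by fastforce
    then show "of_bool ((g @ [c, c]) ! Suc ?t = (g @ [c, c]) ! j)
        * pairing_amp ((take ?t (g @ [c, c]))[j := (g @ [c, c]) ! ?t])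
      = of_bool (j = ?t \<or> (j < ?t \<and> g ! j = c)) * pairing_amp g"
    proof cases
      case 1
      then show ?thesis by (simp add: nth_append list_update_beyond)
    next
      case 2
      then show ?thesis using list_update_id[of g j] by (auto simp: nth_append)
    qed
  qed
  also have "\<dots> = (\<Sum>j\<le>?t. of_bool (j = ?t \<or> (j < ?t \<and> g ! j = c))) * pairing_amp g"
    by (simp only: sum_distrib_right)
  also have "(\<Sum>j\<le>?t. of_bool (j = ?t \<or> (j < ?t \<and> g ! j = c)) :: complex)
      = (\<Sum>j<?t. of_bool (g ! j = c)) + 1"
    unfolding lessThan_Suc_atMost[symmetric] sum.lessThan_Suc
    by (intro arg_cong2[of _ _ _ _ "(+)"] sum.cong) auto
  also have "\<dots> = of_nat (Suc (count (mset g) c))"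
    by (simp only: count_mset_eq_sum of_nat_Suc add.commute)
  finally show ?thesis by (simp only: mult.commute)
qed

definition mode_lists :: "nat \<Rightarrow> nat \<Rightarrow> nat list set" where
  "mode_lists n m = {g. length g = n \<and> set g \<subseteq> {..<m}}"

lemma finite_mode_lists [simp]: "finite (mode_lists n m)"
  using finite_lists_length_eq[of "{..<m}" n] by (simp add: mode_lists_def conj_commute)

lemma mode_lists_nth: "g \<in> mode_lists n m \<Longrightarrow> j < n \<Longrightarrow> g ! j < m"
  using nth_mem[of j g] by (auto simp: mode_lists_def simp del: nth_mem)

lemma sum_lessThan_add: "(\<Sum>x<m + t. F x) = (\<Sum>x<m. F x) + (\<Sum>j<t. F (m + j :: nat) :: 'a :: comm_monoid_add)"
  by (induction t) (simp_all add: add_ac)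

lemma pmf_bind_finite:
  assumes "finite A" "set_pmf D \<subseteq> A"
  shows "pmf (bind_pmf D K) y = (\<Sum>a\<in>A. pmf D a * pmf (K a) y)"
  using assms by (subst pmf_bind, subst integral_measure_pmf[of A]) auto

lemma pmf_map_finite:
  assumes "finite A" "set_pmf D \<subseteq> A"
  shows "pmf (map_pmf h D) y = (\<Sum>a\<in>A. pmf D a * of_bool (h a = y))"
  unfolding map_pmf_def pmf_bind_finite[OF assms] by (simp add: indicator_def)

text \<open>\<open>x\<close> ranges over \<open>m\<close> fresh choices of a mode and the \<open>length g\<close> modes already present.\<close>

definition urn_insert :: "nat \<Rightarrow> nat list \<Rightarrow> nat \<Rightarrow> nat \<Rightarrow> nat list" where
  "urn_insert m g x i = (let c = if x < m then x else g ! (x - m) in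
     (g @ [if i < length g then g ! i else c, c])[i := c])"

definition uniform_index :: "nat \<Rightarrow> nat pmf" where
  "uniform_index N = kernel_chain (reservoir_kernel (\<lambda>_. 1)) N 0 0"

lemma pmf_uniform_index: "0 < N \<Longrightarrow> pmf (uniform_index N) y = of_bool (y < N) / real N"
  unfolding uniform_index_def by (subst pmf_reservoir) auto

definition urn_step :: "nat \<Rightarrow> nat list \<Rightarrow> nat list pmf" where
  "urn_step m g = bind_pmf (uniform_index (m + length g)) (\<lambda>x.
     map_pmf (urn_insert m g x) (uniform_index (Suc (length g))))"

lemma urn_insert_eq_iff:
  assumes len: "length f = Suc (Suc t)" "length g = t" and i: "i \<le> t"
  shows "urn_insert m g x i = f \<longleftrightarrow>
    (if x < m then x else g ! (x - m)) = f ! Suc t \<and> f ! i = f ! Suc t \<and> g = (take t f)[i := f ! t]"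
    (is "?l \<longleftrightarrow> ?c = _ \<and> _ \<and> _")
proof
  assume l: ?l
  have f: "f = (g @ [if i < t then g ! i else ?c, ?c])[i := ?c]"
    using l len by (simp add: urn_insert_def Let_def)
  have "f ! Suc t = ?c" using i len by (subst f) (simp add: nth_list_update nth_append)
  moreover have "f ! i = ?c" using i len by (subst f) simp
  moreover have "g = (take t f)[i := f ! t]"
    using i len by (subst f, subst f) (auto intro!: nth_equalityI simp: nth_list_update nth_append)
  ultimately show "?c = f ! Suc t \<and> f ! i = f ! Suc t \<and> g = (take t f)[i := f ! t]" by simp
next
  assume r: "?c = f ! Suc t \<and> f ! i = f ! Suc t \<and> g = (take t f)[i := f ! t]"
  have g: "g ! j = (if j = i then f ! t else f ! j)" if "j < t" for j
    using r that len i by (simp add: nth_list_update)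
  show ?l
  proof (rule nth_equalityI)
    fix j assume "j < length (urn_insert m g x i)"
    then have "j \<le> Suc t" using len by (simp add: urn_insert_def Let_def)
    then consider "j < t" | "j = t" | "j = Suc t" by linarith
    then show "urn_insert m g x i ! j = f ! j"
      using r g i len by cases (auto simp: urn_insert_def Let_def nth_list_update nth_append)
  qed (simp add: urn_insert_def Let_def len)
qed

lemma pmf_urn_step:
  assumes m: "0 < m" and D: "\<And>g. pmf D g = (if g \<in> mode_lists t m then (cmod (pairing_amp g))\<^sup>2 / Z else 0)"
  shows "pmf (bind_pmf D (urn_step m)) f = (if f \<in> mode_lists (Suc (Suc t)) m
    then (cmod (pairing_amp f))\<^sup>2 / (Z * ((real m + real t) * (real t + 1))) else 0)"
proof -
  have supp: "set_pmf D \<subseteq> mode_lists t m" using D by (auto simp: set_pmf_eq)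
  have step: "pmf (urn_step m g) f = (\<Sum>x<m + t. \<Sum>i<Suc t. of_bool (urn_insert m g x i = f))
      / ((real m + real t) * (real t + 1))" if g: "g \<in> mode_lists t m" for g
  proof -
    have l: "length g = t" using g by (simp add: mode_lists_def)
    have s: "set_pmf (uniform_index N) \<subseteq> {..<N}" if "0 < N" for N
      using pmf_uniform_index[OF that] by (auto simp: set_pmf_eq)
    have "pmf (urn_step m g) f = (\<Sum>x<m + t. pmf (uniform_index (m + t)) x
        * (\<Sum>i<Suc t. pmf (uniform_index (Suc t)) i * of_bool (urn_insert m g x i = f)))"
      unfolding urn_step_def l
      by (subst pmf_bind_finite[of "{..<m + t}"])
        (use m s in \<open>auto intro!: sum.cong simp: pmf_map_finite[of "{..<Suc t}"] simp del: sum.lessThan_Suc\<close>)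
    also have "\<dots> = (\<Sum>x<m + t. \<Sum>i<Suc t. of_bool (urn_insert m g x i = f)
        / ((real m + real t) * (real t + 1)))"
      unfolding sum_distrib_left using m
      by (intro sum.cong refl) (simp add: pmf_uniform_index)
    finally show ?thesis by (simp only: sum_divide_distrib)
  qed
  have eq: "pmf (bind_pmf D (urn_step m)) f
      = (\<Sum>g\<in>mode_lists t m. (cmod (pairing_amp g))\<^sup>2 / Z * pmf (urn_step m g) f)"
    by (simp add: pmf_bind_finite[OF _ supp] D)
  show ?thesis
  proof (cases "f \<in> mode_lists (Suc (Suc t)) m")
    case False
    have "urn_insert m g x i \<noteq> f" if g: "g \<in> mode_lists t m" and "x < m + t" "i < Suc t" for g x i
    proof -
      have c: "(if x < m then x else g ! (x - m)) < m"
        using that mode_lists_nth[OF g, of "x - m"] by auto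
      moreover have "g ! i < m" if "i < t" using g that by (rule mode_lists_nth)
      ultimately have "urn_insert m g x i \<in> mode_lists (Suc (Suc t)) m"
        using g by (auto simp: mode_lists_def urn_insert_def Let_def split: if_splits
            dest!: set_update_subset_insert[THEN subsetD])
      with False show ?thesis by auto
    qed
    then show ?thesis using False by (simp add: eq step sum.neutral)
  next
    case True
    define c where "c = f ! Suc t"
    define h where "h i = (take t f)[i := f ! t]" for i
    have len: "length f = Suc (Suc t)" using True by (simp add: mode_lists_def)
    have fm: "f ! j < m" if "j < Suc (Suc t)" for j using True that by (rule mode_lists_nth)
    have h: "h i \<in> mode_lists t m" if "i \<le> t" for i
      using True fm[of t] len by (auto simp: h_def mode_lists_def
          dest!: set_update_subset_insert[THEN subsetD] in_set_takeD)
    have cm: "c < m" using fm by (simp add: c_def)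
    have choices: "(\<Sum>x<m + t. of_bool ((if x < m then x else g ! (x - m)) = c))
        = real (Suc (count (mset g) c))" if "length g = t" for g
    proof -
      have "(\<Sum>x<m + t. of_bool ((if x < m then x else g ! (x - m)) = c) :: real)
        = (\<Sum>x<m. of_bool (x = c)) + (\<Sum>j<t. of_bool (g ! j = c))"
        unfolding sum_lessThan_add by (intro arg_cong2[of _ _ _ _ "(+)"] sum.cong) auto
      also have "\<dots> = 1 + real (count (mset g) c)"
        using cm that by (subst sum.remove[of _ c]) (simp_all add: count_mset_eq_sum[of g c] del: sum_of_bool_eq)
      finally show ?thesis by simp
    qed
    have mset: "mset f = mset (h i @ [c, c])" if "i \<le> t" "f ! i = c" for i
    proof -
      have f: "f = take t f @ [f ! t, c]"
        using len by (simp add: c_def take_Suc_conv_app_nth list_eq_iff_nth_eq nth_append less_Suc_eq)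
      show ?thesis
      proof (cases "i < t")
        case True
        have "c \<in># mset (take t f)" using True that len by (metis in_set_conv_nth length_take min.absorb2 nth_take set_mset_mset less_imp_le_nat lessI le_SucI)
        then show ?thesis
          using True that(2) len by (subst f) (simp add: h_def mset_update insert_DiffM)
      next
        case False
        then show ?thesis using that len by (subst f) (simp add: h_def list_update_beyond)
      qed
    qed
    have amp: "pairing_amp f = pairing_amp (h i) * of_nat (Suc (count (mset (h i)) c))"
      if "i \<le> t" "f ! i = c" for i
      using pairing_amp_mset[OF mset[OF that]] by (simp only: pairing_amp_snoc2)
    define M where "M = (real m + real t) * (real t + 1)"
    have hits: "(\<Sum>x<m + t. \<Sum>i<Suc t. of_bool (urn_insert m g x i = f))
        = (\<Sum>i\<le>t. of_bool (f ! i = c) * (of_bool (g = h i) * real (Suc (count (mset g) c))))"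
      if "g \<in> mode_lists t m" for g
    proof -
      have lg: "length g = t" using that by (simp add: mode_lists_def)
      have "(\<Sum>x<m + t. \<Sum>i<Suc t. of_bool (urn_insert m g x i = f) :: real)
          = (\<Sum>i\<le>t. \<Sum>x<m + t. of_bool (f ! i = c) * (of_bool (g = h i)
              * of_bool ((if x < m then x else g ! (x - m)) = c)))"
        unfolding lessThan_Suc_atMost
        by (subst sum.swap, intro sum.cong refl)
          (simp only: atMost_iff urn_insert_eq_iff[OF len lg] of_bool_conj c_def h_def mult_ac)
      also have "\<dots> = (\<Sum>i\<le>t. of_bool (f ! i = c) * (of_bool (g = h i) * real (Suc (count (mset g) c))))"
        unfolding sum_distrib_left[symmetric] choices[OF lg] ..
      finally show ?thesis .
    qed
    have "pmf (bind_pmf D (urn_step m)) f = (\<Sum>g\<in>mode_lists t m. (cmod (pairing_amp g))\<^sup>2 / Z *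
        ((\<Sum>i\<le>t. of_bool (f ! i = c) * (of_bool (g = h i) * real (Suc (count (mset g) c)))) / M))"
      unfolding eq by (intro sum.cong refl) (simp only: step hits M_def)
    also have "\<dots> = (\<Sum>i\<le>t. \<Sum>g\<in>mode_lists t m. of_bool (g = h i) *
        (of_bool (f ! i = c) * ((cmod (pairing_amp g))\<^sup>2 * real (Suc (count (mset g) c)) / (Z * M))))"
      by (subst sum.swap, intro sum.cong refl) (simp only: sum_distrib_left sum_divide_distrib
          times_divide_eq_right times_divide_eq_left divide_divide_eq_left mult_ac)
    also have "\<dots> = (\<Sum>i\<le>t. of_bool (f ! i = c) *
        ((cmod (pairing_amp (h i)))\<^sup>2 * real (Suc (count (mset (h i)) c)) / (Z * M)))"
    proof (intro sum.cong refl)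
      fix i assume "i \<in> {..t}"
      then have "h i \<in> mode_lists t m" using h by simp
      then show "(\<Sum>g\<in>mode_lists t m. of_bool (g = h i) *
        (of_bool (f ! i = c) * ((cmod (pairing_amp g))\<^sup>2 * real (Suc (count (mset g) c)) / (Z * M))))
        = of_bool (f ! i = c) *
        ((cmod (pairing_amp (h i)))\<^sup>2 * real (Suc (count (mset (h i)) c)) / (Z * M))"
        by (subst sum.remove[of _ "h i"]) (auto intro!: sum.neutral)
    qed
    also have "\<dots> = (\<Sum>i\<le>t. of_bool (f ! i = c) *
        ((cmod (pairing_amp (h i)))\<^sup>2 * real (Suc (count (mset (h i)) c)))) / (Z * M)"
      by (simp only: sum_divide_distrib times_divide_eq_right)
    also have "(\<Sum>i\<le>t. of_bool (f ! i = c) *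
        ((cmod (pairing_amp (h i)))\<^sup>2 * real (Suc (count (mset (h i)) c)))) = (cmod (pairing_amp f))\<^sup>2"
    proof -
      have "complex_of_real ((cmod (pairing_amp f))\<^sup>2) = pairing_amp f * cnj (pairing_amp f)"
        by (rule complex_norm_square)
      also have "\<dots> = (\<Sum>i\<le>t. of_bool (c = f ! i) * pairing_amp (h i)) * cnj (pairing_amp f)"
        unfolding pairing_amp_def c_def h_def
        by (subst list_hafnian_expand_last[OF _ len]) auto
      also have "\<dots> = (\<Sum>i\<le>t. of_bool (c = f ! i) * (pairing_amp (h i) * cnj (pairing_amp f)))"
        by (simp only: sum_distrib_right mult.assoc)
      also have "\<dots> = (\<Sum>i\<le>t. of_bool (f ! i = c) * complex_of_real
          ((cmod (pairing_amp (h i)))\<^sup>2 * real (Suc (count (mset (h i)) c))))"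
      proof (intro sum.cong refl)
        fix i assume i: "i \<in> {..t}"
        show "of_bool (c = f ! i) * (pairing_amp (h i) * cnj (pairing_amp f))
          = of_bool (f ! i = c) * complex_of_real
          ((cmod (pairing_amp (h i)))\<^sup>2 * real (Suc (count (mset (h i)) c)))"
        proof (cases "f ! i = c")
          case True
          have "pairing_amp (h i) * cnj (pairing_amp f) = pairing_amp (h i) * cnj (pairing_amp (h i))
              * of_nat (Suc (count (mset (h i)) c))"
            using amp[of i] i True by (simp only: atMost_iff complex_cnj_mult complex_cnj_of_nat mult.assoc)
          then show ?thesis using True by (simp only: complex_norm_square of_real_mult of_real_of_nat_eq)
        qed auto
      qed
      also have "\<dots> = complex_of_real (\<Sum>i\<le>t. of_bool (f ! i = c) *
        ((cmod (pairing_amp (h i)))\<^sup>2 * real (Suc (count (mset (h i)) c))))"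
        by (simp only: of_real_sum of_real_mult of_bool_def if_distrib[of complex_of_real] of_real_0 of_real_1)
      finally show ?thesis by (simp only: of_real_eq_iff)
    qed
    finally show ?thesis using True by (simp add: M_def)
  qed
qed

lemma pair_binom_Suc:
  "pair_binom m (2 * Suc k) = pair_binom m (2 * k) * ((real m + 2 * real k) / (2 * real k + 2))"
proof -
  define a :: real where "a = (real m + real (2 * k)) / 2"
  have b: "pair_binom m (2 * k) = (a - 1) gchoose k" "pair_binom m (2 * Suc k) = a gchoose Suc k"
    by (simp_all add: pair_binom_def a_def add_divide_distrib)
  have "real (Suc k) * pair_binom m (2 * Suc k) = a * pair_binom m (2 * k)"
    unfolding b by (rule gbinomial_absorption)
  then show ?thesis by (simp add: a_def field_simps)
qed

lemma pmf_urn_chain: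
  assumes m: "0 < m"
  shows "pmf (kernel_chain (\<lambda>_. urn_step m) k 0 []) f = (if f \<in> mode_lists (2 * k) m
    then (cmod (pairing_amp f))\<^sup>2 / (fact (2 * k) * pair_binom m (2 * k)) else 0)"
proof (induction k arbitrary: f)
  case 0
  have "pairing_amp [] = 1" by (simp add: pairing_amp_def list_hafnian_def)
  then show ?case by (auto simp: mode_lists_def pair_binom_def indicator_def)
next
  case (Suc k)
  have "fact (2 * Suc k) = fact (2 * k) * ((2 * real k + 1) * (2 * real k + 2))"
    by (simp add: algebra_simps)
  then have Z: "fact (2 * Suc k) * pair_binom m (2 * Suc k)
      = fact (2 * k) * pair_binom m (2 * k) * ((real m + real (2 * k)) * (real (2 * k) + 1))"
    unfolding pair_binom_Suc by (simp add: field_simps)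
  have "pmf (kernel_chain (\<lambda>_. urn_step m) (Suc k) 0 []) f
      = (if f \<in> mode_lists (Suc (Suc (2 * k))) m
         then (cmod (pairing_amp f))\<^sup>2 / (fact (2 * k) * pair_binom m (2 * k)
            * ((real m + real (2 * k)) * (real (2 * k) + 1))) else 0)"
    unfolding kernel_chain_Suc using Suc.IH by (intro pmf_urn_step m)
  then show ?case unfolding Z by simp
qed

lemma pmf_resample:
  assumes k: "k < n"
    and D: "\<And>g. pmf D g = (if g \<in> mode_lists n m then a g / Z else 0)"
    and a: "\<And>g. g \<in> mode_lists n m \<Longrightarrow> 0 \<le> a g"
    and a': "\<And>g. g \<in> mode_lists n m \<Longrightarrow> 0 \<le> a' g"
    and eq: "\<And>g. g \<in> mode_lists n m \<Longrightarrow> (\<Sum>f<m. a (g[k := f])) = (\<Sum>e<m. a' (g[k := e]))"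
    and R: "\<And>g y. g \<in> mode_lists n m \<Longrightarrow> 0 < (\<Sum>e<m. a' (g[k := e])) \<Longrightarrow>
      pmf (R g) y = (if y < m then a' (g[k := y]) / (\<Sum>e<m. a' (g[k := e])) else 0)"
  shows "pmf (bind_pmf D (\<lambda>g. map_pmf (\<lambda>e. g[k := e]) (R g))) f
    = (if f \<in> mode_lists n m then a' f / Z else 0)"
proof -
  have upd: "g[k := e] \<in> mode_lists n m" if "g \<in> mode_lists n m" "e < m" for g e
    using that set_update_subset_insert[of g k e] by (auto simp: mode_lists_def)
  define T where "T g = (\<Sum>e<m. a' (g[k := e]))" for g
  have T: "T (g[k := e]) = T g" for g e by (simp add: T_def)
  have supp: "set_pmf D \<subseteq> mode_lists n m" using D by (auto simp: set_pmf_eq)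
  have T0: "0 \<le> T g" if "g \<in> mode_lists n m" for g
    unfolding T_def using a' upd that by (intro sum_nonneg) auto
  have le: "a g \<le> T g" if "g \<in> mode_lists n m" for g
  proof -
    have "a (g[k := g ! k]) \<le> (\<Sum>f<m. a (g[k := f]))"
      using that a upd k mode_lists_nth[OF that] by (intro member_le_sum) auto
    then show ?thesis using eq[OF that] by (simp add: T_def)
  qed
  have summand: "pmf D g * pmf (map_pmf (\<lambda>e. g[k := e]) (R g)) f
      = (if f \<in> mode_lists n m \<and> g = f[k := g ! k] \<and> T f > 0 then a g / Z * (a' f / T f) else 0)"
    if g: "g \<in> mode_lists n m" for g
  proof (cases "T g = 0")
    case True
    then have "pmf D g = 0" using le[OF g] a[OF g] g by (simp add: D)
    moreover have "T f = 0" if "g = f[k := g ! k]" using True T[of f "g ! k"] that by simp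
    ultimately show ?thesis by auto
  next
    case False
    then have pos: "0 < T g" using T0[OF g] by simp
    have pR: "pmf (R g) y = (if y < m then a' (g[k := y]) / T g else 0)" for y
      using R[OF g] pos by (simp add: T_def)
    have "set_pmf (R g) \<subseteq> {..<m}" using pR by (auto simp: set_pmf_eq split: if_splits)
    then have p: "pmf (map_pmf (\<lambda>e. g[k := e]) (R g)) f
        = (\<Sum>e<m. a' (g[k := e]) / T g * of_bool (g[k := e] = f))"
      by (subst pmf_map_finite[of "{..<m}"]) (auto simp: pR intro!: sum.cong)
    have lg: "length g = n" using g by (simp add: mode_lists_def)
    show ?thesis
    proof (cases "f \<in> mode_lists n m \<and> g = f[k := g ! k]")
      case True
      then have fk: "f ! k < m" and lf: "length f = n" using k by (auto intro: mode_lists_nth simp: mode_lists_def)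
      have iff: "g[k := e] = f \<longleftrightarrow> e = f ! k" for e
      proof
        assume "g[k := e] = f" then show "e = f ! k" using k lg by auto
      next
        assume "e = f ! k"
        then have "g[k := e] = (f[k := g ! k])[k := f ! k]" using True by simp
        then show "g[k := e] = f" by simp
      qed
      have "T f = T g" using T[of f "g ! k"] True by simp
      have gf: "g[k := f ! k] = f" using iff by simp
      have "(\<Sum>e<m. a' (g[k := e]) / T g * of_bool (g[k := e] = f)) = a' f / T g"
        using fk by (subst sum.remove[of _ "f ! k"]) (auto simp: iff gf intro!: sum.neutral)
      with \<open>T f = T g\<close> show ?thesis
        unfolding p using conjunct1[OF True] conjunct2[OF True, symmetric] pos g by (simp add: D)
    next
      case False
      have "g[k := e] \<noteq> f" if "e < m" for e
        using False upd[OF g that] list_update_id[of g k] by (metis list_update_overwrite)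
      then show ?thesis unfolding p using False by (auto intro!: sum.neutral)
    qed
  qed
  have "pmf (bind_pmf D (\<lambda>g. map_pmf (\<lambda>e. g[k := e]) (R g))) f
      = (\<Sum>g\<in>mode_lists n m. if f \<in> mode_lists n m \<and> g = f[k := g ! k] \<and> T f > 0
          then a g / Z * (a' f / T f) else 0)"
    by (simp add: pmf_bind_finite[OF _ supp] summand cong: sum.cong)
  also have "\<dots> = (if f \<in> mode_lists n m then a' f / Z else 0)"
  proof (cases "f \<in> mode_lists n m")
    case f: True
    have lf: "length f = n" using f by (simp add: mode_lists_def)
    have inj: "inj_on (\<lambda>e. f[k := e]) {..<m}" using k lf by (auto simp: inj_on_def dest: arg_cong[of _ _ "\<lambda>l. l ! k"])
    have img: "{g \<in> mode_lists n m. g = f[k := g ! k]} = (\<lambda>e. f[k := e]) ` {..<m}"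
      using upd[OF f] k lf by (auto simp: image_iff mode_lists_nth intro!: bexI[of _ "_ ! k"])
    show ?thesis
    proof (cases "T f > 0")
      case True
      have "(\<Sum>g\<in>mode_lists n m. if f \<in> mode_lists n m \<and> g = f[k := g ! k] \<and> T f > 0
          then a g / Z * (a' f / T f) else 0) = (\<Sum>g\<in>{g \<in> mode_lists n m. g = f[k := g ! k]}. a g / Z * (a' f / T f))"
        using f True by (subst sum.inter_filter) (auto intro!: sum.cong)
      also have "\<dots> = (\<Sum>e<m. a (f[k := e]) / Z * (a' f / T f))"
        unfolding img by (simp add: sum.reindex[OF inj])
      also have "\<dots> = (\<Sum>e<m. a (f[k := e])) / Z * (a' f / T f)"
        by (simp add: sum_distrib_right sum_divide_distrib)
      also have "\<dots> = a' f / Z" using True eq[OF f] by (simp add: T_def)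
      finally show ?thesis using f by simp
    next
      case False
      then have "T f = 0" using T0[OF f] by simp
      moreover have "a' (f[k := f ! k]) \<le> T f"
        unfolding T_def using f a' upd k mode_lists_nth[OF f] by (intro member_le_sum) auto
      ultimately have "a' f = 0" using a'[OF f] by simp
      then show ?thesis using False by simp
    qed
  qed simp
  finally show ?thesis .
qed

text \<open>In stage \<open>k\<close> of the sampler, slots below \<open>k\<close> hold output modes and the other slots
  hold input modes.\<close>

definition slot :: "complex mat \<Rightarrow> nat \<Rightarrow> nat list \<Rightarrow> nat \<Rightarrow> nat \<Rightarrow> complex" where
  "slot U k g i l = (if i < k then U $$ (g ! i, l) else of_bool (g ! i = l))"

definition overlap :: "complex mat \<Rightarrow> nat \<Rightarrow> nat list \<Rightarrow> nat \<Rightarrow> nat \<Rightarrow> complex" where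
  "overlap U k g i j = (\<Sum>l<dim_row U. slot U k g i l * slot U k g j l)"

definition stage_amp :: "complex mat \<Rightarrow> nat \<Rightarrow> nat list \<Rightarrow> complex" where
  "stage_amp U k g = hafnian (overlap U k g) {..<length g}"

lemma overlap_sym: "overlap U k g i j = overlap U k g j i"
  by (simp add: overlap_def mult.commute)

definition partner_amp :: "complex mat \<Rightarrow> nat \<Rightarrow> nat list \<Rightarrow> nat \<Rightarrow> complex" where
  "partner_amp U k g x = hafnian (overlap U k g) ({..<length g} - {k, x})"

definition input_amp :: "complex mat \<Rightarrow> nat \<Rightarrow> nat list \<Rightarrow> nat \<Rightarrow> complex" where
  "input_amp U k g l = (\<Sum>x\<in>{..<length g} - {k}. partner_amp U k g x * slot U k g x l)"

lemma stage_amp_update: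
  assumes k: "k < length g"
    and other: "\<And>x l. x \<noteq> k \<Longrightarrow> slot U k' (g[k := e]) x l = slot U k g x l"
  shows "stage_amp U k' (g[k := e]) = (\<Sum>l<dim_row U. slot U k' (g[k := e]) k l * input_amp U k g l)"
proof -
  let ?g = "g[k := e]"
  have "stage_amp U k' ?g = (\<Sum>x\<in>{..<length g} - {k}. overlap U k' ?g k x
      * hafnian (overlap U k' ?g) ({..<length g} - {k, x}))"
    unfolding stage_amp_def length_list_update
    by (rule hafnian_expand) (use k overlap_sym in auto)
  also have "\<dots> = (\<Sum>x\<in>{..<length g} - {k}. \<Sum>l<dim_row U.
      slot U k' ?g k l * (partner_amp U k g x * slot U k g x l))"
  proof (intro sum.cong refl)
    fix x assume x: "x \<in> {..<length g} - {k}"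
    have "hafnian (overlap U k' ?g) ({..<length g} - {k, x}) = partner_amp U k g x"
      unfolding partner_amp_def
      by (intro hafnian_cong) (auto simp: overlap_def other)
    moreover have "overlap U k' ?g k x = (\<Sum>l<dim_row U. slot U k' ?g k l * slot U k g x l)"
      using x by (simp add: overlap_def other)
    ultimately show "overlap U k' ?g k x * hafnian (overlap U k' ?g) ({..<length g} - {k, x})
      = (\<Sum>l<dim_row U. slot U k' ?g k l * (partner_amp U k g x * slot U k g x l))"
      by (simp add: sum_distrib_left sum_distrib_right mult_ac)
  qed
  also have "\<dots> = (\<Sum>l<dim_row U. slot U k' ?g k l * input_amp U k g l)"
    unfolding input_amp_def sum_distrib_left by (rule sum.swap)
  finally show ?thesis .
qed

lemma stage_amp_out:
  assumes "k < length g"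
  shows "stage_amp U (Suc k) (g[k := e]) = (\<Sum>l<dim_row U. U $$ (e, l) * input_amp U k g l)"
proof -
  have "stage_amp U (Suc k) (g[k := e])
      = (\<Sum>l<dim_row U. slot U (Suc k) (g[k := e]) k l * input_amp U k g l)"
    by (rule stage_amp_update) (use assms in \<open>auto simp: slot_def\<close>)
  then show ?thesis using assms by (simp add: slot_def)
qed

lemma stage_amp_in:
  assumes "k < length g" "f < dim_row U"
  shows "stage_amp U k (g[k := f]) = input_amp U k g f"
proof -
  have "stage_amp U k (g[k := f])
      = (\<Sum>l<dim_row U. slot U k (g[k := f]) k l * input_amp U k g l)"
    by (rule stage_amp_update) (use assms in \<open>auto simp: slot_def\<close>)
  also have "\<dots> = (\<Sum>l<dim_row U. of_bool (f = l) * input_amp U k g l)"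
    using assms by (simp add: slot_def)
  also have "\<dots> = input_amp U k g f"
    using assms(2) by (subst sum.remove[of _ f]) (auto intro!: sum.neutral)
  finally show ?thesis .
qed

lemma unitary_isometry:
  assumes U: "U \<in> carrier_mat m m" "unitary U"
  shows "(\<Sum>e<m. (cmod (\<Sum>l<m. U $$ (e, l) * \<phi> l))\<^sup>2) = (\<Sum>l<m. (cmod (\<phi> l))\<^sup>2)"
proof -
  have dims: "dim_row U = m" "dim_col U = m" using U(1) by auto
  have orth: "(\<Sum>e<m. cnj (U $$ (e, l)) * U $$ (e, l')) = of_bool (l = l')" if "l < m" "l' < m" for l l'
  proof -
    have "(\<Sum>e<m. cnj (U $$ (e, l)) * U $$ (e, l')) = (mat_adjoint U * U) $$ (l, l')"
      using that dims by (auto simp: mat_adjoint_def scalar_prod_def lessThan_atLeast0 mat_of_rows_def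
          intro!: sum.cong)
    also have "mat_adjoint U * U = 1\<^sub>m m" using U(2) dims by (simp add: unitary_def)
    finally show ?thesis using that by simp
  qed
  have "complex_of_real (\<Sum>e<m. (cmod (\<Sum>l<m. U $$ (e, l) * \<phi> l))\<^sup>2)
      = (\<Sum>e<m. (\<Sum>l'<m. U $$ (e, l') * \<phi> l') * (\<Sum>l<m. cnj (U $$ (e, l)) * cnj (\<phi> l)))"
    by (simp only: of_real_sum complex_norm_square cnj_sum complex_cnj_mult)
  also have "\<dots> = (\<Sum>e<m. \<Sum>l<m. \<Sum>l'<m. cnj (\<phi> l) * \<phi> l' * (cnj (U $$ (e, l)) * U $$ (e, l')))"
    unfolding sum_product by (subst sum.swap) (simp add: mult_ac)
  also have "\<dots> = (\<Sum>l<m. \<Sum>l'<m. \<Sum>e<m. cnj (\<phi> l) * \<phi> l' * (cnj (U $$ (e, l)) * U $$ (e, l')))"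
    by (subst sum.swap, rule sum.cong[OF refl], rule sum.swap)
  also have "\<dots> = (\<Sum>l<m. \<Sum>l'<m. cnj (\<phi> l) * \<phi> l' * of_bool (l = l'))"
    unfolding sum_distrib_left[symmetric] by (intro sum.cong refl) (simp add: orth)
  also have "\<dots> = (\<Sum>l<m. cnj (\<phi> l) * \<phi> l)"
  proof (intro sum.cong refl)
    fix l assume "l \<in> {..<m}"
    then show "(\<Sum>l'<m. cnj (\<phi> l) * \<phi> l' * of_bool (l = l')) = cnj (\<phi> l) * \<phi> l"
      by (subst sum.remove[of _ l]) (auto intro!: sum.neutral)
  qed
  also have "\<dots> = complex_of_real (\<Sum>l<m. (cmod (\<phi> l))\<^sup>2)"
    by (simp only: of_real_sum complex_norm_square mult.commute)
  finally show ?thesis by (simp only: of_real_eq_iff)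
qed

lemma stage_norm:
  assumes U: "U \<in> carrier_mat m m" "unitary U" and k: "k < length g"
  shows "(\<Sum>f<m. (cmod (stage_amp U k (g[k := f])))\<^sup>2) = (\<Sum>e<m. (cmod (stage_amp U (Suc k) (g[k := e])))\<^sup>2)"
  using U k unitary_isometry[OF U, of "input_amp U k g"]
  by (auto simp: stage_amp_out stage_amp_in intro!: sum.cong)

lemma stage_amp_0:
  assumes "U \<in> carrier_mat m m" "g \<in> mode_lists n m"
  shows "stage_amp U 0 g = pairing_amp g"
  unfolding stage_amp_def pairing_amp_def list_hafnian_def
proof (rule hafnian_cong)
  fix i j assume "i \<in> {..<length g}" "j \<in> {..<length g}"
  then have "g ! i < m" using assms(2) by (intro mode_lists_nth) (auto simp: mode_lists_def)
  then show "overlap U 0 g i j = of_bool (g ! i = g ! j)"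
    using assms(1) unfolding overlap_def slot_def
    by (subst sum.remove[of _ "g ! i"]) (auto intro!: sum.neutral)
qed

lemma stage_amp_full:
  assumes "U \<in> carrier_mat m m" "g \<in> mode_lists n m"
  shows "stage_amp U n g = list_hafnian (\<lambda>a b. \<Sum>l<m. U $$ (a, l) * U $$ (b, l)) g"
  unfolding stage_amp_def list_hafnian_def
  by (rule hafnian_cong) (use assms in \<open>auto simp: overlap_def slot_def mode_lists_def\<close>)

lemma partner_amp_inclusion_exclusion:
  assumes n: "length g = 2 * Suc p" and k: "k < length g" "x < length g" "x \<noteq> k"
  shows "(\<Sum>S\<in>Pow {..<length g}. of_bool (k \<notin> S \<and> x \<notin> S) * ((-1) ^ card S
      * (\<Sum>l<dim_row U. (\<Sum>i\<in>S. slot U k g i l)\<^sup>2) ^ p)) = 2 ^ p * fact p * partner_amp U k g x"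
proof -
  let ?A = "{..<length g} - {k, x}"
  have "card ?A = card {..<length g} - card {k, x}" using k by (intro card_Diff_subset) auto
  then have card: "card ?A = 2 * p" using n k by simp
  have "(\<Sum>S\<in>Pow {..<length g}. of_bool (k \<notin> S \<and> x \<notin> S) * ((-1) ^ card S
      * (\<Sum>l<dim_row U. (\<Sum>i\<in>S. slot U k g i l)\<^sup>2) ^ p))
    = (\<Sum>S\<in>Pow ?A. (-1) ^ card S * (\<Sum>l<dim_row U. (\<Sum>i\<in>S. slot U k g i l)\<^sup>2) ^ p)"
    by (rule sum.mono_neutral_cong_right) auto
  also have "\<dots> = alternating_power_sum (overlap U k g) ?A {} p"
  proof -
    have "(\<Sum>i\<in>S. \<Sum>j\<in>S. overlap U k g i j) = (\<Sum>l<dim_row U. (\<Sum>i\<in>S. slot U k g i l)\<^sup>2)" for S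
    proof -
      have "(\<Sum>i\<in>S. \<Sum>j\<in>S. overlap U k g i j)
          = (\<Sum>l<dim_row U. \<Sum>i\<in>S. \<Sum>j\<in>S. slot U k g i l * slot U k g j l)"
        unfolding overlap_def by (rule trans[OF sum.cong[OF refl sum.swap] sum.swap])
      then show ?thesis by (simp only: power2_eq_square sum_product)
    qed
    then show ?thesis by (simp only: alternating_power_sum_def Un_empty_right)
  qed
  also have "\<dots> = 2 ^ p * fact p * partner_amp U k g x"
    unfolding partner_amp_def
    by (rule alternating_power_sum_eq_hafnian) (use overlap_sym card in auto)
  finally show ?thesis .
qed

lemma photon_modes_snoc: "photon_modes (s @ [a]) = photon_modes s @ replicate a (length s)"
proof -
  have "map (\<lambda>j. replicate ((s @ [a]) ! j) j) [0..<length s] = map (\<lambda>j. replicate (s ! j) j) [0..<length s]"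
    by (intro map_cong refl) (simp add: nth_append)
  then have "photon_modes (s @ [a]) = concat (map (\<lambda>j. replicate (s ! j) j) [0..<length s])
      @ replicate ((s @ [a]) ! length s) (length s)"
    by (simp only: photon_modes_def length_append_singleton upt_Suc_append[of 0] map_append concat_append
        le0 list.map concat.simps append_Nil2)
  then show ?thesis by (simp add: photon_modes_def)
qed

lemma count_photon_modes:
  "count (mset (photon_modes s)) j = (if j < length s then s ! j else 0)"
proof (induction s rule: rev_induct)
  case Nil
  then show ?case by (simp add: photon_modes_def)
next
  case (snoc a s)
  then show ?case by (auto simp: photon_modes_snoc nth_append)
qed

lemma length_photon_modes: "length (photon_modes s) = sum_list s"
  by (induction s rule: rev_induct) (simp_all add: photon_modes_snoc, simp add: photon_modes_def)

lemma set_photon_modes: "set (photon_modes s) \<subseteq> {..<length s}"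
proof
  fix j assume "j \<in> set (photon_modes s)"
  then have "0 < count (mset (photon_modes s)) j" by simp
  then show "j \<in> {..<length s}" by (simp add: count_photon_modes split: if_splits)
qed

definition mode_counts :: "nat \<Rightarrow> nat list \<Rightarrow> nat list" where
  "mode_counts m g = map (count (mset g)) [0..<m]"

lemma mode_counts_eq_iff:
  assumes "g \<in> mode_lists n m"
  shows "mode_counts m g = s \<longleftrightarrow> length s = m \<and> mset g = mset (photon_modes s)"
proof
  assume s: "mode_counts m g = s"
  then have len: "length s = m" by (auto simp: mode_counts_def)
  have "count (mset g) j = count (mset (photon_modes s)) j" for j
    using assms by (auto simp: count_photon_modes s[symmetric] mode_counts_def mode_lists_def)
  then show "length s = m \<and> mset g = mset (photon_modes s)" using len by (auto intro: multiset_eqI)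
next
  assume "length s = m \<and> mset g = mset (photon_modes s)"
  then show "mode_counts m g = s"
    by (auto simp: mode_counts_def count_photon_modes intro!: nth_equalityI)
qed

lemma sum_list_mode_counts:
  assumes "g \<in> mode_lists n m"
  shows "sum_list (mode_counts m g) = n"
proof -
  have "mset g = mset (photon_modes (mode_counts m g))"
    using mode_counts_eq_iff[OF assms] by blast
  then have "length g = sum_list (mode_counts m g)"
    using length_photon_modes mset_eq_length by metis
  then show ?thesis using assms by (simp add: mode_lists_def)
qed

lemma Haf_repeat_mat:
  assumes U: "U \<in> carrier_mat m m" and s: "length s = m"
  shows "Haf (repeat_mat (U * transpose_mat U) s)
    = list_hafnian (\<lambda>a b. \<Sum>l<m. U $$ (a, l) * U $$ (b, l)) (photon_modes s)"
proof -
  let ?e = "photon_modes s"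
  have "Haf (repeat_mat (U * transpose_mat U) s)
      = hafnian (\<lambda>i j. repeat_mat (U * transpose_mat U) s $$ (i, j)) {..<length ?e}"
    by (simp add: Haf_def hafnian_def repeat_mat_def Let_def)
  also have "\<dots> = list_hafnian (\<lambda>a b. \<Sum>l<m. U $$ (a, l) * U $$ (b, l)) ?e"
    unfolding list_hafnian_def
  proof (rule hafnian_cong)
    fix i j assume ij: "i \<in> {..<length ?e}" "j \<in> {..<length ?e}"
    then have "?e ! i < m" "?e ! j < m" using set_photon_modes[of s] s nth_mem by blast+
    then show "repeat_mat (U * transpose_mat U) s $$ (i, j) = (\<Sum>l<m. U $$ (?e ! i, l) * U $$ (?e ! j, l))"
      using ij U by (simp add: repeat_mat_def Let_def scalar_prod_def lessThan_atLeast0)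
  qed
  finally show ?thesis .
qed

lemma pmf_mode_counts:
  assumes U: "U \<in> carrier_mat m m"
    and D: "\<And>g. pmf D g = (if g \<in> mode_lists n m
      then (cmod (stage_amp U n g))\<^sup>2 / (fact n * pair_binom m n) else 0)"
  shows "pmf (map_pmf (mode_counts m) D) s = config_prob U n s"
proof -
  have supp: "set_pmf D \<subseteq> mode_lists n m" using D by (auto simp: set_pmf_eq)
  have "pmf (map_pmf (mode_counts m) D) s
      = (\<Sum>g\<in>mode_lists n m. pmf D g * of_bool (mode_counts m g = s))"
    by (rule pmf_map_finite[OF _ supp]) simp
  also have "\<dots> = (\<Sum>g\<in>{g \<in> mode_lists n m. mode_counts m g = s}. pmf D g)"
    by (rule sum.mono_neutral_cong_right) auto
  also have "\<dots> = config_prob U n s"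
  proof (cases "length s = m \<and> sum_list s = n")
    case True
    let ?e = "photon_modes s" and ?W = "\<lambda>a b. \<Sum>l<m. U $$ (a, l) * U $$ (b, l)"
    have perms: "{g \<in> mode_lists n m. mode_counts m g = s} = permutations_of_multiset (mset ?e)"
    proof -
      have "g \<in> mode_lists n m" if "mset g = mset ?e" for g
        using that True set_photon_modes[of s] length_photon_modes[of s]
        by (auto simp: mode_lists_def dest: mset_eq_setD mset_eq_length)
      moreover have "mode_counts m g = s \<longleftrightarrow> mset g = mset ?e" if "g \<in> mode_lists n m" for g
        using mode_counts_eq_iff[OF that] True by blast
      ultimately show ?thesis unfolding permutations_of_multiset_def by blast
    qed
    have amp: "stage_amp U n g = list_hafnian ?W ?e" if "g \<in> permutations_of_multiset (mset ?e)" for g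
    proof -
      have g: "g \<in> mode_lists n m" "mset g = mset ?e"
        using that perms by (auto simp: permutations_of_multiset_def)
      show ?thesis unfolding stage_amp_full[OF U g(1)]
        by (rule list_hafnian_mset[OF _ g(2)]) (simp add: mult.commute)
    qed
    have prod: "(\<Prod>x\<in>set_mset (mset ?e). fact (count (mset ?e) x)) = (\<Prod>j<m. fact (s ! j) :: nat)"
    proof (rule prod.mono_neutral_cong_left)
      show "set_mset (mset ?e) \<subseteq> {..<m}" using True set_photon_modes[of s] by simp
      show "\<forall>i\<in>{..<m} - set_mset (mset ?e). fact (s ! i) = (1 :: nat)"
      proof
        fix i assume "i \<in> {..<m} - set_mset (mset ?e)"
        then have "count (mset ?e) i = 0" "i < length s" using True by (auto simp: count_eq_zero_iff)
        then show "fact (s ! i) = (1 :: nat)" by (simp add: count_photon_modes)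
      qed
      show "fact (count (mset ?e) x) = (fact (s ! x) :: nat)" if "x \<in> set_mset (mset ?e)" for x
        using that set_photon_modes[of s] by (auto simp: count_photon_modes)
    qed simp
    have "card (permutations_of_multiset (mset ?e)) * (\<Prod>j<m. fact (s ! j)) = fact n"
      using card_permutations_of_multiset_aux[of "mset ?e"] length_photon_modes[of s] True
      unfolding prod by simp
    then have "real (card (permutations_of_multiset (mset ?e))) * (\<Prod>j<m. fact (s ! j)) = fact n"
      by (metis (mono_tags, lifting) of_nat_fact of_nat_mult of_nat_prod prod.cong)
    moreover have "(\<Prod>j<m. fact (s ! j) :: real) \<noteq> 0" by simp
    ultimately have card: "real (card (permutations_of_multiset (mset ?e))) = fact n / (\<Prod>j<m. fact (s ! j))"
      by (simp add: field_simps)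
    have "(\<Sum>g\<in>{g \<in> mode_lists n m. mode_counts m g = s}. pmf D g)
        = (\<Sum>g\<in>permutations_of_multiset (mset ?e). (cmod (list_hafnian ?W ?e))\<^sup>2 / (fact n * pair_binom m n))"
      using perms by (intro sum.cong) (auto simp: D amp)
    also have "\<dots> = fact n / (\<Prod>j<m. fact (s ! j)) * ((cmod (list_hafnian ?W ?e))\<^sup>2 / (fact n * pair_binom m n))"
      by (simp add: card)
    also have "\<dots> = (cmod (list_hafnian ?W ?e))\<^sup>2 / ((\<Prod>j<m. fact (s ! j)) * pair_binom m n)"
      by simp
    also have "\<dots> = config_prob U n s"
      using True U Haf_repeat_mat[OF U, of s] by (simp add: config_prob_def)
    finally show ?thesis .
  next
    case False
    have "{g \<in> mode_lists n m. mode_counts m g = s} = {}"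
      using False sum_list_mode_counts by (auto simp: mode_counts_def)
    moreover have "config_prob U n s = 0" using False U by (auto simp: config_prob_def)
    ultimately show ?thesis by (simp only: sum.empty)
  qed
  finally show ?thesis .
qed

definition resample_step :: "complex mat \<Rightarrow> real \<Rightarrow> nat \<Rightarrow> nat list \<Rightarrow> nat list pmf" where
  "resample_step U \<kappa> k g = map_pmf (\<lambda>e. g[k := e])
     (kernel_chain (reservoir_kernel (\<lambda>e. \<kappa> * (cmod (stage_amp U (Suc k) (g[k := e])))\<^sup>2)) (dim_row U) 0 0)"

lemma pmf_resample_chain:
  assumes U: "U \<in> carrier_mat m m" "unitary U" and \<kappa>: "0 < \<kappa>"
    and D: "\<And>g. pmf D g = (if g \<in> mode_lists n m then (cmod (stage_amp U 0 g))\<^sup>2 / Z else 0)"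
    and k: "k \<le> n"
  shows "pmf (bind_pmf D (kernel_chain (resample_step U \<kappa>) k 0)) f
    = (if f \<in> mode_lists n m then (cmod (stage_amp U k f))\<^sup>2 / Z else 0)"
  using k
proof (induction k arbitrary: f)
  case 0
  have "kernel_chain (resample_step U \<kappa>) 0 0 = return_pmf" by (rule ext) simp
  then show ?case by (simp add: bind_return_pmf' D)
next
  case (Suc k)
  have chain: "bind_pmf D (kernel_chain (resample_step U \<kappa>) (Suc k) 0)
      = bind_pmf (bind_pmf D (kernel_chain (resample_step U \<kappa>) k 0)) (resample_step U \<kappa> k)"
    unfolding bind_assoc_pmf by (intro bind_pmf_cong refl) (simp only: kernel_chain_Suc add_0)
  have dim: "dim_row U = m" using U by simp
  show ?case
    unfolding chain resample_step_def[of U \<kappa> k, abs_def]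
  proof (rule pmf_resample)
    fix g assume g: "g \<in> mode_lists n m"
    then have "k < length g" using Suc.prems by (simp add: mode_lists_def)
    then show "(\<Sum>f<m. (cmod (stage_amp U k (g[k := f])))\<^sup>2)
        = (\<Sum>e<m. (cmod (stage_amp U (Suc k) (g[k := e])))\<^sup>2)"
      by (rule stage_norm[OF U])
    fix y assume pos: "0 < (\<Sum>e<m. (cmod (stage_amp U (Suc k) (g[k := e])))\<^sup>2)"
    have sum: "(\<Sum>e<m. \<kappa> * (cmod (stage_amp U (Suc k) (g[k := e])))\<^sup>2)
        = \<kappa> * (\<Sum>e<m. (cmod (stage_amp U (Suc k) (g[k := e])))\<^sup>2)"
      by (simp only: sum_distrib_left)
    show "pmf (kernel_chain (reservoir_kernel (\<lambda>e. \<kappa> * (cmod (stage_amp U (Suc k) (g[k := e])))\<^sup>2))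
          (dim_row U) 0 0) y
      = (if y < m then (cmod (stage_amp U (Suc k) (g[k := y])))\<^sup>2
          / (\<Sum>e<m. (cmod (stage_amp U (Suc k) (g[k := e])))\<^sup>2) else 0)"
      unfolding dim by (subst pmf_reservoir) (use \<kappa> pos in \<open>simp_all add: sum\<close>)
  qed (use Suc in \<open>simp_all add: resample_step_def[abs_def]\<close>)
qed

lemma pmf_config_sampler:
  assumes "0 < m" and U: "U \<in> carrier_mat m m" "unitary U" and \<kappa>: "0 < \<kappa>" and n: "n = 2 * h"
  shows "pmf (map_pmf (mode_counts m)
      (bind_pmf (kernel_chain (\<lambda>_. urn_step m) h 0 []) (kernel_chain (resample_step U \<kappa>) n 0))) s
    = config_prob U n s"
proof (rule pmf_mode_counts[OF U(1)])
  fix g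
  show "pmf (bind_pmf (kernel_chain (\<lambda>_. urn_step m) h 0 []) (kernel_chain (resample_step U \<kappa>) n 0)) g
    = (if g \<in> mode_lists n m then (cmod (stage_amp U n g))\<^sup>2 / (fact n * pair_binom m n) else 0)"
    by (rule pmf_resample_chain[OF U \<kappa>])
      (use pmf_urn_chain[OF assms(1), of h] stage_amp_0[OF U(1)] n in auto)
qed

section \<open>The sampling programs\<close>

definition agree :: "nat set \<Rightarrow> (nat \<Rightarrow> 'a) \<Rightarrow> (nat \<Rightarrow> 'a) \<Rightarrow> bool" where
  "agree X I J \<longleftrightarrow> (\<forall>a. a \<notin> X \<longrightarrow> J a = I a)"

lemma agree_refl [simp]: "agree X I I"
  by (simp add: agree_def)

lemma agree_trans: "agree X I J \<Longrightarrow> agree X J K \<Longrightarrow> agree X I K"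
  by (simp add: agree_def)

lemma agree_mono: "agree X I J \<Longrightarrow> X \<subseteq> Y \<Longrightarrow> agree Y I J"
  by (auto simp: agree_def)

lemma agreeD: "agree X I J \<Longrightarrow> a \<notin> X \<Longrightarrow> J a = I a"
  by (simp add: agree_def)

lemma agree_upd [simp]: "a \<in> X \<Longrightarrow> agree X I (J(a := v)) \<longleftrightarrow> agree X I J"
  by (auto simp: agree_def)

abbreviation reg :: "nat \<Rightarrow> iexp" where "reg a \<equiv> ILoad (IConst a)"
abbreviation creg :: "nat \<Rightarrow> cexp" where "creg a \<equiv> CLoad (IConst a)"

text \<open>Slots occupy the cells from 20 on, followed by \<open>n + 1\<close> bits; index cell 0 holds \<open>n\<close>.\<close>

abbreviation slot_addr :: "iexp \<Rightarrow> iexp" where "slot_addr e \<equiv> IAdd (IConst 20) e"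
abbreviation bit_addr :: "iexp \<Rightarrow> iexp" where "bit_addr e \<equiv> IAdd (IAdd (IConst 20) (reg 0)) e"

definition slots :: "nat \<Rightarrow> (nat \<Rightarrow> nat) \<Rightarrow> nat list" where
  "slots n I = map (\<lambda>i. I (20 + i)) [0..<n]"

lemma length_slots [simp]: "length (slots n I) = n"
  by (simp add: slots_def)

lemma nth_slots [simp]: "i < n \<Longrightarrow> slots n I ! i = I (20 + i)"
  by (simp add: slots_def)

lemma slots_cong: "(\<And>i. i < n \<Longrightarrow> I (20 + i) = J (20 + i)) \<Longrightarrow> slots n I = slots n J"
  by (simp add: slots_def)

definition Uniform :: "iexp \<Rightarrow> com" where
  "Uniform b = Reservoir b (CStore (IConst 1) (OfIndex (IConst 1)))"

lemma run_dist_Uniform: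
  assumes bound: "\<And>J C. agree {2, 3, 4} I J \<Longrightarrow> ival P b (mem_state J C W) = N" and "4 < B"
  shows "run_dist P B (Uniform b) (N * (icost b + 38) + icost b + 20) I C W (\<lambda>I C W. I 3)
    (uniform_index N) (\<lambda>J D V. agree {2, 3, 4} I J \<and> V = W)"
proof -
  have "run_dist P B (Uniform b) (N * (4 + icost b + 34) + icost b + 20) I C W (\<lambda>I C W. I 3)
    (kernel_chain (reservoir_kernel (\<lambda>_. 1)) N 0 0) (\<lambda>J D V. agree {2, 3, 4} I J \<and> V = W)"
    unfolding Uniform_def
  proof (rule run_dist_Reservoir[where J = "\<lambda>_ J D V. agree {2, 3, 4} I J \<and> V = W"])
    fix i :: nat and J D V
    assume "agree {2, 3, 4} I J \<and> V = W" "J 2 = i"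
    then show "run P B (CStore (IConst 1) (OfIndex (IConst 1))) 4 J D V
      (\<lambda>I' C' W'. (agree {2, 3, 4} I I' \<and> W' = W) \<and> I' 2 = i \<and> I' 3 = J 3 \<and> C' 0 = D 0
         \<and> C' 1 = complex_of_real 1)"
      using assms(2) by (intro run_le[OF run_CStore]) auto
  qed (use assms in auto)
  then show ?thesis by (simp add: uniform_index_def algebra_simps)
qed

definition UrnStep :: com where
  "UrnStep = Seq (Uniform (IAdd Modes (reg 1))) (Seq (IStore (IConst 7) (reg 3))
     (Seq (Uniform (IAdd (reg 1) (IConst 1)))
     (Seq (If (ILess (reg 7) Modes) (IStore (IConst 8) (reg 7))
             (IStore (IConst 8) (ILoad (slot_addr (ISub (reg 7) Modes)))))
     (Seq (IStore (slot_addr (reg 1)) (ILoad (slot_addr (reg 3))))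
     (Seq (IStore (slot_addr (reg 3)) (reg 8))
     (Seq (IStore (slot_addr (IAdd (reg 1) (IConst 1))) (reg 8))
       (IStore (IConst 1) (IAdd (reg 1) (IConst 2)))))))))"

lemma run_dist_UrnStep:
  assumes t: "I 1 = t" "t + 2 \<le> n" and n: "I 0 = n" and B: "20 + n < B" and m: "dim_row (network P) = m" "0 < m"
  shows "run_dist P B UrnStep (100 * (m + n + 1)) I C W (\<lambda>I C W. slots (t + 2) I)
    (urn_step m (slots t I)) (\<lambda>J D V. J 0 = n \<and> J 1 = t + 2 \<and> V = W)"
proof -
  let ?g = "slots t I"
  let ?Q = "\<lambda>J D V. J 0 = n \<and> J 1 = t + 2 \<and> V = W"
  let ?fin = "Seq (If (ILess (reg 7) Modes) (IStore (IConst 8) (reg 7))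
             (IStore (IConst 8) (ILoad (slot_addr (ISub (reg 7) Modes)))))
     (Seq (IStore (slot_addr (reg 1)) (ILoad (slot_addr (reg 3))))
     (Seq (IStore (slot_addr (reg 3)) (reg 8))
     (Seq (IStore (slot_addr (IAdd (reg 1) (IConst 1))) (reg 8))
       (IStore (IConst 1) (IAdd (reg 1) (IConst 2))))))"
  have fin: "run_dist P B ?fin 70 J C W (\<lambda>I C W. slots (t + 2) I)
      (return_pmf (urn_insert m ?g x (J 3))) ?Q"
    if J: "agree {2, 3, 4, 7} I J" "J 7 = x" "x < m + t" "J 3 < Suc t" for J C x
  proof (rule run_dist_of_run, rule run_le, rule run_seq)
    let ?c = "if x < m then x else ?g ! (x - m)"
    have J0: "J 0 = n" "J 1 = t" "\<And>i. J (20 + i) = I (20 + i)"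
      using J(1) t n by (auto simp: agree_def)
    let ?R = "\<lambda>K V. (\<forall>i. K (20 + i) = I (20 + i)) \<and> K 0 = n \<and> K 1 = t \<and> K 3 = J 3 \<and> K 8 = ?c \<and> V = W"
    let ?rest = "Seq (IStore (slot_addr (reg 1)) (ILoad (slot_addr (reg 3))))
     (Seq (IStore (slot_addr (reg 3)) (reg 8))
     (Seq (IStore (slot_addr (IAdd (reg 1) (IConst 1))) (reg 8))
       (IStore (IConst 1) (IAdd (reg 1) (IConst 2)))))"
    have rest: "run P B ?rest 45 K D V (\<lambda>I C W. ?Q I C W \<and> slots (t + 2) I = urn_insert m ?g x (J 3))"
      if K: "?R K V" for K D V
    proof -
      have eq: "slots (t + 2) (K(20 + t := K (20 + J 3), 20 + J 3 := ?c, 21 + t := ?c, 1 := t + 2))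
          = urn_insert m ?g x (J 3)"
      proof (rule nth_equalityI)
        fix i assume "i < length (slots (t + 2) (K(20 + t := K (20 + J 3), 20 + J 3 := ?c, 21 + t := ?c, 1 := t + 2)))"
        then have "i < t + 2" by simp
        then consider "i < t" | "i = t" | "i = Suc t" by linarith
        then show "slots (t + 2) (K(20 + t := K (20 + J 3), 20 + J 3 := ?c, 21 + t := ?c, 1 := t + 2)) ! i
            = urn_insert m ?g x (J 3) ! i"
          by cases (use K J(4) in \<open>auto simp: urn_insert_def Let_def nth_list_update nth_append\<close>)
      qed (simp add: urn_insert_def Let_def)
      show ?thesis
        apply (rule run_le)
         apply (rule run_seq, rule run_IStore)
        subgoal using K t(2) B by simp
         apply (rule run_seq, rule run_IStore)
        subgoal using K J(4) t(2) B by simp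
         apply (rule run_seq, rule run_IStore)
        subgoal using K J(4) t(2) B by simp
         apply (rule run_IStore)
        subgoal using K J(4) t(2) B by simp
        subgoal using eq K J(4) n t by simp
        subgoal by simp
        done
    qed
    show "run P B (If (ILess (reg 7) Modes) (IStore (IConst 8) (reg 7))
             (IStore (IConst 8) (ILoad (slot_addr (ISub (reg 7) Modes))))) 20 J C W
        (\<lambda>I' C W. run P B ?rest 45 I' C W (\<lambda>I C W. ?Q I C W \<and> slots (t + 2) I = urn_insert m ?g x (J 3)))"
      apply (rule run_le, rule run_If[where T = 10])
      subgoal
        apply (rule run_le, rule run_IStore)
        subgoal using B by simp
        subgoal by (rule rest) (use J J0 m in auto)
        subgoal by simp
        done
      subgoal
        apply (rule run_le, rule run_IStore)
        subgoal using B by simp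
        subgoal by (rule rest) (use J J0 J0(3)[of "x - m"] m in auto)
        subgoal by simp
        done
      subgoal by simp
      done
  qed simp
  let ?u = "Seq (Uniform (IAdd (reg 1) (IConst 1))) ?fin"
  have pick: "run_dist P B ?u (42 * Suc t + 24 + 70) J C W (\<lambda>I C W. slots (t + 2) I)
      (map_pmf (urn_insert m ?g x) (uniform_index (Suc t))) ?Q"
    if J: "agree {2, 3, 4, 7} I J" "J 7 = x" "x < m + t" for J C x
  proof -
    have J1: "J' 1 = t" if "agree {2, 3, 4} J J'" for J'
      using agreeD[OF J(1), of 1] agreeD[OF that, of 1] t by simp
    have "run_dist P B ?u ((Suc t * (4 + 38) + 4 + 20) + 70) J C W (\<lambda>I C W. slots (t + 2) I)
      (bind_pmf (uniform_index (Suc t)) (\<lambda>i. return_pmf (urn_insert m ?g x i))) ?Q"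
    proof (rule run_dist_seq)
      show "run_dist P B (Uniform (IAdd (reg 1) (IConst 1))) (Suc t * (4 + 38) + 4 + 20) J C W
        (\<lambda>I C W. I 3) (uniform_index (Suc t)) (\<lambda>J' D V. agree {2, 3, 4} J J' \<and> V = W)"
        using run_dist_Uniform[where b = "IAdd (reg 1) (IConst 1)" and N = "Suc t" and P = P and B = B
            and I = J and C = C and W = W] J1 B by simp
      fix J' D V assume J': "agree {2, 3, 4} J J' \<and> V = W" "J' 3 \<in> set_pmf (uniform_index (Suc t))"
      have "J' 3 < Suc t" using J'(2) by (simp add: set_pmf_iff pmf_uniform_index split: if_splits)
      moreover have "agree {2, 3, 4, 7} I J'" "J' 7 = x"
        using J J' agreeD[of "{2, 3, 4}" J J' 7]
        by (auto intro: agree_trans[OF J(1)] agree_mono[of "{2, 3, 4}" J J'])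
      ultimately show "run_dist P B ?fin 70 J' D V (\<lambda>I C W. slots (t + 2) I)
         (return_pmf (urn_insert m ?g x (J' 3))) ?Q"
        using fin[of J' x D] J(3) J'(1) by simp
    qed
    then show ?thesis by (simp add: map_pmf_def algebra_simps)
  qed
  let ?v = "Seq (IStore (IConst 7) (reg 3)) ?u"
  have store: "run_dist P B ?v (4 + (42 * Suc t + 24 + 70)) J C W (\<lambda>I C W. slots (t + 2) I)
      (map_pmf (urn_insert m ?g (J 3)) (uniform_index (Suc t))) ?Q"
    if J: "agree {2, 3, 4} I J" "J 3 < m + t" for J C
  proof -
    have "run_dist P B ?u (42 * Suc t + 24 + 70) (J(7 := J 3)) C W (\<lambda>I C W. slots (t + 2) I)
      (map_pmf (urn_insert m ?g (J 3)) (uniform_index (Suc t))) ?Q"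
      by (rule pick) (use J agree_mono[OF J(1)] in auto)
    then show ?thesis
      by - (rule run_dist_det_seq, rule run_le, rule run_IStore, use B in simp_all)
  qed
  have "run_dist P B UrnStep (((m + t) * (4 + 38) + 4 + 20) + (4 + (42 * Suc t + 24 + 70))) I C W
      (\<lambda>I C W. slots (t + 2) I) (urn_step m ?g) ?Q"
    unfolding UrnStep_def urn_step_def length_slots
  proof (rule run_dist_seq)
    show "run_dist P B (Uniform (IAdd Modes (reg 1))) ((m + t) * (4 + 38) + 4 + 20) I C W
      (\<lambda>I C W. I 3) (uniform_index (m + t)) (\<lambda>J' D V. agree {2, 3, 4} I J' \<and> V = W)"
      using run_dist_Uniform[where b = "IAdd Modes (reg 1)" and N = "m + t" and P = P and B = B
          and I = I and C = C and W = W] B m t by (simp add: agree_def)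
    fix J D V assume J: "agree {2, 3, 4} I J \<and> V = W" "J 3 \<in> set_pmf (uniform_index (m + t))"
    have "J 3 < m + t" using J(2) m by (simp add: set_pmf_iff pmf_uniform_index split: if_splits)
    then show "run_dist P B ?v (4 + (42 * Suc t + 24 + 70)) J D V (\<lambda>I C W. slots (t + 2) I)
      (map_pmf (urn_insert m ?g (J 3)) (uniform_index (Suc t))) ?Q"
      using store[of J D] J by simp
  qed
  then show ?thesis by (rule run_dist_le) (use t m in simp)
qed

definition Urn :: com where
  "Urn = Seq (IStore (IConst 1) (IConst 0)) (While (ILess (reg 1) (reg 0)) UrnStep)"

lemma run_dist_Urn:
  assumes n: "I 0 = n" "n = 2 * h" and B: "20 + n < B" and m: "dim_row (network P) = m" "0 < m"
  shows "run_dist P B Urn (h * (100 * (m + n + 1) + 10) + 20) I C W (\<lambda>I C W. slots n I)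
    (kernel_chain (\<lambda>_. urn_step m) h 0 []) (\<lambda>J D V. J 0 = n \<and> V = W)"
proof -
  let ?b = "ILess (reg 1) (reg 0)"
  have "run_dist P B (While ?b UrnStep) (h * (100 * (m + n + 1) + Suc (bcost ?b)) + Suc (bcost ?b))
     (I(1 := 0)) C W (\<lambda>I C W. slots (2 * h) I)
     (kernel_chain (\<lambda>_. urn_step m) h 0 (slots (2 * 0) (I(1 := 0))))
     (\<lambda>J D V. J 0 = n \<and> J 1 = 2 * h \<and> V = W)"
  proof (rule run_dist_While[where f = "\<lambda>j I C W. slots (2 * j) I" and K = "\<lambda>_. urn_step m"
          and Inv = "\<lambda>j J D V. J 0 = n \<and> J 1 = 2 * j \<and> V = W"])
    show "run_dist P B UrnStep (100 * (m + n + 1)) J D V (\<lambda>I C W. slots (2 * Suc j) I)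
        (urn_step m (slots (2 * j) J)) (\<lambda>J D V. J 0 = n \<and> J 1 = 2 * Suc j \<and> V = W)"
      if "j < h" "J 0 = n \<and> J 1 = 2 * j \<and> V = W" for j J D V
      using run_dist_UrnStep[of J "2 * j" n B P m D V] that n B m by simp
  qed (use n in auto)
  then have "run_dist P B Urn (3 + (h * (100 * (m + n + 1) + Suc (bcost ?b)) + Suc (bcost ?b)))
     I C W (\<lambda>I C W. slots n I) (kernel_chain (\<lambda>_. urn_step m) h 0 []) (\<lambda>J D V. J 0 = n \<and> J 1 = 2 * h \<and> V = W)"
    unfolding Urn_def using n B
    by (intro run_dist_det_seq run_le[OF run_IStore]) (auto simp: slots_def)
  then show ?thesis by (rule run_dist_weaken) (simp_all add: algebra_simps)
qed

text \<open>The value of \<open>slot\<close> for the slot in index cell 5 and the mode in cell 6 at stage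
  (cell 1). With truncated subtraction, \<open>1 - (1 - (k - i))\<close> is the truth value of \<open>i < k\<close>.\<close>

definition slot_exp :: cexp where
  "slot_exp = CAdd
     (CMul (OfIndex (ISub (IConst 1) (ISub (IConst 1) (ISub (reg 1) (reg 5)))))
        (Network (ILoad (slot_addr (reg 5))) (reg 6)))
     (CMul (OfIndex (ISub (IConst 1) (ISub (reg 1) (reg 5))))
        (OfIndex (ISub (IConst 1) (IAdd (ISub (ILoad (slot_addr (reg 5))) (reg 6))
           (ISub (reg 6) (ILoad (slot_addr (reg 5))))))))"

lemma of_bool_eq_monus:
  "Suc 0 - (a - b + (b - a)) = of_bool (a = b)" "Suc 0 - (a - b) = of_bool (a \<le> b)"
  for a b :: nat
  by (auto simp: not_le)

lemma cval_slot_exp: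
  assumes "network P \<in> carrier_mat m m" "J 5 = i" "J 6 < m" "J (20 + i) < m" "i < n"
  shows "cval P slot_exp (mem_state J D W) = slot (network P) (J 1) (slots n J) i (J 6)"
  using assms by (auto simp: slot_exp_def slot_def of_bool_eq_monus not_le)

definition Accumulate :: "cexp \<Rightarrow> com" where
  "Accumulate coef = Seq (CStore (IConst 2) (OfIndex (IConst 0)))
     (For 5 (reg 0) (CStore (IConst 2) (CAdd (creg 2) (CMul coef slot_exp))))"

lemma run_Accumulate:
  assumes U: "network P \<in> carrier_mat m m" and n: "I 0 = n" and g: "\<And>i. i < n \<Longrightarrow> I (20 + i) < m"
    and l: "I 6 < m" and B: "20 < B"
    and coef: "\<And>i J D. i < n \<Longrightarrow> agree {5} I J \<Longrightarrow> J 5 = i \<Longrightarrow> agree {2} C D \<Longrightarrow>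
      cval P coef (mem_state J D W) = c i"
  shows "run P B (Accumulate coef) (n * (ccost coef + 70) + 30) I C W
    (\<lambda>J D V. agree {5} I J \<and> agree {2} C D \<and> V = W
       \<and> D 2 = (\<Sum>i<n. c i * slot (network P) (I 1) (slots n I) i (I 6)))"
proof -
  let ?s = "\<lambda>i. slot (network P) (I 1) (slots n I) i (I 6)"
  let ?body = "CStore (IConst 2) (CAdd (creg 2) (CMul coef slot_exp))"
  have loop: "run P B (For 5 (reg 0) ?body) (n * ((1 + ccost (CAdd (creg 2) (CMul coef slot_exp)) + 1) + icost (reg 0) + 10) + icost (reg 0) + 10)
      I (C(2 := 0)) W (\<lambda>J D V. agree {5} I J \<and> agree {2} C D \<and> V = W \<and> D 2 = (\<Sum>i<n. c i * ?s i))"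
  proof (rule run_For[where Inv = "\<lambda>i J D V. agree {5} I J \<and> agree {2} C D \<and> V = W \<and> D 2 = (\<Sum>j<i. c j * ?s j)"])
    fix i J D V
    assume i: "i < n" "agree {5} I J \<and> agree {2} C D \<and> V = W \<and> D 2 = (\<Sum>j<i. c j * ?s j)" "J 5 = i"
    have J: "J 1 = I 1" "J 6 = I 6" "\<And>j. J (20 + j) = I (20 + j)" using i(2) by (auto simp: agree_def)
    have "cval P slot_exp (mem_state J D V) = ?s i"
      using cval_slot_exp[of P m J i n D V] U i(1,3) J l g[OF i(1)] slots_cong[of n J I] by simp
    moreover have "cval P coef (mem_state J D V) = c i" using coef i by blast
    ultimately show "run P B ?body (1 + ccost (CAdd (creg 2) (CMul coef slot_exp)) + 1) J D V
      (\<lambda>J D V. J 5 = i \<and> agree {5} I (J(5 := Suc i)) \<and> agree {2} C D \<and> V = W \<and> D 2 = (\<Sum>j<Suc i. c j * ?s j))"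
      using i B by (intro run_le[OF run_CStore]) (auto simp: agree_def)
  qed (use n B in \<open>auto simp: agree_def\<close>)
  have "run P B (Accumulate coef) (4 + (n * ((1 + ccost (CAdd (creg 2) (CMul coef slot_exp)) + 1) + icost (reg 0) + 10) + icost (reg 0) + 10))
      I C W (\<lambda>J D V. agree {5} I J \<and> agree {2} C D \<and> V = W \<and> D 2 = (\<Sum>i<n. c i * ?s i))"
    unfolding Accumulate_def by (rule run_seq, rule run_le, rule run_CStore) (use loop B in auto)
  then show ?thesis by (rule run_le) (simp add: slot_exp_def algebra_simps)
qed

definition QuadraticForm :: com where
  "QuadraticForm = Seq (CStore (IConst 3) (OfIndex (IConst 0)))
     (For 6 Modes (Seq (Accumulate (OfIndex (ILoad (bit_addr (reg 5)))))
        (CStore (IConst 3) (CAdd (creg 3) (CMul (creg 2) (creg 2))))))"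

lemma run_QuadraticForm:
  assumes U: "network P \<in> carrier_mat m m" and n: "I 0 = n" and g: "\<And>i. i < n \<Longrightarrow> I (20 + i) < m"
    and B: "20 < B"
  shows "run P B QuadraticForm (m * (n * 80 + 80) + 30) I C W
    (\<lambda>J D V. agree {5, 6} I J \<and> agree {2, 3} C D \<and> V = W
       \<and> D 3 = (\<Sum>l<m. (\<Sum>i<n. of_nat (I (20 + n + i)) * slot (network P) (I 1) (slots n I) i l)\<^sup>2))"
proof -
  let ?s = "\<lambda>l. \<Sum>i<n. of_nat (I (20 + n + i)) * slot (network P) (I 1) (slots n I) i l"
  let ?Inv = "\<lambda>l J D V. agree {5, 6} I J \<and> agree {2, 3} C D \<and> V = W \<and> D 3 = (\<Sum>j<l. (?s j)\<^sup>2)"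
  let ?acc = "Accumulate (OfIndex (ILoad (bit_addr (reg 5))))"
  let ?add = "CStore (IConst 3) (CAdd (creg 3) (CMul (creg 2) (creg 2)))"
  have dim: "dim_row (network P) = m" using U by simp
  have loop: "run P B (For 6 Modes (Seq ?acc ?add)) (m * ((n * (9 + 70) + 30 + 15) + icost Modes + 10) + icost Modes + 10)
      I (C(3 := 0)) W (?Inv m)"
  proof (rule run_For[where Inv = ?Inv])
    fix l J D V
    assume l: "l < m" "?Inv l J D V" "J 6 = l"
    have J: "J 0 = n" "J 1 = I 1" "\<And>j. J (20 + j) = I (20 + j)" "\<And>j. J (20 + n + j) = I (20 + n + j)"
      using l(2) n by (auto simp: agree_def)
    show "run P B (Seq ?acc ?add) (n * (9 + 70) + 30 + 15) J D V
      (\<lambda>J D V. J 6 = l \<and> ?Inv (Suc l) (J(6 := Suc l)) D V)"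
    proof (rule run_seq, rule run_weaken)
      show "run P B ?acc (n * (9 + 70) + 30) J D V (\<lambda>J' D' V'. agree {5} J J' \<and> agree {2} D D' \<and> V' = V
         \<and> D' 2 = (\<Sum>i<n. of_nat (I (20 + n + i)) * slot (network P) (J 1) (slots n J) i (J 6)))"
      proof (rule run_le, rule run_Accumulate[where m = m and n = n])
        fix i J' D'
        assume "agree {5} J J'" "J' 5 = i"
        then show "cval P (OfIndex (ILoad (bit_addr (reg 5)))) (mem_state J' D' V) = of_nat (I (20 + n + i))"
          using J by (simp add: agree_def)
      qed (use U J g l B in auto)
      fix J' D' V'
      assume a: "agree {5} J J' \<and> agree {2} D D' \<and> V' = V
         \<and> D' 2 = (\<Sum>i<n. of_nat (I (20 + n + i)) * slot (network P) (J 1) (slots n J) i (J 6))"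
      have "slots n J = slots n I" using J(3) by (intro slots_cong)
      then have "D' 2 = ?s l" using a J l(3) by simp
      moreover have "D' 3 = D 3" using a by (auto simp: agree_def)
      moreover have "agree {5, 6} I J'" using a l(2) by (auto simp: agree_def)
      moreover have "agree {2, 3} C D'" using a l(2) by (auto simp: agree_def)
      moreover have "J' 6 = l" using a l(3) by (simp add: agree_def)
      ultimately show "run P B ?add 15 J' D' V' (\<lambda>J D V. J 6 = l \<and> ?Inv (Suc l) (J(6 := Suc l)) D V)"
        using a l(2) B by (intro run_le[OF run_CStore]) (auto simp: power2_eq_square)
    qed simp
  qed (use dim B in auto)
  have "run P B QuadraticForm (4 + (m * ((n * (9 + 70) + 30 + 15) + icost Modes + 10) + icost Modes + 10)) I C W (?Inv m)"
    unfolding QuadraticForm_def by (rule run_seq, rule run_le, rule run_CStore) (use loop B in auto)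
  then show ?thesis by (rule run_weaken) (simp_all add: algebra_simps)
qed

definition SignedPower :: com where
  "SignedPower = Seq (CStore (IConst 4) (OfIndex (IConst 1)))
    (Seq (For 5 (reg 0) (CStore (IConst 4) (CMul (creg 4)
       (CSub (OfIndex (IConst 1)) (OfIndex (IAdd (ILoad (bit_addr (reg 5))) (ILoad (bit_addr (reg 5)))))))))
    (Seq (IStore (IConst 10) (IConst 2))
      (While (ILess (reg 10) (reg 0)) (Seq (CStore (IConst 4) (CMul (creg 4) (creg 3)))
         (IStore (IConst 10) (IAdd (reg 10) (IConst 2)))))))"

lemma run_While:
  assumes cond: "\<And>i I C W. i \<le> N \<Longrightarrow> Inv i I C W \<Longrightarrow> bval P b (mem_state I C W) \<longleftrightarrow> i < N"
    and body: "\<And>i I C W. i < N \<Longrightarrow> Inv i I C W \<Longrightarrow> run P B p T I C W (Inv (Suc i))"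
    and init: "Inv 0 I C W"
  shows "run P B (While b p) (N * (T + Suc (bcost b)) + Suc (bcost b)) I C W (Inv N)"
proof -
  have "run_dist P B (While b p) (N * (T + Suc (bcost b)) + Suc (bcost b)) I C W (\<lambda>_ _ _. ())
    (kernel_chain (\<lambda>_ _. return_pmf ()) N 0 ()) (Inv N)"
    by (rule run_dist_While[where f = "\<lambda>_ _ _ _. ()" and Inv = Inv and K = "\<lambda>_ _. return_pmf ()", OF cond body[unfolded run_def] init])
  then show ?thesis by (rule run_weaken[OF run_of_run_dist]) auto
qed

lemma run_SignedPower:
  assumes n: "I 0 = n" "n = 2 * Suc p" and B: "20 < B"
  shows "run P B SignedPower (n * 100 + 30) I C W
    (\<lambda>J D V. agree {5, 10} I J \<and> agree {4} C D \<and> V = W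
       \<and> D 4 = (\<Prod>i<n. 1 - 2 * of_nat (I (20 + n + i))) * C 3 ^ p)"
proof -
  let ?\<epsilon> = "\<Prod>i<n. 1 - 2 * of_nat (I (20 + n + i)) :: complex"
  let ?sgn = "CStore (IConst 4) (CMul (creg 4)
       (CSub (OfIndex (IConst 1)) (OfIndex (IAdd (ILoad (bit_addr (reg 5))) (ILoad (bit_addr (reg 5)))))))"
  let ?pow = "Seq (CStore (IConst 4) (CMul (creg 4) (creg 3)))
         (IStore (IConst 10) (IAdd (reg 10) (IConst 2)))"
  let ?b = "ILess (reg 10) (reg 0)"
  let ?TW = "p * ((7 + 6) + Suc (bcost ?b)) + Suc (bcost ?b)"
  let ?Q = "\<lambda>J D V. agree {5, 10} I J \<and> agree {4} C D \<and> V = W \<and> D 4 = ?\<epsilon> * C 3 ^ p"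
  have pow: "run P B (While ?b ?pow) (?TW) J D W ?Q"
    if a: "agree {5, 10} I J" "agree {4} C D" "D 4 = ?\<epsilon>" "J 10 = 2" for J D
  proof -
    let ?Inv = "\<lambda>j J D V. agree {5, 10} I J \<and> agree {4} C D \<and> V = W \<and> D 4 = ?\<epsilon> * C 3 ^ j \<and> J 10 = 2 + 2 * j"
    have "run P B (While ?b ?pow) (?TW) J D W (?Inv p)"
    proof (rule run_While[where Inv = ?Inv])
      show "bval P ?b (mem_state J D V) \<longleftrightarrow> j < p" if "?Inv j J D V" for j J D V
        using that n by (auto simp: agree_def)
      fix j J D V assume i: "?Inv j J D V"
      have D3: "D 3 = C 3" using i by (auto simp: agree_def)
      show "run P B ?pow (7 + 6) J D V (?Inv (Suc j))"
        apply (rule run_seq, rule run_le, rule run_CStore)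
        subgoal using B by simp
        subgoal
          apply (rule run_le, rule run_IStore)
          using B i D3 by (simp_all add: mult_ac)
        subgoal by simp
        done
    qed (use a in auto)
    then show ?thesis by (rule run_weaken) auto
  qed
  have sgn: "run P B (For 5 (reg 0) ?sgn) (n * (30 + icost (reg 0) + 10) + icost (reg 0) + 10) I (C(4 := 1)) W
      (\<lambda>J D V. agree {5} I J \<and> agree {4} C D \<and> V = W \<and> D 4 = ?\<epsilon>)"
  proof (rule run_For[where Inv = "\<lambda>i J D V. agree {5} I J \<and> agree {4} C D \<and> V = W
      \<and> D 4 = (\<Prod>j<i. 1 - 2 * of_nat (I (20 + n + j)))"])
    fix i J D V
    assume i: "agree {5} I J \<and> agree {4} C D \<and> V = W
      \<and> D 4 = (\<Prod>j<i. 1 - 2 * of_nat (I (20 + n + j)))" "J 5 = i"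
    then have J: "J 0 = n" "J (20 + n + i) = I (20 + n + i)" using n by (auto simp: agree_def)
    show "run P B ?sgn 30 J D V (\<lambda>J D V. J 5 = i \<and> agree {5} I (J(5 := Suc i)) \<and> agree {4} C D \<and> V = W
      \<and> D 4 = (\<Prod>j<Suc i. 1 - 2 * of_nat (I (20 + n + j))))"
      apply (rule run_le, rule run_CStore)
      using B apply simp
      using i J apply (simp add: mult_2[symmetric])
      apply simp
      done
  qed (use n B in \<open>auto simp: agree_def\<close>)
  let ?T = "(n * (30 + icost (reg 0) + 10) + icost (reg 0) + 10)
      + (3 + (?TW))"
  have "run P B (Seq (For 5 (reg 0) ?sgn) (Seq (IStore (IConst 10) (IConst 2)) (While ?b ?pow))) ?T
      I (C(4 := 1)) W ?Q"
  proof (rule run_seq, rule run_weaken[OF sgn order.refl], rule run_seq, rule run_le, rule run_IStore)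
    fix J D V assume a: "agree {5} I J \<and> agree {4} C D \<and> V = W \<and> D 4 = ?\<epsilon>"
    have "run P B (While ?b ?pow) (?TW) (J(10 := 2)) D W ?Q"
      by (rule pow) (use a in \<open>auto simp: agree_def\<close>)
    then show "run P B (While ?b ?pow) (?TW)
        (J(ival P (IConst 10) (mem_state J D V) := ival P (IConst 2) (mem_state J D V))) D V ?Q"
      using a by simp
  qed (use B in simp_all)
  then have "run P B SignedPower (4 + ?T) I C W ?Q"
    unfolding SignedPower_def by - (rule run_seq, rule run_le, rule run_CStore, use B in simp_all)
  then show ?thesis by (rule run_le) (use n in simp)
qed

definition AddPartners :: com where
  "AddPartners = For 5 (reg 0) (CStore (slot_addr (reg 5)) (CAdd (CLoad (slot_addr (reg 5)))
     (CMul (creg 4) (CMul (OfIndex (ISub (IConst 1) (ILoad (bit_addr (reg 1)))))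
        (OfIndex (ISub (IConst 1) (ILoad (bit_addr (reg 5)))))))))"

lemma run_AddPartners:
  assumes n: "I 0 = n" and B: "20 + n < B"
  shows "run P B AddPartners (n * 60 + 20) I C W
    (\<lambda>J D V. agree {5} I J \<and> agree {20..<20 + n} C D \<and> V = W
       \<and> (\<forall>x<n. D (20 + x) = C (20 + x) + C 4 * (of_nat (1 - I (20 + n + I 1)) * of_nat (1 - I (20 + n + x)))))"
proof -
  let ?v = "\<lambda>x. C (20 + x) + C 4 * (of_nat (1 - I (20 + n + I 1)) * of_nat (1 - I (20 + n + x)))"
  let ?Inv = "\<lambda>i J D V. agree {5} I J \<and> agree {20..<20 + n} C D \<and> V = W
     \<and> (\<forall>x<n. D (20 + x) = (if x < i then ?v x else C (20 + x)))"
  show ?thesis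
    unfolding AddPartners_def
  proof (rule run_le, rule run_For[where Inv = ?Inv and N = n and T = 40])
    fix i J D V
    assume i: "i < n" "?Inv i J D V" "J 5 = i"
    then have a: "agree {5} I J" "agree {20..<20 + n} C D" "V = W" by simp_all
    have D: "D (20 + x) = (if x < i then ?v x else C (20 + x))" if "x < n" for x
      using i(2) that by simp
    have J: "J 0 = n" "J 1 = I 1" "\<And>j. J (20 + n + j) = I (20 + n + j)" "D 4 = C 4" "D (20 + i) = C (20 + i)"
      using n agreeD[OF a(1)] agreeD[OF a(2), of 4] D[OF i(1)] by simp_all
    show "run P B (CStore (slot_addr (reg 5)) (CAdd (CLoad (slot_addr (reg 5)))
     (CMul (creg 4) (CMul (OfIndex (ISub (IConst 1) (ILoad (bit_addr (reg 1)))))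
        (OfIndex (ISub (IConst 1) (ILoad (bit_addr (reg 5))))))))) 40 J D V
        (\<lambda>J D V. J 5 = i \<and> ?Inv (Suc i) (J(5 := Suc i)) D V)"
      apply (rule run_le, rule run_CStore)
      using i(1,3) B J(1) apply simp
      using i(1,3) a J D apply (simp add: less_Suc_eq)
      apply simp
      done
  next
    show "?Inv 0 (I(5 := 0)) C W" by simp
    show "ival P (reg 0) (mem_state J D V) = n" if "?Inv i J D V" for i J D V
      using that n agreeD[of "{5}" I J 0] by simp
    show "agree {5} I J \<and> agree {20..<20 + n} C D \<and> V = W \<and> (\<forall>x<n. D (20 + x) = ?v x)"
      if "?Inv n J D V" for J D V using that by simp
  qed (use B in simp_all)
qed

definition IncrementBits :: com where
  "IncrementBits = Seq (IStore (IConst 8) (IConst 1)) (For 5 (IAdd (reg 0) (IConst 1))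
     (Seq (IStore (IConst 9) (ISub (IAdd (ILoad (bit_addr (reg 5))) (reg 8)) (IConst 1)))
     (Seq (IStore (bit_addr (reg 5)) (ISub (IAdd (ILoad (bit_addr (reg 5))) (reg 8)) (IAdd (reg 9) (reg 9))))
        (IStore (IConst 8) (reg 9)))))"

lemma binary_carry:
  fixes t i :: nat
  defines "b \<equiv> t div 2 ^ i mod 2" and "c \<equiv> of_bool (2 ^ i dvd Suc t)"
  shows "b + c - 1 = of_bool (2 ^ Suc i dvd Suc t)"
    and "b + c - ((b + c - 1) + (b + c - 1)) = Suc t div 2 ^ i mod 2"
proof -
  have both: "b + c - 1 = of_bool (2 ^ Suc i dvd Suc t)
    \<and> b + c - ((b + c - 1) + (b + c - 1)) = Suc t div 2 ^ i mod 2"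
  proof (cases "2 ^ i dvd Suc t")
    case True
    then obtain q where q: "Suc t = 2 ^ i * q" ..
    then obtain q' where q': "q = Suc q'" by (cases q) auto
    have "Suc t div 2 ^ i = Suc (t div 2 ^ i)"
      using True by (simp add: div_Suc mod_eq_0_iff_dvd)
    then have "t div 2 ^ i = q'" using q q' by simp
    moreover have "2 ^ Suc i dvd Suc t \<longleftrightarrow> even q" unfolding q by simp
    moreover have "Suc t div 2 ^ i = q" unfolding q by simp
    ultimately show ?thesis using True q'
      by (cases "even q'") (auto simp: b_def c_def mod_2_eq_odd)
  next
    case False
    then have "\<not> 2 ^ Suc i dvd Suc t" by (meson dvd_trans le_imp_power_dvd le_SucI order.refl)
    moreover have "Suc t div 2 ^ i = t div 2 ^ i"
      using False by (simp add: div_Suc mod_eq_0_iff_dvd)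
    ultimately show ?thesis using False by (simp add: b_def c_def mod_2_eq_odd)
  qed
  then show "b + c - 1 = of_bool (2 ^ Suc i dvd Suc t)"
    "b + c - ((b + c - 1) + (b + c - 1)) = Suc t div 2 ^ i mod 2" by blast+
qed

lemma run_IncrementBits:
  assumes n: "I 0 = n" and bits: "\<And>j. j \<le> n \<Longrightarrow> I (20 + n + j) = t div 2 ^ j mod 2" and B: "20 + n + n < B"
  shows "run P B IncrementBits (n * 80 + 100) I C W
    (\<lambda>J D V. agree ({5, 8, 9} \<union> {20 + n..20 + n + n}) I J \<and> D = C \<and> V = W
       \<and> (\<forall>j\<le>n. J (20 + n + j) = Suc t div 2 ^ j mod 2))"
proof -
  let ?X = "{5, 8, 9} \<union> {20 + n..20 + n + n}"
  let ?Inv = "\<lambda>i J D V. agree ?X I J \<and> D = C \<and> V = W \<and> J 8 = of_bool (2 ^ i dvd Suc t)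
     \<and> (\<forall>j\<le>n. J (20 + n + j) = (if j < i then Suc t else t) div 2 ^ j mod 2)"
  let ?body = "Seq (IStore (IConst 9) (ISub (IAdd (ILoad (bit_addr (reg 5))) (reg 8)) (IConst 1)))
     (Seq (IStore (bit_addr (reg 5)) (ISub (IAdd (ILoad (bit_addr (reg 5))) (reg 8)) (IAdd (reg 9) (reg 9))))
        (IStore (IConst 8) (reg 9)))"
  have loop: "run P B (For 5 (IAdd (reg 0) (IConst 1)) ?body)
      (Suc n * ((15 + (25 + 10)) + icost (IAdd (reg 0) (IConst 1)) + 10) + icost (IAdd (reg 0) (IConst 1)) + 10)
      (I(8 := 1)) C W (\<lambda>J D V. agree ?X I J \<and> D = C \<and> V = W
       \<and> (\<forall>j\<le>n. J (20 + n + j) = Suc t div 2 ^ j mod 2))"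
  proof (rule run_For[where Inv = ?Inv])
    fix i J D V assume i: "i < Suc n" and inv: "?Inv i J D V" and J5: "J 5 = i"
    define b c where "b = t div 2 ^ i mod 2" and "c = (of_bool (2 ^ i dvd Suc t) :: nat)"
    have J: "J 0 = n" "J 8 = c" "J (20 + n + i) = b" "D = C" "V = W" "agree ?X I J"
      using inv n i agreeD[of ?X I J 0] by (auto simp: b_def c_def)
    have bits': "J (20 + n + j) = (if j < i then Suc t else t) div 2 ^ j mod 2" if "j \<le> n" for j
      using inv that by blast
    note carry = binary_carry[of t i, folded b_def c_def]
    define v w where "v = b + c - 1" and "w = b + c - (v + v)"
    have vw: "b + c - Suc 0 = v" "b + c - (v + v) = w" by (simp_all add: v_def w_def)
    have vw_eq: "v = of_bool (2 ^ Suc i dvd Suc t)" "w = Suc t div 2 ^ i mod 2"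
      using carry unfolding v_def w_def by blast+
    let ?K = "J(9 := v, 20 + n + i := w, 8 := v)"
    define post where "post = (\<lambda>J D V. J 5 = i \<and> ?Inv (Suc i) (J(5 := Suc i)) D V)"
    have K: "post ?K C W"
      unfolding post_def using J5 J i bits' vw_eq by (auto simp: less_Suc_eq)
    show "run P B ?body (15 + (25 + 10)) J D V (\<lambda>J D V. J 5 = i \<and> ?Inv (Suc i) (J(5 := Suc i)) D V)"
      unfolding post_def[symmetric]
      apply (rule run_seq, rule run_le, rule run_IStore)
      subgoal using B by simp
      subgoal
        apply (rule run_seq, rule run_le, rule run_IStore)
        subgoal using B i J5 J by simp
        subgoal
          apply (rule run_le, rule run_IStore)
          subgoal using B by simp
          subgoal using K J(1-5) J5 by (simp add: vw)
          subgoal by simp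
          done
        subgoal by simp
        done
      subgoal by simp
      done
  next
    show "?Inv 0 ((I(8 := 1))(5 := 0)) C W" using bits by simp
    show "ival P (IAdd (reg 0) (IConst 1)) (mem_state J D V) = Suc n" if "?Inv i J D V" for i J D V
      using that n agreeD[of ?X I J 0] by simp
    show "agree ?X I J \<and> D = C \<and> V = W \<and> (\<forall>j\<le>n. J (20 + n + j) = Suc t div 2 ^ j mod 2)"
      if "?Inv (Suc n) J D V" for J D V using that by (simp add: less_Suc_eq_le)
  qed (use B in simp)
  have "run P B IncrementBits (3 + (Suc n * ((15 + (25 + 10)) + icost (IAdd (reg 0) (IConst 1)) + 10) + icost (IAdd (reg 0) (IConst 1)) + 10))
     I C W (\<lambda>J D V. agree ?X I J \<and> D = C \<and> V = W
       \<and> (\<forall>j\<le>n. J (20 + n + j) = Suc t div 2 ^ j mod 2))"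
    unfolding IncrementBits_def by (rule run_seq, rule run_le, rule run_IStore) (use loop B in simp_all)
  then show ?thesis by (rule run_le) simp
qed

lemma sum_Pow_bits:
  "(\<Sum>S\<in>Pow {..<n}. F S) = (\<Sum>t<2 ^ n :: nat. F {i. i < n \<and> odd (t div 2 ^ i)})"
proof -
  have less: "i < n" if "odd (t div 2 ^ i)" "t < 2 ^ n" for i t :: nat
  proof (rule ccontr)
    assume "\<not> i < n"
    then have "(2::nat) ^ n \<le> 2 ^ i" by (intro power_increasing) auto
    then have "t div 2 ^ i = 0" using that(2) by (intro div_less) linarith
    then show False using that(1) by simp
  qed
  then have sub: "set_decode t \<subseteq> {..<n}" if "t < 2 ^ n" for t
    using that by (auto simp: set_decode_def)
  have dec: "{i. i < n \<and> odd (t div 2 ^ i)} = set_decode t" if "t < 2 ^ n" for t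
    using that less by (auto simp: set_decode_def)
  have enc: "set_encode S < 2 ^ n" if "S \<subseteq> {..<n}" for S
  proof -
    have "set_encode S \<le> set_encode {..<n}"
      unfolding set_encode_def using that by (intro sum_mono2) auto
    also have "set_encode {..<n} < 2 ^ n"
      unfolding set_encode_def by (induction n) auto
    finally show ?thesis .
  qed
  have "(\<Sum>S\<in>Pow {..<n}. F S) = (\<Sum>t<2 ^ n. F (set_decode t))"
    by (rule sum.reindex_bij_witness[of _ set_decode set_encode])
      (use enc sub in \<open>auto simp: finite_subset set_encode_inverse\<close>)
  also have "\<dots> = (\<Sum>t<2 ^ n :: nat. F {i. i < n \<and> odd (t div 2 ^ i)})"
    by (intro sum.cong refl) (simp add: dec)
  finally show ?thesis .
qed

definition subset_term :: "complex mat \<Rightarrow> nat \<Rightarrow> nat list \<Rightarrow> nat \<Rightarrow> nat \<Rightarrow> nat \<Rightarrow> complex" where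
  "subset_term U k g p t x = (\<Prod>i<length g. 1 - 2 * of_nat (t div 2 ^ i mod 2))
     * (\<Sum>l<dim_row U. (\<Sum>i<length g. of_nat (t div 2 ^ i mod 2) * slot U k g i l)\<^sup>2) ^ p
     * (of_nat (1 - t div 2 ^ k mod 2) * of_nat (1 - t div 2 ^ x mod 2))"

lemma sum_subset_term:
  assumes n: "length g = 2 * Suc p" and k: "k < length g" "x < length g" "x \<noteq> k"
  shows "(\<Sum>t<2 ^ length g. subset_term U k g p t x) = 2 ^ p * fact p * partner_amp U k g x"
proof -
  let ?n = "length g"
  define F where "F S = of_bool (k \<notin> S \<and> x \<notin> S)
    * ((-1) ^ card S * (\<Sum>l<dim_row U. (\<Sum>i\<in>S. slot U k g i l)\<^sup>2) ^ p)" for S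
  have term_eq: "subset_term U k g p t x = F {i. i < ?n \<and> odd (t div 2 ^ i)}" for t
  proof -
    define S where "S = {i. i < ?n \<and> odd (t div 2 ^ i)}"
    have S: "S \<subseteq> {..<?n}" by (auto simp: S_def)
    have bit: "t div 2 ^ i mod 2 = of_bool (i \<in> S)" if "i < ?n" for i
      using that by (simp add: S_def mod_2_eq_odd)
    have "(\<Prod>i<?n. 1 - 2 * of_nat (t div 2 ^ i mod 2) :: complex) = (\<Prod>i\<in>S. - 1)"
      by (rule prod.mono_neutral_cong_right) (use S bit in auto)
    moreover have "(\<Sum>i<?n. of_nat (t div 2 ^ i mod 2) * slot U k g i l) = (\<Sum>i\<in>S. slot U k g i l)" for l
      by (rule sum.mono_neutral_cong_right) (use S bit in auto)
    ultimately show ?thesis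
      using bit k by (auto simp: subset_term_def S_def[symmetric] F_def)
  qed
  have "(\<Sum>t<2 ^ ?n. subset_term U k g p t x) = (\<Sum>S\<in>Pow {..<?n}. F S)"
    by (simp only: sum_Pow_bits term_eq)
  then show ?thesis using partner_amp_inclusion_exclusion[OF n k] by (simp only: F_def)
qed

definition Partners :: com where
  "Partners = Seq (For 5 (reg 0) (Seq (CStore (slot_addr (reg 5)) (OfIndex (IConst 0)))
       (IStore (bit_addr (reg 5)) (IConst 0))))
    (Seq (IStore (bit_addr (reg 0)) (IConst 0))
    (Seq (While (ILess (ILoad (bit_addr (reg 0))) (IConst 1))
       (Seq QuadraticForm (Seq SignedPower (Seq AddPartners IncrementBits))))
     (CStore (slot_addr (reg 1)) (OfIndex (IConst 0)))))"

lemma run_Partners: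
  assumes U: "network P \<in> carrier_mat m m" and n: "I 0 = n" "n = 2 * Suc p" and g: "\<And>i. i < n \<Longrightarrow> I (20 + i) < m"
    and k: "I 1 = k" "k < n" and B: "20 + n + n < B"
  shows "run P B Partners (2 ^ n * (300 * (m * n + m + n + 1)) + 100 * (n + 1)) I C W
    (\<lambda>J D V. agree ({5, 6, 8, 9, 10} \<union> {20 + n..20 + n + n}) I J \<and> V = W
       \<and> (\<forall>x<n. D (20 + x) = (if x = k then 0 else 2 ^ p * fact p * partner_amp (network P) k (slots n I) x)))"
proof -
  let ?X = "{5, 6, 8, 9, 10} \<union> {20 + n..20 + n + n}" and ?U = "network P" and ?g = "slots n I"
  let ?b = "ILess (ILoad (bit_addr (reg 0))) (IConst 1)"
  have dim: "dim_row ?U = m" using U by simp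
  let ?Inv = "\<lambda>t J D V. agree ?X I J \<and> V = W \<and> (\<forall>j\<le>n. J (20 + n + j) = t div 2 ^ j mod 2)
     \<and> (\<forall>x<n. D (20 + x) = (\<Sum>t'<t. subset_term ?U k ?g p t' x))"
  let ?T1 = "m * (n * 80 + 80) + 30" and ?T2 = "n * 100 + 30" and ?T3 = "n * 60 + 20" and ?T4 = "n * 80 + 100"
  let ?A = "?T1 + (?T2 + (?T3 + ?T4))"
  let ?TW = "2 ^ n * (?A + Suc (bcost ?b)) + Suc (bcost ?b)"
  let ?body = "Seq QuadraticForm (Seq SignedPower (Seq AddPartners IncrementBits))"
  have body: "run P B ?body ?A J D V (?Inv (Suc t))" if inv: "?Inv t J D V" for t J D V
  proof -
    have J0: "J 0 = n" "J 1 = k" "\<And>i. i < n \<Longrightarrow> J (20 + i) = I (20 + i)"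
      and Jb: "\<And>j. j \<le> n \<Longrightarrow> J (20 + n + j) = t div 2 ^ j mod 2"
      using inv n k agreeD[of ?X I J] by auto
    have sl: "slots n J = ?g" using J0(3) by (rule slots_cong)
    let ?q = "\<Sum>l<m. (\<Sum>i<n. of_nat (J (20 + n + i)) * slot ?U (J 1) (slots n J) i l)\<^sup>2"
    let ?\<epsilon> = "(\<Prod>i<n. 1 - 2 * of_nat (J (20 + n + i)))"
    have q: "?\<epsilon> * ?q ^ p * (of_nat (1 - J (20 + n + k)) * of_nat (1 - J (20 + n + x)))
        = subset_term ?U k ?g p t x" if "x < n" for x
      using that k J0 by (simp add: subset_term_def Jb sl dim)
    show ?thesis
    proof (rule run_seq, rule run_weaken[OF run_QuadraticForm[OF U, of J n] order.refl])
      fix J1 D1 V1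
      assume 1: "agree {5, 6} J J1 \<and> agree {2, 3} D D1 \<and> V1 = V \<and> D1 3 = ?q"
      have b1: "J1 (20 + n + j) = J (20 + n + j)" for j using 1 agreeD[of "{5, 6}" J J1] by simp
      have J10: "J1 0 = n" using 1 J0 agreeD[of "{5, 6}" J J1] by simp
      show "run P B (Seq SignedPower (Seq AddPartners IncrementBits)) (?T2 + (?T3 + ?T4)) J1 D1 V1 (?Inv (Suc t))"
      proof (rule run_seq, rule run_weaken[OF run_SignedPower[of J1 n p] order.refl])
        fix J2 D2 V2
        assume "agree {5, 10} J1 J2 \<and> agree {4} D1 D2 \<and> V2 = V1
          \<and> D2 4 = (\<Prod>i<n. 1 - 2 * of_nat (J1 (20 + n + i))) * D1 3 ^ p"
        then have 2: "agree {5, 6, 10} J J2" "agree {2, 3, 4} D D2" "V2 = V" "D2 4 = ?\<epsilon> * ?q ^ p"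
          using 1 by (auto simp: b1 agree_def)
        have J2: "J2 (20 + n + j) = J (20 + n + j)" "J2 1 = k" "J2 0 = n" for j
          using agreeD[OF 2(1)] J0 by simp_all
        show "run P B (Seq AddPartners IncrementBits) (?T3 + ?T4) J2 D2 V2 (?Inv (Suc t))"
        proof (rule run_seq, rule run_weaken[OF run_AddPartners[of J2 n] order.refl])
          fix J3 D3 V3
          assume 3: "agree {5} J2 J3 \<and> agree {20..<20 + n} D2 D3 \<and> V3 = V2
           \<and> (\<forall>x<n. D3 (20 + x) = D2 (20 + x)
               + D2 4 * (of_nat (1 - J2 (20 + n + J2 1)) * of_nat (1 - J2 (20 + n + x))))"
          have J3: "J3 0 = n" "J3 (20 + n + j) = J (20 + n + j)" for j
            using 3 agreeD[of "{5}" J2 J3] J2 by simp_all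
          have D3: "D3 (20 + x) = (\<Sum>t'<Suc t. subset_term ?U k ?g p t' x)" if "x < n" for x
          proof -
            have "D3 (20 + x) = D2 (20 + x) + ?\<epsilon> * ?q ^ p
                * (of_nat (1 - J (20 + n + k)) * of_nat (1 - J (20 + n + x)))"
              using 3 that J2 2(4) by simp
            also have "D2 (20 + x) = D (20 + x)" using agreeD[OF 2(2)] by simp
            finally show ?thesis using q[OF that] inv that by simp
          qed
          show "run P B IncrementBits ?T4 J3 D3 V3 (?Inv (Suc t))"
          proof (rule run_weaken[OF run_IncrementBits[of J3 n t] order.refl])
            fix J4 D4 V4
            assume 4: "agree ({5, 8, 9} \<union> {20 + n..20 + n + n}) J3 J4 \<and> D4 = D3 \<and> V4 = V3
              \<and> (\<forall>j\<le>n. J4 (20 + n + j) = Suc t div 2 ^ j mod 2)"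
            have "agree ?X J J4"
              using 4 3 2(1) unfolding agree_def by auto
            then have "agree ?X I J4" using inv by (blast intro: agree_trans)
            then show "?Inv (Suc t) J4 D4 V4" using 4 3 2(3) inv D3 by simp
          qed (use J3 Jb B in auto)
        qed (use J2 B in auto)
      qed (use J10 n B in auto)
    qed (use J0 g B in auto)
  qed
  have main: "run P B (While ?b ?body) ?TW J D V (?Inv (2 ^ n))"
    if "?Inv 0 J D V" for J D V
  proof (rule run_While[where Inv = ?Inv])
    fix t J D V assume t: "t \<le> 2 ^ n" "?Inv t J D V"
    have "J 0 = n" using t n agreeD[of ?X I J 0] by simp
    moreover have "J (20 + n + n) = t div 2 ^ n mod 2" using t by blast
    moreover have "t div 2 ^ n mod 2 = 0 \<longleftrightarrow> t < 2 ^ n" using t(1) by (cases "t = 2 ^ n") auto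
    ultimately show "bval P ?b (mem_state J D V) \<longleftrightarrow> t < 2 ^ n" by simp
  qed (use that body in auto)
  let ?init = "Seq (CStore (slot_addr (reg 5)) (OfIndex (IConst 0))) (IStore (bit_addr (reg 5)) (IConst 0))"
  have init: "run P B (For 5 (reg 0) ?init) (n * ((7 + 13) + icost (reg 0) + 10) + icost (reg 0) + 10) I C W
    (\<lambda>J D V. agree ?X I J \<and> V = W \<and> (\<forall>j<n. J (20 + n + j) = 0) \<and> (\<forall>x<n. D (20 + x) = 0))"
  proof (rule run_For[where Inv = "\<lambda>i J D V. agree ?X I J \<and> V = W \<and> (\<forall>j<i. J (20 + n + j) = 0) \<and> (\<forall>x<i. D (20 + x) = 0)"])
    fix i J V and D :: "nat \<Rightarrow> complex"
    assume i: "i < n" "agree ?X I J \<and> V = W \<and> (\<forall>j<i. J (20 + n + j) = 0) \<and> (\<forall>x<i. D (20 + x) = 0)" "J 5 = i"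
    have J0: "J 0 = n" using i n agreeD[of ?X I J 0] by simp
    show "run P B ?init (7 + 13) J D V (\<lambda>J D V. J 5 = i \<and> agree ?X I (J(5 := Suc i)) \<and> V = W
        \<and> (\<forall>j<Suc i. (J(5 := Suc i)) (20 + n + j) = 0) \<and> (\<forall>x<Suc i. D (20 + x) = 0))"
      apply (rule run_seq, rule run_le, rule run_CStore)
      subgoal using i B by simp
      subgoal
        apply (rule run_le, rule run_IStore)
        subgoal using i B J0 by simp
        subgoal using i J0 by (simp add: less_Suc_eq)
        subgoal by simp
        done
      subgoal by simp
      done
  next
    show "ival P (reg 0) (mem_state J D V) = n"
      if "agree ?X I J \<and> V = W \<and> (\<forall>j<i. J (20 + n + j) = 0) \<and> (\<forall>x<i. D (20 + x) = 0)"
      for i J V and D :: "nat \<Rightarrow> complex"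
      using that n agreeD[of ?X I J 0] by simp
  qed (use B in simp_all)
  have "run P B Partners ((n * ((7 + 13) + icost (reg 0) + 10) + icost (reg 0) + 10) + (10 +
      (?TW + 10))) I C W
    (\<lambda>J D V. agree ?X I J \<and> V = W
       \<and> (\<forall>x<n. D (20 + x) = (if x = k then 0 else 2 ^ p * fact p * partner_amp ?U k ?g x)))"
    unfolding Partners_def
  proof (rule run_seq, rule run_weaken[OF init order.refl])
    fix J V and D :: "nat \<Rightarrow> complex"
    assume a: "agree ?X I J \<and> V = W \<and> (\<forall>j<n. J (20 + n + j) = 0) \<and> (\<forall>x<n. D (20 + x) = 0)"
    have J0: "J 0 = n" using a n agreeD[of ?X I J 0] by simp
    let ?Q = "\<lambda>J D V. agree ?X I J \<and> V = W
       \<and> (\<forall>x<n. D (20 + x) = (if x = k then 0 else 2 ^ p * fact p * partner_amp ?U k ?g x))"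
    let ?last = "CStore (slot_addr (reg 1)) (OfIndex (IConst 0))"
    have last: "run P B ?last 10 J D V ?Q" if "?Inv (2 ^ n) J D V" for J D V
    proof -
      have J1: "J 1 = k" using that k agreeD[of ?X I J 1] by simp
      have "D (20 + x) = 2 ^ p * fact p * partner_amp ?U k ?g x" if "x < n" "x \<noteq> k" for x
        using sum_subset_term[of ?g p k x ?U] that k n \<open>?Inv (2 ^ n) J D V\<close> by simp
      then show ?thesis using J1 that B k
        by - (rule run_le, rule run_CStore, simp_all)
    qed
    have "run P B (Seq (While ?b ?body) ?last) (?TW + 10)
       (J(20 + n + n := 0)) D V ?Q"
    proof (rule run_seq, rule run_weaken[OF main order.refl])
      have "agree ?X I (J(20 + n + n := 0))" using a by (subst agree_upd) auto
      then show "?Inv 0 (J(20 + n + n := 0)) D V" using a by (simp add: le_less)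
    qed (rule last)
    then show "run P B (Seq (IStore (bit_addr (reg 0)) (IConst 0)) (Seq (While ?b ?body) ?last)) (10 +
      (?TW + 10)) J D V ?Q"
      using J0 B by - (rule run_seq, rule run_le, rule run_IStore, simp_all)
  qed
  moreover have "(n * ((7 + 13) + icost (reg 0) + 10) + icost (reg 0) + 10) + (10 +
      (?TW + 10))
      \<le> 2 ^ n * (300 * (m * n + m + n + 1)) + 100 * (n + 1)"
  proof -
    have sum_le: "(n * ((7 + 13) + icost (reg 0) + 10) + icost (reg 0) + 10)
        + (10 + ((x + Suc (bcost ?b)) + 10)) \<le> y + 100 * (n + 1)" if "x \<le> y" for x y
      using that by simp
    have "?A + Suc (bcost ?b) \<le> 300 * (m * n + m + n + 1)"
      by (simp add: algebra_simps)
    then have "2 ^ n * (?A + Suc (bcost ?b)) \<le> 2 ^ n * (300 * (m * n + m + n + 1))"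
      by (rule mult_le_mono2)
    then show ?thesis by (rule sum_le)
  qed
  ultimately show ?thesis by (rule run_le)
qed

definition Weight :: com where
  "Weight = Seq (CStore (IConst 5) (OfIndex (IConst 0)))
    (Seq (For 6 Modes (Seq (Accumulate (CLoad (slot_addr (reg 5))))
        (CStore (IConst 5) (CAdd (creg 5) (CMul (Network (reg 2) (reg 6)) (creg 2))))))
      (CStore (IConst 1) (CMul (creg 5) (CConj (creg 5)))))"

lemma run_Weight:
  assumes U: "network P \<in> carrier_mat m m" and n: "I 0 = n" and g: "\<And>i. i < n \<Longrightarrow> I (20 + i) < m"
    and e: "I 2 < m" and B: "20 < B"
  shows "run P B Weight (m * (n * 80 + 80) + 50) I C W
    (\<lambda>J D V. agree {5, 6} I J \<and> agree {1, 2, 5} C D \<and> V = W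
       \<and> D 1 = of_real ((cmod (\<Sum>l<m. network P $$ (I 2, l)
           * (\<Sum>i<n. C (20 + i) * slot (network P) (I 1) (slots n I) i l)))\<^sup>2))"
proof -
  let ?TL = "m * ((n * (5 + 70) + 30 + 20) + icost Modes + 10) + icost Modes + 10"
  let ?U = "network P"
  let ?s = "\<lambda>l. \<Sum>i<n. C (20 + i) * slot ?U (I 1) (slots n I) i l"
  let ?Inv = "\<lambda>l J D V. agree {5, 6} I J \<and> agree {2, 5} C D \<and> V = W \<and> D 5 = (\<Sum>j<l. ?U $$ (I 2, j) * ?s j)"
  let ?acc = "Accumulate (CLoad (slot_addr (reg 5)))"
  let ?add = "CStore (IConst 5) (CAdd (creg 5) (CMul (Network (reg 2) (reg 6)) (creg 2)))"
  let ?fin = "CStore (IConst 1) (CMul (creg 5) (CConj (creg 5)))"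
  have dim: "dim_row ?U = m" "dim_col ?U = m" using U by auto
  have loop: "run P B (For 6 Modes (Seq ?acc ?add)) ?TL
      I (C(5 := 0)) W (?Inv m)"
  proof (rule run_For[where Inv = ?Inv])
    fix l J D V
    assume l: "l < m" "?Inv l J D V" "J 6 = l"
    have J: "J 0 = n" "J 1 = I 1" "J 2 = I 2" "\<And>j. J (20 + j) = I (20 + j)"
      using l(2) n by (auto simp: agree_def)
    have D: "D (20 + j) = C (20 + j)" for j using l(2) agreeD[of "{2, 5}" C D] by simp
    show "run P B (Seq ?acc ?add) (n * (5 + 70) + 30 + 20) J D V
      (\<lambda>J D V. J 6 = l \<and> ?Inv (Suc l) (J(6 := Suc l)) D V)"
    proof (rule run_seq, rule run_weaken)
      show "run P B ?acc (n * (5 + 70) + 30) J D V (\<lambda>J' D' V'. agree {5} J J' \<and> agree {2} D D' \<and> V' = V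
         \<and> D' 2 = (\<Sum>i<n. C (20 + i) * slot ?U (J 1) (slots n J) i (J 6)))"
      proof (rule run_le, rule run_Accumulate[where m = m and n = n])
        fix i J' D'
        assume "agree {5} J J'" "J' 5 = i" "agree {2} D D'"
        then show "cval P (CLoad (slot_addr (reg 5))) (mem_state J' D' V) = C (20 + i)"
          using D agreeD[of "{2}" D D'] by simp
      qed (use U J g l B in auto)
      fix J' D' V'
      assume a: "agree {5} J J' \<and> agree {2} D D' \<and> V' = V
         \<and> D' 2 = (\<Sum>i<n. C (20 + i) * slot ?U (J 1) (slots n J) i (J 6))"
      have "slots n J = slots n I" using J(4) by (intro slots_cong)
      then have "D' 2 = ?s l" using a J l(3) by simp
      moreover have "D' 5 = D 5" using a by (auto simp: agree_def)
      moreover have "agree {5, 6} I J'" using a l(2) by (auto simp: agree_def)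
      moreover have "agree {2, 5} C D'" using a l(2) by (auto simp: agree_def)
      moreover have "J' 6 = l" "J' 2 = I 2" using a l(3) J by (simp_all add: agree_def)
      ultimately show "run P B ?add 20 J' D' V' (\<lambda>J D V. J 6 = l \<and> ?Inv (Suc l) (J(6 := Suc l)) D V)"
        using a l(1,2) e B dim by - (rule run_le, rule run_CStore, simp_all)
    qed simp
  qed (use dim B in auto)
  have "run P B Weight (4 + (?TL + 10)) I C W
    (\<lambda>J D V. agree {5, 6} I J \<and> agree {1, 2, 5} C D \<and> V = W
       \<and> D 1 = of_real ((cmod (\<Sum>l<m. ?U $$ (I 2, l) * ?s l))\<^sup>2))" (is "run _ _ _ _ _ _ _ ?Q")
    unfolding Weight_def
  proof (rule run_seq, rule run_le, rule run_CStore)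
    have "run P B (Seq (For 6 Modes (Seq ?acc ?add)) ?fin)
      (?TL + 10) I (C(5 := 0)) W ?Q"
    proof (rule run_seq, rule run_weaken[OF loop order.refl])
      fix J D V assume a: "?Inv m J D V"
      have "agree {1, 2, 5} C D" using a agree_mono[of "{2, 5}" C D "{1, 2, 5}"] by auto
      moreover define z where "z = (\<Sum>l<m. ?U $$ (I 2, l) * ?s l)"
      moreover have "D 5 = z" using a by (simp only: z_def)
      ultimately show "run P B ?fin 10 J D V ?Q"
        unfolding z_def[symmetric]
        using conjunct1[OF a] conjunct1[OF conjunct2[OF conjunct2[OF a]]] B
        by - (rule run_le, rule run_CStore, simp_all add: complex_norm_square[symmetric])
    qed
    then show "run P B (Seq (For 6 Modes (Seq ?acc ?add)) ?fin)
      (?TL + 10) I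
      (C(ival P (IConst 5) (mem_state I C W) := cval P (OfIndex (IConst 0)) (mem_state I C W))) W ?Q"
      by simp
  qed (use B in simp_all)
  then show ?thesis by (rule run_le) (simp add: algebra_simps)
qed

lemma set_pmf_reservoir: "set_pmf (kernel_chain (reservoir_kernel w) N 0 x) \<subseteq> insert x {..<N}"
proof (induction N)
  case (Suc N)
  have "set_pmf (reservoir_kernel w N y) \<subseteq> {N, y}" for y
    by (auto simp: reservoir_kernel_def)
  then have "y \<in> insert x {..<Suc N}" if "y \<in> set_pmf (kernel_chain (reservoir_kernel w) (Suc N) 0 x)" for y
  proof -
    from that obtain z where "z \<in> set_pmf (kernel_chain (reservoir_kernel w) N 0 x)"
      "y \<in> set_pmf (reservoir_kernel w N z)" unfolding kernel_chain_Suc by auto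
    then have "z \<in> insert x {..<N}" "y \<in> {N, z}" using Suc \<open>set_pmf (reservoir_kernel w N z) \<subseteq> {N, z}\<close> by blast+
    then show ?thesis by auto
  qed
  then show ?case by blast
qed simp

definition Resample :: com where
  "Resample = Seq Partners (Seq (Reservoir Modes Weight) (IStore (slot_addr (reg 1)) (reg 3)))"

lemma run_dist_Resample:
  assumes U: "network P \<in> carrier_mat m m" and n: "I 0 = n" "n = 2 * Suc p" and g: "\<And>i. i < n \<Longrightarrow> I (20 + i) < m"
    and k: "I 1 = k" "k < n" and B: "20 + n + n < B"
  shows "run_dist P B Resample (2 ^ n * (300 * (m * n + m + n + 1)) + 100 * (n + 1) + m * (m * (n * 80 + 80) + 100) + 50) I C W
    (\<lambda>I C W. slots n I) (resample_step (network P) ((2 ^ p * fact p)\<^sup>2) k (slots n I))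
    (\<lambda>J D V. J 0 = n \<and> J 1 = k \<and> (\<forall>i<n. J (20 + i) < m) \<and> V = W)"
proof -
  let ?Q = "\<lambda>J D V. J 0 = n \<and> J 1 = k \<and> (\<forall>i<n. J (20 + i) < m) \<and> V = W"
  let ?R = "m * ((m * (n * 80 + 80) + 50) + icost Modes + 34) + icost Modes + 20"
  let ?U = "network P" and ?g = "slots n I" and ?Y = "{5, 6, 8, 9, 10} \<union> {20 + n..20 + n + n}"
  have dim: "dim_row ?U = m" using U by simp
  have m: "0 < m" using g[OF k(2)] by simp
  define w where "w e = (2 ^ p * fact p)\<^sup>2 * (cmod (stage_amp ?U (Suc k) (?g[k := e])))\<^sup>2" for e
  let ?h = "\<lambda>x. if x = k then 0 else 2 ^ p * fact p * partner_amp ?U k ?g x"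
  have w: "w e = (cmod (\<Sum>l<m. ?U $$ (e, l) * (\<Sum>i<n. ?h i * slot ?U k ?g i l)))\<^sup>2" for e
  proof -
    have "(\<Sum>i<n. ?h i * slot ?U k ?g i l) = 2 ^ p * fact p * input_amp ?U k ?g l" for l
    proof -
      have "(\<Sum>i<n. ?h i * slot ?U k ?g i l) = (\<Sum>i\<in>{..<n} - {k}. 2 ^ p * fact p * (partner_amp ?U k ?g i * slot ?U k ?g i l))"
        by (rule sum.mono_neutral_cong_right) (auto simp: mult.assoc)
      then show ?thesis by (simp add: input_amp_def sum_distrib_left)
    qed
    then have "(\<Sum>l<m. ?U $$ (e, l) * (\<Sum>i<n. ?h i * slot ?U k ?g i l))
        = 2 ^ p * fact p * stage_amp ?U (Suc k) (?g[k := e])"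
      using k by (simp add: stage_amp_out dim sum_distrib_left mult_ac)
    then show ?thesis by (simp add: w_def norm_mult norm_power power_mult_distrib)
  qed
  let ?X = "{2, 3, 4, 5, 6, 8, 9, 10} \<union> {20 + n..20 + n + n}"
  let ?J = "\<lambda>J D V. agree ?X I J \<and> V = W \<and> (\<forall>x<n. D (20 + x) = ?h x)"
  let ?store = "IStore (slot_addr (reg 1)) (reg 3)"
  have res: "run_dist P B (Reservoir Modes Weight) ?R J D V
      (\<lambda>I C W. I 3) (kernel_chain (reservoir_kernel w) m 0 0) ?J" if "?J J D V" for J D V
  proof (rule run_dist_Reservoir[where J = "\<lambda>_. ?J"])
    fix e J D V assume e: "e < m" "?J J D V" "J 2 = e"
    have J: "J 0 = n" "J 1 = k" "\<And>i. i < n \<Longrightarrow> J (20 + i) = I (20 + i)"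
      using e(2) n k agreeD[of ?X I J] by auto
    have sl: "slots n J = ?g" using J(3) by (rule slots_cong)
    show "run P B Weight (m * (n * 80 + 80) + 50) J D V
      (\<lambda>I' C' W'. ?J I' C' W' \<and> I' 2 = e \<and> I' 3 = J 3 \<and> C' 0 = D 0 \<and> C' 1 = of_real (w e))"
    proof (rule run_weaken[OF run_Weight[of P m J n B D V] order.refl])
      fix J' D' V'
      assume a: "agree {5, 6} J J' \<and> agree {1, 2, 5} D D' \<and> V' = V
       \<and> D' 1 = of_real ((cmod (\<Sum>l<m. ?U $$ (J 2, l) * (\<Sum>i<n. D (20 + i) * slot ?U (J 1) (slots n J) i l)))\<^sup>2)"
      have "(\<Sum>i<n. D (20 + i) * slot ?U k ?g i l) = (\<Sum>i<n. ?h i * slot ?U k ?g i l)" for l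
      proof (rule sum.cong[OF refl])
        fix i assume "i \<in> {..<n}"
        then have "D (20 + i) = ?h i" using e(2) by blast
        then show "D (20 + i) * slot ?U k ?g i l = ?h i * slot ?U k ?g i l" by (rule arg_cong)
      qed
      then have "D' 1 = of_real (w e)"
        using conjunct2[OF conjunct2[OF conjunct2[OF a]]] unfolding w sl J(2) e(3) by (simp only:)
      moreover have "agree ?X I J'"
        by (rule agree_trans[OF conjunct1[OF e(2)]], rule agree_mono[OF conjunct1[OF a]]) auto
      moreover have "D' (20 + x) = D (20 + x)" "D' 0 = D 0" for x using a agreeD[of "{1, 2, 5}" D D'] by simp_all
      moreover have "J' 2 = J 2" "J' 3 = J 3" using a agreeD[of "{5, 6}" J J'] by simp_all
      ultimately show "?J J' D' V' \<and> J' 2 = e \<and> J' 3 = J 3 \<and> D' 0 = D 0 \<and> D' 1 = of_real (w e)"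
        using a e by simp
    qed (use U J g e B in auto)
  next
    show "?J (J(a := x)) D V" if "?J J D V" "a \<in> {2, 3, 4}" for J D V a x
      using that by (subst agree_upd) auto
  next
    show "?J J (D(0 := s)) V" if "?J J D V" for J D V s using that by simp
    show "ival P Modes (mem_state J D V) = m" for J D V using dim by simp
    show "?J J D V" by (rule that)
    show "4 < B" using B by simp
  qed
  have tail: "run_dist P B (Seq (Reservoir Modes Weight) ?store)
      (?R + 10) J D V
      (\<lambda>I C W. slots n I) (resample_step ?U ((2 ^ p * fact p)\<^sup>2) k ?g)
      ?Q" if inv: "?J J D V" for J D V
  proof -
    have "run_dist P B (Seq (Reservoir Modes Weight) ?store)
      (?R + 10) J D V (\<lambda>I C W. slots n I)
      (bind_pmf (kernel_chain (reservoir_kernel w) m 0 0) (\<lambda>e. return_pmf (?g[k := e])))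
      ?Q"
    proof (rule run_dist_seq[OF res[OF inv]])
      fix J D V assume a: "?J J D V" "J 3 \<in> set_pmf (kernel_chain (reservoir_kernel w) m 0 0)"
      have e: "J 3 < m" using subsetD[OF set_pmf_reservoir a(2)] m by auto
      have J: "J 0 = n" "J 1 = k" "\<And>i. i < n \<Longrightarrow> J (20 + i) = I (20 + i)"
        using a(1) n k agreeD[of ?X I J] by auto
      have "slots n (J(20 + k := J 3)) = ?g[k := J 3]"
        using J k by (auto intro!: nth_equalityI simp: nth_list_update)
      then show "run_dist P B ?store 10 J D V (\<lambda>I C W. slots n I) (return_pmf (?g[k := J 3]))
        ?Q"
        using e J B k g a(1) by - (rule run_dist_of_run, rule run_le, rule run_IStore, simp_all)
    qed
    then show ?thesis by (simp only: resample_step_def map_pmf_def dim w_def[symmetric])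
  qed
  have "run_dist P B Resample ((2 ^ n * (300 * (m * n + m + n + 1)) + 100 * (n + 1)) +
      (?R + 10)) I C W
      (\<lambda>I C W. slots n I) (resample_step ?U ((2 ^ p * fact p)\<^sup>2) k ?g)
      ?Q"
    unfolding Resample_def
  proof (rule run_dist_det_seq, rule run_weaken[OF run_Partners[OF U n g k B] order.refl])
    fix J D V
    assume a: "agree ?Y I J \<and> V = W \<and> (\<forall>x<n. D (20 + x) = ?h x)"
    have "agree ?X I J" by (rule agree_mono[of ?Y]) (use a in auto)
    then have "?J J D V" by (rule conjI) (rule conjunct2[OF a])
    then show "run_dist P B (Seq (Reservoir Modes Weight) ?store)
      (?R + 10) J D V
      (\<lambda>I C W. slots n I) (resample_step ?U ((2 ^ p * fact p)\<^sup>2) k ?g)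
      ?Q" by (rule tail)
  qed
  then show ?thesis by (rule run_dist_le) (simp add: algebra_simps)
qed

definition resample_time :: "nat \<Rightarrow> nat \<Rightarrow> nat" where
  "resample_time m n = 2 ^ n * (300 * (m * n + m + n + 1)) + 100 * (n + 1) + m * (m * (n * 80 + 80) + 100) + 50"

lemma run_dist_ResampleAll:
  assumes U: "network P \<in> carrier_mat m m" and n: "I 0 = n" "even n" and g: "\<And>i. i < n \<Longrightarrow> I (20 + i) < m"
    and B: "20 + n + n < B"
  shows "run_dist P B (For 1 (reg 0) Resample) (n * (resample_time m n + 12) + 12) I C W (\<lambda>I C W. slots n I)
    (kernel_chain (resample_step (network P) ((2 ^ (n div 2 - 1) * fact (n div 2 - 1))\<^sup>2)) n 0 (slots n I))
    (\<lambda>J D V. J 0 = n \<and> V = W)"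
proof -
  let ?p = "n div 2 - 1"
  let ?K = "resample_step (network P) ((2 ^ ?p * fact ?p)\<^sup>2)"
  let ?Inv = "\<lambda>J D V. J 0 = n \<and> (\<forall>i<n. J (20 + i) < m) \<and> V = W"
  have slots1: "slots n (J(1 := x)) = slots n J" for J x by (rule slots_cong) simp
  have "run_dist P B (For 1 (reg 0) Resample) (n * (resample_time m n + icost (reg 0) + 10) + icost (reg 0) + 10) I C W
    (\<lambda>I C W. slots n I) (kernel_chain ?K n 0 (slots n (I(1 := 0)))) (\<lambda>J D V. ?Inv J D V \<and> J 1 = n)"
  proof (rule run_dist_For[where f = "\<lambda>_ I C W. slots n I" and Inv = "\<lambda>_. ?Inv"])
    fix k J D V assume k: "k < n" "?Inv J D V" "J 1 = k"
    have p: "n = 2 * Suc ?p" using k(1) n(2) by (auto elim!: evenE)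
    show "run_dist P B Resample (resample_time m n) J D V (\<lambda>I C W. slots n (I(1 := Suc k))) (?K k (slots n J))
      (\<lambda>J D V. J 1 = k \<and> ?Inv (J(1 := Suc k)) D V)"
      unfolding slots1 resample_time_def
      by (rule run_dist_weaken[OF run_dist_Resample[where I = J and n = n and p = ?p and k = k, OF U _ p]])
        (use k B in auto)
  qed (use n g B in auto)
  then show ?thesis unfolding slots1 by (rule run_dist_weaken) auto
qed

definition Output :: com where
  "Output = For 1 Modes (Seq (IStore (IConst 7) (IConst 0))
     (Seq (For 5 (reg 0) (IStore (IConst 7) (IAdd (reg 7) (ISub (IConst 1)
        (IAdd (ISub (ILoad (slot_addr (reg 5))) (reg 1)) (ISub (reg 1) (ILoad (slot_addr (reg 5)))))))))
       (Emit (reg 7))))"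

lemma run_Output:
  assumes m: "dim_row (network P) = m" and n: "I 0 = n" and B: "20 < B"
  shows "run P B Output (m * (n * 40 + 50) + 20) I C W (\<lambda>J D V. V = W @ mode_counts m (slots n I))"
proof -
  let ?TL = "n * (24 + icost (reg 0) + 10) + icost (reg 0) + 10"
  let ?cnt = "\<lambda>j. count (mset (slots n I)) j"
  let ?Inv = "\<lambda>j J D V. J 0 = n \<and> (\<forall>i. J (20 + i) = I (20 + i)) \<and> V = W @ map ?cnt [0..<j]"
  let ?add = "IStore (IConst 7) (IAdd (reg 7) (ISub (IConst 1)
        (IAdd (ISub (ILoad (slot_addr (reg 5))) (reg 1)) (ISub (reg 1) (ILoad (slot_addr (reg 5)))))))"
  have cnt: "?cnt j = (\<Sum>i<n. of_bool (I (20 + i) = j))" for j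
    using count_mset_eq_sum[of "slots n I" j, where 'a = nat] by simp
  have loop: "run P B (For 5 (reg 0) ?add) ?TL J D V
     (\<lambda>J' D' V'. J' 7 = ?cnt j \<and> agree {5, 7} J J' \<and> V' = V)"
    if J: "?Inv j J D V" "J 1 = j" "J 7 = 0" for j J D V
  proof (rule run_For[where Inv = "\<lambda>i J' D' V'. J' 7 = (\<Sum>i'<i. of_bool (I (20 + i') = j)) \<and> agree {5, 7} J J' \<and> V' = V"])
    fix i J' D' V'
    assume i: "J' 7 = (\<Sum>i'<i. of_bool (I (20 + i') = j)) \<and> agree {5, 7} J J' \<and> V' = V" "J' 5 = i"
    have J': "J' 1 = j" "J' (20 + i) = I (20 + i)" using i(1) J agreeD[of "{5, 7}" J J'] by simp_all
    have "agree {5, 7} J (J'(7 := v, 5 := Suc i))" for v using i by simp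
    then show "run P B ?add 24 J' D' V' (\<lambda>J' D' V'. J' 5 = i \<and> (J'(5 := Suc i)) 7 = (\<Sum>i'<Suc i. of_bool (I (20 + i') = j))
       \<and> agree {5, 7} J (J'(5 := Suc i)) \<and> V' = V)"
      using i J' B by - (rule run_le, rule run_IStore, simp_all add: of_bool_eq_monus del: sum_of_bool_eq)
  next
    show "ival P (reg 0) (mem_state J' D' V') = n"
      if "J' 7 = (\<Sum>i'<i. of_bool (I (20 + i') = j)) \<and> agree {5, 7} J J' \<and> V' = V" for i J' D' V'
      using that J agreeD[of "{5, 7}" J J' 0] by simp
    show "J' 7 = ?cnt j \<and> agree {5, 7} J J' \<and> V' = V"
      if "J' 7 = (\<Sum>i'<n. of_bool (I (20 + i') = j)) \<and> agree {5, 7} J J' \<and> V' = V" for J' D' V'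
      using that unfolding cnt by blast
  qed (use J B in simp_all)
  let ?body = "Seq (IStore (IConst 7) (IConst 0)) (Seq (For 5 (reg 0) ?add) (Emit (reg 7)))"
  have "run P B (For 1 Modes ?body) (m * ((3 + (?TL + 3)) + icost Modes + 10) + icost Modes + 10)
    I C W (\<lambda>J D V. V = W @ mode_counts m (slots n I))"
  proof (rule run_For[where Inv = ?Inv])
    fix j J D V assume j: "?Inv j J D V" "J 1 = j"
    have "run P B (Seq (For 5 (reg 0) ?add) (Emit (reg 7))) (?TL + 3) (J(7 := 0)) D V
      (\<lambda>J D V. J 1 = j \<and> ?Inv (Suc j) (J(1 := Suc j)) D V)"
    proof (rule run_seq, rule run_weaken[OF loop order.refl])
      show "?Inv j (J(7 := 0)) D V" "(J(7 := 0)) 1 = j" "(J(7 := 0)) 7 = 0" using j by auto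
      fix J' D' V' assume a: "J' 7 = ?cnt j \<and> agree {5, 7} (J(7 := 0)) J' \<and> V' = V"
      then have "J' 0 = n" "J' 1 = j" "\<And>i. J' (20 + i) = I (20 + i)"
        using j agreeD[of "{5, 7}" "J(7 := 0)" J'] by simp_all
      then show "run P B (Emit (reg 7)) 3 J' D' V' (\<lambda>J D V. J 1 = j \<and> ?Inv (Suc j) (J(1 := Suc j)) D V)"
        using a j by - (rule run_le, rule run_Emit, simp_all)
    qed
    then show "run P B ?body (3 + (?TL + 3)) J D V
      (\<lambda>J D V. J 1 = j \<and> ?Inv (Suc j) (J(1 := Suc j)) D V)"
      using B by - (rule run_seq, rule run_le, rule run_IStore, simp_all)
  qed (use m n B in \<open>simp_all add: mode_counts_def\<close>)
  then show ?thesis unfolding Output_def by (rule run_le) (simp add: algebra_simps)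
qed

definition Config :: com where
  "Config = Seq Urn (Seq (For 1 (reg 0) Resample) Output)"

definition config_steps :: "nat \<Rightarrow> nat \<Rightarrow> nat" where
  "config_steps m n = (n div 2 * (100 * (m + n + 1) + 10) + 20)
     + ((n * (resample_time m n + 12) + 12) + (m * (n * 40 + 50) + 20))"

lemma run_dist_Config:
  assumes U: "network P \<in> carrier_mat m m" "unitary (network P)" and m: "0 < m"
    and n: "I 0 = n" "even n" and B: "20 + n + n < B" and W: "W = []"
  obtains E where "run_dist P B Config (config_steps m n) I C W (\<lambda>I C W. W) E (\<lambda>J D V. sum_list V = n)"
    and "\<And>s. pmf E s = config_prob (network P) n s"
proof -
  let ?U = "network P" and ?h = "n div 2" and ?p = "n div 2 - 1"
  let ?K = "resample_step ?U ((2 ^ ?p * fact ?p)\<^sup>2)" and ?urn = "kernel_chain (\<lambda>_. urn_step m) ?h 0 []"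
  have dim: "dim_row ?U = m" using U by simp
  have h: "n = 2 * ?h" using n by simp
  have out: "run_dist P B Output (m * (n * 40 + 50) + 20) J D V (\<lambda>I C W. W)
      (return_pmf (mode_counts m (slots n J))) (\<lambda>_ _ _. True)" if "J 0 = n \<and> V = W" for J D V
    by (rule run_dist_of_run, rule run_weaken[OF run_Output[OF dim, of J n] order.refl]) (use that W B in auto)
  have res: "run_dist P B (Seq (For 1 (reg 0) Resample) Output)
      ((n * (resample_time m n + 12) + 12) + (m * (n * 40 + 50) + 20)) J D V (\<lambda>I C W. W)
      (map_pmf (mode_counts m) (kernel_chain ?K n 0 (slots n J))) (\<lambda>_ _ _. True)"
    if J: "J 0 = n \<and> V = W" "slots n J \<in> set_pmf ?urn" for J D V
  proof -
    have "pmf ?urn (slots n J) \<noteq> 0" using J(2) by (simp add: set_pmf_iff)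
    then have ml: "slots n J \<in> mode_lists n m"
      using pmf_urn_chain[OF m, of ?h] h by (auto split: if_splits)
    have g: "J (20 + i) < m" if "i < n" for i using mode_lists_nth[OF ml that] that by simp
    show ?thesis
      unfolding map_pmf_def
    proof (rule run_dist_seq)
      show "run_dist P B (For 1 (reg 0) Resample) (n * (resample_time m n + 12) + 12) J D V (\<lambda>I C W. slots n I)
        (kernel_chain ?K n 0 (slots n J)) (\<lambda>J D V. J 0 = n \<and> V = W)"
        by (rule run_dist_weaken[OF run_dist_ResampleAll[OF U(1)]]) (use J g n B in auto)
    qed (rule out)
  qed
  let ?E = "map_pmf (mode_counts m) (bind_pmf ?urn (kernel_chain ?K n 0))"
  have E: "pmf ?E s = config_prob ?U n s" for s
    by (rule pmf_config_sampler[OF m U _ h]) simp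
  have "run_dist P B Config (config_steps m n) I C W (\<lambda>I C W. W)
    (bind_pmf ?urn (\<lambda>g. map_pmf (mode_counts m) (kernel_chain ?K n 0 g))) (\<lambda>_ _ _. True)"
    unfolding Config_def config_steps_def
  proof (rule run_dist_seq)
    show "run_dist P B Urn (?h * (100 * (m + n + 1) + 10) + 20) I C W (\<lambda>I C W. slots n I) ?urn
      (\<lambda>J D V. J 0 = n \<and> V = W)"
      using n h B dim m by (intro run_dist_Urn) auto
  qed (rule res)
  then have "run_dist P B Config (config_steps m n) I C W (\<lambda>I C W. W) ?E (\<lambda>_ _ _. True)"
    by (simp only: map_bind_pmf)
  then have "run_dist P B Config (config_steps m n) I C W (\<lambda>I C W. W) ?E (\<lambda>J D V. sum_list V = n)"
  proof (rule run_dist_weaken)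
    fix V assume "V \<in> set_pmf ?E"
    then have "pmf ?E V \<noteq> 0" by (rule iffD1[OF set_pmf_iff])
    then have "config_prob ?U n V \<noteq> 0" unfolding E .
    then show "sum_list V = n" by (simp add: config_prob_def split: if_splits)
  qed simp
  then show thesis using E by (rule that)
qed

section \<open>Sampling the photon number\<close>

definition photon_weight :: "nat \<Rightarrow> real \<Rightarrow> nat \<Rightarrow> real" where
  "photon_weight m r k = pair_binom m (2 * k) * tanh r ^ (2 * k)"

lemma photon_weight_0 [simp]: "photon_weight m r 0 = 1"
  by (simp add: photon_weight_def pair_binom_def)

lemma photon_weight_Suc:
  "photon_weight m r (Suc k) = photon_weight m r k * ((tanh r)\<^sup>2 * ((real m + 2 * real k) / (2 * real k + 2)))"
  unfolding photon_weight_def pair_binom_Suc by (simp add: power2_eq_square mult_ac)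

lemma photon_weight_nonneg: "0 \<le> photon_weight m r k"
  by (induction k) (simp_all add: photon_weight_Suc)

lemma photon_prob_eq_weight: "photon_prob m r (2 * k) = photon_weight m r k / cosh r ^ m"
  by (simp add: photon_prob_def photon_weight_def)

definition half_most :: "nat \<Rightarrow> real \<Rightarrow> nat" where
  "half_most m r = nat \<lfloor>(real m / 2 - 1) * (sinh r)\<^sup>2\<rfloor>"

definition range_card :: "nat \<Rightarrow> real \<Rightarrow> real \<Rightarrow> nat" where
  "range_card m r c = Suc (nat \<lfloor>c * real (half_most m r)\<rfloor>)"

lemma photon_range_eq:
  assumes "c > 0"
  shows "photon_range m r c = (*) 2 ` {..<range_card m r c}"
proof -
  have most: "n_most m r = 2 * half_most m r"
    by (simp add: n_most_def half_most_def nat_mult_distrib)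
  have "real (2 * k) \<le> c * real (n_most m r) \<longleftrightarrow> k < range_card m r c" for k
  proof -
    have "real (2 * k) \<le> c * real (n_most m r) \<longleftrightarrow> of_int (int k) \<le> c * real (half_most m r)"
      unfolding most by simp
    also have "\<dots> \<longleftrightarrow> int k \<le> \<lfloor>c * real (half_most m r)\<rfloor>" by (rule le_floor_iff[symmetric])
    also have "\<dots> \<longleftrightarrow> k < range_card m r c"
      using assms by (auto simp: range_card_def less_Suc_eq_le le_nat_iff)
    finally show ?thesis .
  qed
  note iff = this
  show ?thesis
  proof (intro equalityI subsetI)
    fix n assume "n \<in> photon_range m r c"
    then have "even n" and le: "real n \<le> c * real (n_most m r)" by (simp_all add: photon_range_def)
    then obtain k where "n = 2 * k" by (elim evenE)
    then show "n \<in> (*) 2 ` {..<range_card m r c}" using le iff[of k] by simp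
  next
    fix n assume "n \<in> (*) 2 ` {..<range_card m r c}"
    then obtain k where "n = 2 * k" "k < range_card m r c" by auto
    then show "n \<in> photon_range m r c" using iff[of k] by (simp add: photon_range_def)
  qed
qed

lemma truncated_photon_prob_eq:
  assumes "c > 0"
  shows "truncated_photon_prob m r c n = (if even n \<and> n div 2 < range_card m r c
     then photon_weight m r (n div 2) / (\<Sum>k<range_card m r c. photon_weight m r k) else 0)"
proof -
  have "(\<Sum>k\<in>photon_range m r c. photon_prob m r k) = (\<Sum>k<range_card m r c. photon_weight m r k) / cosh r ^ m"
    unfolding photon_range_eq[OF assms]
    by (subst sum.reindex) (auto simp: inj_on_def photon_prob_eq_weight sum_divide_distrib)
  moreover have "n \<in> photon_range m r c \<longleftrightarrow> even n \<and> n div 2 < range_card m r c"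
    unfolding photon_range_eq[OF assms]
    by (metis (no_types, lifting) dvd_triv_left even_two_times_div_two image_iff lessThan_iff nonzero_mult_div_cancel_left zero_neq_numeral)
  moreover have "cosh r ^ m \<noteq> (0::real)" using cosh_real_pos[of r] by simp
  moreover have "photon_prob m r n = photon_weight m r (n div 2) / cosh r ^ m" if "even n"
    using photon_prob_eq_weight[of m r "n div 2"] that by simp
  ultimately show ?thesis by (simp add: truncated_photon_prob_def)
qed

lemma pmf_number_sampler:
  assumes "c > 0"
  shows "pmf (map_pmf ((*) 2) (kernel_chain (reservoir_kernel (photon_weight m r)) (range_card m r c) 0 0)) n
    = truncated_photon_prob m r c n"
proof -
  let ?K = "range_card m r c" and ?w = "photon_weight m r"
  let ?D = "kernel_chain (reservoir_kernel ?w) ?K 0 0"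
  have "?w 0 \<le> (\<Sum>k<?K. ?w k)"
    using photon_weight_nonneg by (intro member_le_sum) (auto simp: range_card_def)
  then have pos: "0 < (\<Sum>k<?K. ?w k)" by simp
  have D: "pmf ?D k = (if k < ?K then ?w k / (\<Sum>k<?K. ?w k) else 0)" for k
    by (rule pmf_reservoir) (use pos photon_weight_nonneg in auto)
  show ?thesis
  proof (cases "even n")
    case True
    then obtain k where k: "n = 2 * k" ..
    have "pmf (map_pmf ((*) 2) ?D) ((*) 2 k) = pmf ?D k" by (rule pmf_map_inj') (simp add: inj_def)
    then show ?thesis using D k by (simp add: truncated_photon_prob_eq[OF assms])
  next
    case False
    then have "n \<notin> set_pmf (map_pmf ((*) 2) ?D)" by auto
    then show ?thesis using False by (simp only: set_pmf_iff truncated_photon_prob_eq[OF assms]) simp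
  qed
qed

text \<open>Complex cells 2 to 4 receive \<open>sinh\<^sup>2 r\<close>, \<open>(m / 2 - 1) sinh\<^sup>2 r\<close> and \<open>tanh\<^sup>2 r\<close>, cell 5 the
  next weight; index cells 5 and 6 receive \<open>half_most\<close> and \<open>range_card\<close>.\<close>

definition Number :: com where
  "Number =
    (let num = CSub (CExp Squeezing) (CExp (CSub (OfIndex (IConst 0)) Squeezing));
         den = CAdd (CExp Squeezing) (CExp (CSub (OfIndex (IConst 0)) Squeezing));
         two = OfIndex (IConst 2)
     in Seq (CStore (IConst 2) (CDiv (CMul num num) (OfIndex (IConst 4))))
       (Seq (CStore (IConst 3) (CMul (CSub (CDiv (OfIndex Modes) two) (OfIndex (IConst 1))) (creg 2)))
       (Seq (CStore (IConst 4) (CDiv (CMul num num) (CMul den den)))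
       (Seq (CStore (IConst 5) (OfIndex (IConst 1)))
       (Seq (IStore (IConst 5) (IConst 0))
       (Seq (While (BNot (CLess (creg 3) (OfIndex (IAdd (reg 5) (IConst 1)))))
               (IStore (IConst 5) (IAdd (reg 5) (IConst 1))))
       (Seq (IStore (IConst 6) (IConst 0))
       (Seq (While (BNot (CLess (CMul Cutoff (OfIndex (reg 5))) (OfIndex (reg 6))))
               (IStore (IConst 6) (IAdd (reg 6) (IConst 1))))
       (Seq (Reservoir (reg 6) (Seq (CStore (IConst 1) (creg 5))
          (CStore (IConst 5) (CMul (creg 5) (CMul (creg 4)
             (CDiv (OfIndex (IAdd Modes (IAdd (reg 2) (reg 2))))
                   (OfIndex (IAdd (IAdd (reg 2) (reg 2)) (IConst 2)))))))))
         (IStore (IConst 0) (IAdd (reg 3) (reg 3))))))))))))"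

lemma run_dist_Number:
  assumes m: "dim_row (network P) = m" and r: "squeezing P = r" and c: "cutoff P = c" "c > 0" and B: "20 < B"
  obtains E where "run_dist P B Number (300 + half_most m r * 30 + range_card m r c * 150) I C W
      (\<lambda>I C W. I 0) E (\<lambda>J D V. even (J 0) \<and> V = W)"
    and "\<And>n. pmf E n = truncated_photon_prob m r c n"
proof -
  let ?K = "range_card m r c" and ?M = "half_most m r" and ?w = "photon_weight m r"
  let ?Q = "\<lambda>J D V. even (J 0) \<and> V = W"
  let ?D = "kernel_chain (reservoir_kernel ?w) ?K 0 0"
  let ?E = "map_pmf ((*) 2) ?D"
  let ?x = "(real m / 2 - 1) * (sinh r)\<^sup>2"
  let ?weight = "Seq (CStore (IConst 1) (creg 5))
          (CStore (IConst 5) (CMul (creg 5) (CMul (creg 4)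
             (CDiv (OfIndex (IAdd Modes (IAdd (reg 2) (reg 2))))
                   (OfIndex (IAdd (IAdd (reg 2) (reg 2)) (IConst 2)))))))"
  let ?J = "\<lambda>i (J :: nat \<Rightarrow> nat) (D :: nat \<Rightarrow> complex) V. J 6 = ?K \<and> D 4 = of_real ((tanh r)\<^sup>2) \<and> D 5 = of_real (?w i) \<and> V = W"
  have res: "run_dist P B (Reservoir (reg 6) ?weight) (?K * ((5 + 30) + icost (reg 6) + 34) + icost (reg 6) + 20) J D V
     (\<lambda>I C W. I 3) ?D (?J ?K)" if "?J 0 J D V" for J D V
  proof (rule run_dist_Reservoir[where J = ?J])
    fix i V and J :: "nat \<Rightarrow> nat" and D :: "nat \<Rightarrow> complex" assume i: "?J i J D V" "J 2 = i"
    have w: "D 5 * (D 4 * (of_nat (m + (i + i)) / of_nat (i + i + 2))) = of_real (?w (Suc i))"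
    proof -
      have "of_nat (m + (i + i)) / of_nat (i + i + 2) = complex_of_real ((real m + 2 * real i) / (2 * real i + 2))"
        by simp
      moreover have "D 4 = of_real ((tanh r)\<^sup>2)" "D 5 = of_real (?w i)" using i by blast+
      ultimately show ?thesis by (simp only: photon_weight_Suc of_real_mult)
    qed
    show "run P B ?weight (5 + 30) J D V
      (\<lambda>I' C' W'. ?J (Suc i) I' C' W' \<and> I' 2 = i \<and> I' 3 = J 3 \<and> C' 0 = D 0 \<and> C' 1 = of_real (?w i))"
      apply (rule run_seq, rule run_le, rule run_CStore)
      subgoal using B by simp
      subgoal
        apply (rule run_le, rule run_CStore)
        subgoal using B by simp
        subgoal using i w m by simp
        subgoal by simp
        done
      subgoal by simp
      done
  qed (use that B in auto)
  let ?b1 = "BNot (CLess (creg 3) (OfIndex (IAdd (reg 5) (IConst 1))))"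
  let ?b2 = "BNot (CLess (CMul Cutoff (OfIndex (reg 5))) (OfIndex (reg 6)))"
  let ?inc1 = "IStore (IConst 5) (IAdd (reg 5) (IConst 1))"
  let ?inc2 = "IStore (IConst 6) (IAdd (reg 6) (IConst 1))"
  let ?store = "IStore (IConst 0) (IAdd (reg 3) (reg 3))"
  let ?T4 = "(?K * ((5 + 30) + icost (reg 6) + 34) + icost (reg 6) + 20) + 10"
  let ?P4 = "Seq (Reservoir (reg 6) ?weight) ?store"
  have p4: "run_dist P B ?P4 ?T4 J D V (\<lambda>I C W. I 0) ?E ?Q" if "?J 0 J D V" for J D V
    unfolding map_pmf_def
  proof (rule run_dist_seq, rule res[of J D V])
    show "?J 0 J D V" by (rule that)
    fix J D V assume "?J ?K J D V"
    then show "run_dist P B ?store 10 J D V (\<lambda>I C W. I 0) (return_pmf (2 * J 3)) ?Q"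
      using B by - (rule run_dist_of_run, rule run_le, rule run_IStore, simp_all)
  qed
  let ?T3 = "3 + ((?K * (6 + Suc (bcost ?b2)) + Suc (bcost ?b2)) + ?T4)"
  let ?P3 = "Seq (IStore (IConst 6) (IConst 0)) (Seq (While ?b2 ?inc2) ?P4)"
  have p3: "run_dist P B ?P3 ?T3 J D V (\<lambda>I C W. I 0) ?E ?Q"
    if J: "J 5 = ?M" "D 4 = of_real ((tanh r)\<^sup>2)" "D 5 = 1" "V = W" for J D V
  proof -
    let ?Inv = "\<lambda>i (J :: nat \<Rightarrow> nat) (D :: nat \<Rightarrow> complex) V. J 5 = ?M \<and> J 6 = i \<and> D 4 = of_real ((tanh r)\<^sup>2) \<and> D 5 = 1 \<and> V = W"
    have "run P B (While ?b2 ?inc2) (?K * (6 + Suc (bcost ?b2)) + Suc (bcost ?b2)) (J(6 := 0)) D V (?Inv ?K)"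
    proof (rule run_While[where Inv = ?Inv])
      fix i V and J :: "nat \<Rightarrow> nat" and D :: "nat \<Rightarrow> complex" assume i: "?Inv i J D V"
      have "\<not> c * real ?M < real i \<longleftrightarrow> of_int (int i) \<le> c * real ?M" by auto
      also have "\<dots> \<longleftrightarrow> int i \<le> \<lfloor>c * real ?M\<rfloor>" by (rule le_floor_iff[symmetric])
      also have "\<dots> \<longleftrightarrow> i < ?K"
        using c by (auto simp: range_card_def less_Suc_eq_le le_nat_iff)
      finally show "bval P ?b2 (mem_state J D V) \<longleftrightarrow> i < ?K" using i c by simp
      show "run P B ?inc2 6 J D V (?Inv (Suc i))"
        using i B by - (rule run_le, rule run_IStore, simp_all)
    qed (use J in simp)
    then have "run P B (While ?b2 ?inc2) (?K * (6 + Suc (bcost ?b2)) + Suc (bcost ?b2)) (J(6 := 0)) D V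
      (\<lambda>J D V. run_dist P B ?P4 ?T4 J D V (\<lambda>I C W. I 0) ?E ?Q)"
      by (rule run_weaken[OF _ order.refl]) (rule p4, simp)
    then have "run_dist P B (Seq (While ?b2 ?inc2) ?P4) ((?K * (6 + Suc (bcost ?b2)) + Suc (bcost ?b2)) + ?T4) (J(6 := 0)) D V
      (\<lambda>I C W. I 0) ?E ?Q" by (rule run_dist_det_seq)
    then show ?thesis using B by - (rule run_dist_det_seq, rule run_le, rule run_IStore, simp_all)
  qed
  let ?T2 = "3 + ((?M * (6 + Suc (bcost ?b1)) + Suc (bcost ?b1)) + ?T3)"
  let ?P2 = "Seq (IStore (IConst 5) (IConst 0)) (Seq (While ?b1 ?inc1) ?P3)"
  have p2: "run_dist P B ?P2 ?T2 J D V (\<lambda>I C W. I 0) ?E ?Q"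
    if J: "D 3 = of_real ?x" "D 4 = of_real ((tanh r)\<^sup>2)" "D 5 = 1" "V = W" for J D V
  proof -
    let ?Inv = "\<lambda>i (J :: nat \<Rightarrow> nat) (D :: nat \<Rightarrow> complex) V. J 5 = i \<and> D 3 = of_real ?x \<and> D 4 = of_real ((tanh r)\<^sup>2) \<and> D 5 = 1 \<and> V = W"
    have "run P B (While ?b1 ?inc1) (?M * (6 + Suc (bcost ?b1)) + Suc (bcost ?b1)) (J(5 := 0)) D V (?Inv ?M)"
    proof (rule run_While[where Inv = ?Inv])
      fix i V and J :: "nat \<Rightarrow> nat" and D :: "nat \<Rightarrow> complex" assume i: "?Inv i J D V"
      have "?x < real (i + 1) \<longleftrightarrow> \<lfloor>?x\<rfloor> < int (i + 1)"
        unfolding floor_less_iff by simp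
      then have "\<not> ?x < real (i + 1) \<longleftrightarrow> i < ?M" by (auto simp: half_most_def)
      moreover have "Re (D 3) = ?x" using i by (simp only: Re_complex_of_real)
      ultimately show "bval P ?b1 (mem_state J D V) \<longleftrightarrow> i < ?M"
        using i by (simp only: bval.simps cval.simps ival.simps mem_state_simps of_nat_id complex_Re_of_nat)
      show "run P B ?inc1 6 J D V (?Inv (Suc i))"
        using i B by - (rule run_le, rule run_IStore, simp_all)
    qed (use J in simp)
    then have "run P B (While ?b1 ?inc1) (?M * (6 + Suc (bcost ?b1)) + Suc (bcost ?b1)) (J(5 := 0)) D V
      (\<lambda>J D V. run_dist P B ?P3 ?T3 J D V (\<lambda>I C W. I 0) ?E ?Q)"
      by (rule run_weaken[OF _ order.refl]) (elim conjE, rule p3; assumption)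
    then have "run_dist P B (Seq (While ?b1 ?inc1) ?P3) ((?M * (6 + Suc (bcost ?b1)) + Suc (bcost ?b1)) + ?T3) (J(5 := 0)) D V
      (\<lambda>I C W. I 0) ?E ?Q" by (rule run_dist_det_seq)
    then show ?thesis using B by - (rule run_dist_det_seq, rule run_le, rule run_IStore, simp_all)
  qed
  let ?num = "CSub (CExp Squeezing) (CExp (CSub (OfIndex (IConst 0)) Squeezing))"
  let ?den = "CAdd (CExp Squeezing) (CExp (CSub (OfIndex (IConst 0)) Squeezing))"
  have num: "cval P ?num \<sigma> = of_real (2 * sinh r)" "cval P ?den \<sigma> = of_real (2 * cosh r)" for \<sigma>
    using r by (simp_all add: sinh_field_def cosh_field_def)
  have th: "(2 * sinh r) * (2 * sinh r) / ((2 * cosh r) * (2 * cosh r)) = (tanh r)\<^sup>2"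
    by (simp add: tanh_def power2_eq_square)
  let ?e2 = "CDiv (CMul ?num ?num) (OfIndex (IConst 4))"
  let ?e3 = "CMul (CSub (CDiv (OfIndex Modes) (OfIndex (IConst 2))) (OfIndex (IConst 1))) (creg 2)"
  let ?e4 = "CDiv (CMul ?num ?num) (CMul ?den ?den)"
  have e2: "cval P ?e2 \<sigma> = of_real ((sinh r)\<^sup>2)" for \<sigma>
    unfolding cval.simps(9)[of P "CMul _ _"] cval.simps(8) num by (simp add: power2_eq_square)
  have e4: "cval P ?e4 \<sigma> = of_real ((tanh r)\<^sup>2)" for \<sigma>
    unfolding cval.simps(9)[of P "CMul _ _"] cval.simps(8) num th[symmetric] by simp
  have e3: "cval P ?e3 \<sigma> = of_real ?x" if "cmem \<sigma> 2 = of_real ((sinh r)\<^sup>2)" for \<sigma>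
    using that m by simp
  have s5: "run_dist P B (Seq (CStore (IConst 5) (OfIndex (IConst 1))) ?P2) (10 + ?T2) J D W (\<lambda>I C W. I 0) ?E ?Q"
    if "D 3 = of_real ?x" "D 4 = of_real ((tanh r)\<^sup>2)" for J D
  proof (rule run_dist_det_seq, rule run_le, rule run_CStore, use B in simp)
    have "run_dist P B ?P2 ?T2 J (D(5 := 1)) W (\<lambda>I C W. I 0) ?E ?Q" by (rule p2) (use that in simp_all)
    then show "run_dist P B ?P2 ?T2 J (D(ival P (IConst 5) (mem_state J D W)
      := cval P (OfIndex (IConst 1)) (mem_state J D W))) W (\<lambda>I C W. I 0) ?E ?Q" by (simp only: ival.simps cval.simps of_nat_1)
  qed simp
  have s4: "run_dist P B (Seq (CStore (IConst 4) ?e4) (Seq (CStore (IConst 5) (OfIndex (IConst 1))) ?P2)) (50 + (10 + ?T2)) J D W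
      (\<lambda>I C W. I 0) ?E ?Q" if "D 3 = of_real ?x" for J D
    by (rule run_dist_det_seq, rule run_le, rule run_CStore, use B in simp, unfold e4 ival.simps, rule s5)
      (use that in simp_all)
  have s3: "run_dist P B (Seq (CStore (IConst 3) ?e3) (Seq (CStore (IConst 4) ?e4)
      (Seq (CStore (IConst 5) (OfIndex (IConst 1))) ?P2))) (30 + (50 + (10 + ?T2))) J D W
      (\<lambda>I C W. I 0) ?E ?Q" if "D 2 = of_real ((sinh r)\<^sup>2)" for J D
    by (rule run_dist_det_seq, rule run_le, rule run_CStore, use B in simp, subst e3, use that in simp,
        unfold ival.simps, rule s4) simp_all
  have "run_dist P B Number (30 + (30 + (50 + (10 + ?T2)))) I C W (\<lambda>I C W. I 0) ?E ?Q"
    unfolding Number_def Let_def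
    by (rule run_dist_det_seq, rule run_le, rule run_CStore, use B in simp, unfold e2 ival.simps, rule s3)
      simp_all
  then have "run_dist P B Number (300 + ?M * 30 + ?K * 150) I C W (\<lambda>I C W. I 0) ?E ?Q"
    by (rule run_dist_le) simp
  then show thesis using pmf_number_sampler[OF c(2)] by (rule that)
qed

lemma config_steps_le:
  assumes "1 \<le> m"
  shows "config_steps m n \<le> 1000 * (n + 1)\<^sup>2 * (m\<^sup>2 + 4 ^ n)"
proof -
  define X where "X = m\<^sup>2 + 4 ^ n"
  have pow: "(4::nat) ^ n = (2 ^ n)\<^sup>2" by (simp add: power_even_eq[symmetric] power_mult)
  have mm: "m \<le> m\<^sup>2" using assms by (simp add: power2_eq_square)
  have X: "m\<^sup>2 \<le> X" "m \<le> X" "1 \<le> X" "n + 1 \<le> X"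
  proof -
    show "m\<^sup>2 \<le> X" "m \<le> X" "1 \<le> X" using mm assms by (simp_all add: X_def)
    have "n < 4 ^ n" by (induction n) auto
    then show "n + 1 \<le> X" by (simp add: X_def)
  qed
  have "2 * (2 ^ n * m) \<le> X"
    unfolding X_def pow using sum_squares_bound[of "real (2 ^ n)" "real m"]
    by (simp add: of_nat_le_iff[where 'a = real, symmetric] add.commute del: of_nat_le_iff)
  moreover have "(2::nat) ^ n \<le> 2 ^ n * m" using assms by simp
  ultimately have "2 ^ n * (m + 1) \<le> X" unfolding distrib_left by linarith
  then have "2 ^ n * (m + 1) * (300 * (n + 1)) \<le> X * (300 * (n + 1))" by (rule mult_le_mono1)
  moreover have "2 ^ n * (300 * (m * n + m + n + 1)) = 2 ^ n * (m + 1) * (300 * (n + 1))"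
    by (simp add: algebra_simps)
  moreover have "m * (m * (n * 80 + 80) + 100) \<le> X * (180 * (n + 1))"
  proof -
    have "m * (m * (n * 80 + 80) + 100) = m\<^sup>2 * (80 * (n + 1)) + m * 100"
      by (simp add: algebra_simps power2_eq_square)
    also have "\<dots> \<le> X * (80 * (n + 1)) + X * (100 * (n + 1))"
      using X by (intro add_mono mult_le_mono) auto
    finally show ?thesis by (simp add: algebra_simps)
  qed
  moreover have "100 * (n + 1) + 50 \<le> X * (150 * (n + 1))"
  proof -
    have "100 * (n + 1) + 50 \<le> 1 * (150 * (n + 1))" by simp
    also have "\<dots> \<le> X * (150 * (n + 1))" using X by (intro mult_le_mono1) auto
    finally show ?thesis .
  qed
  ultimately have res: "resample_time m n \<le> X * (630 * (n + 1))"
    unfolding resample_time_def by (simp add: algebra_simps)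
  have one: "k \<le> X * (k * (n + 1))" for k
  proof -
    have "1 * (k * 1) \<le> X * (k * (n + 1))" using X by (intro mult_le_mono) auto
    then show ?thesis by simp
  qed
  have "n * (resample_time m n + 12) \<le> (n + 1) * (X * (630 * (n + 1)) + X * (12 * (n + 1)))"
    using res one[of 12] by (intro mult_le_mono add_mono) auto
  moreover have "n div 2 * (100 * (m + n + 1) + 10) \<le> (n + 1) * (X * (210 * (n + 1)))"
  proof (rule mult_le_mono)
    have "100 * (m + n + 1) + 10 \<le> X * 210" using X by simp
    also have "\<dots> \<le> X * (210 * (n + 1))" by simp
    finally show "100 * (m + n + 1) + 10 \<le> X * (210 * (n + 1))" .
  qed simp
  moreover have "m * (n * 40 + 50) \<le> (n + 1) * (X * (90 * (n + 1)))"
  proof -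
    have "m * (n * 40 + 50) \<le> X * (90 * (n + 1))" using X by (intro mult_le_mono) auto
    also have "\<dots> \<le> (n + 1) * (X * (90 * (n + 1)))" by simp
    finally show ?thesis .
  qed
  moreover have "52 \<le> (n + 1) * (X * (52 * (n + 1)))"
  proof -
    have "52 \<le> X * (52 * (n + 1))" by (rule one)
    also have "\<dots> \<le> (n + 1) * (X * (52 * (n + 1)))" by simp
    finally show ?thesis .
  qed
  ultimately have "config_steps m n \<le> (n + 1) * (X * (630 * (n + 1)) + X * (12 * (n + 1)))
      + (n + 1) * (X * (210 * (n + 1))) + (n + 1) * (X * (90 * (n + 1))) + (n + 1) * (X * (52 * (n + 1)))"
    unfolding config_steps_def by linarith
  also have "\<dots> = 994 * ((n + 1) * (X * (n + 1)))" by (simp add: algebra_simps)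
  also have "\<dots> \<le> 1000 * ((n + 1) * (X * (n + 1)))" by (rule mult_le_mono1) simp
  also have "\<dots> = 1000 * (n + 1)\<^sup>2 * X" by (simp add: power2_eq_square algebra_simps)
  finally show ?thesis unfolding X_def .
qed

definition time_poly :: "real poly" where
  "time_poly = [:1000, 2000, 1000:]"

lemma config_steps_le_time:
  assumes "1 \<le> m" "2 \<le> a"
  shows "real (config_steps m n) \<le> config_time time_poly a m n"
proof -
  have "real (config_steps m n) \<le> real (1000 * (n + 1)\<^sup>2 * (m\<^sup>2 + 4 ^ n))"
    using config_steps_le[OF assms(1)] by (simp only: of_nat_le_iff)
  also have "\<dots> = poly time_poly (real n) * ((real m)\<^sup>2 + 4 ^ n)"
    by (simp add: time_poly_def power2_eq_square algebra_simps)
  also have "(4::real) ^ n = 2 powr (2 * real n)"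
    by (simp add: powr_realpow[symmetric] powr_powr[symmetric])
  also have "poly time_poly (real n) * ((real m)\<^sup>2 + 2 powr (2 * real n)) \<le> config_time time_poly a m n"
    unfolding config_time_def using assms(2)
    by (intro mult_left_mono add_left_mono powr_mono mult_right_mono) (auto simp: time_poly_def)
  finally show ?thesis .
qed

lemma config_time_ge:
  assumes "1 \<le> m"
  shows "1000 \<le> config_time time_poly a m n"
proof -
  have "1000 \<le> poly time_poly (real n)" by (simp add: time_poly_def)
  moreover have "1 \<le> (real m)\<^sup>2" using assms by (simp add: one_le_power)
  then have "1 \<le> (real m)\<^sup>2 + 2 powr (a * real n)" using powr_ge_zero[of 2 "a * real n"] by linarith
  ultimately have "1000 * 1 \<le> config_time time_poly a m n"
    unfolding config_time_def by (intro mult_mono) auto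
  then show ?thesis by simp
qed

lemma samples_of_run_dist:
  assumes "run_dist P B p T (imem \<sigma>) (cmem \<sigma>) (out \<sigma>) f E Q"
    and "\<And>x. pmf E x = F x"
    and "\<And>x. x \<in> set_pmf E \<Longrightarrow> real (steps \<sigma> + T) \<le> T' x"
    and "\<And>x. x \<in> set_pmf E \<Longrightarrow> real (max (cells \<sigma>) B) \<le> S x"
  shows "samples P p \<sigma> (\<lambda>\<tau>. f (imem \<tau>) (cmem \<tau>) (out \<tau>)) F T' S"
proof -
  obtain D where D: "exec P p \<sigma> D" "map_pmf (\<lambda>\<tau>. f (imem \<tau>) (cmem \<tau>) (out \<tau>)) D = E"
    "\<And>\<tau>. \<tau> \<in> set_pmf D \<Longrightarrow> steps \<tau> \<le> steps \<sigma> + T"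
    "\<And>\<tau>. \<tau> \<in> set_pmf D \<Longrightarrow> cells \<tau> \<le> max (cells \<sigma>) B"
    using run_distD[OF assms(1) refl refl refl] by blast
  have "real (steps \<tau>) \<le> T' (f (imem \<tau>) (cmem \<tau>) (out \<tau>))"
    "real (cells \<tau>) \<le> S (f (imem \<tau>) (cmem \<tau>) (out \<tau>))" if \<tau>: "\<tau> \<in> set_pmf D" for \<tau>
  proof -
    have x: "f (imem \<tau>) (cmem \<tau>) (out \<tau>) \<in> set_pmf E" using D(2) \<tau> by auto
    have "real (steps \<tau>) \<le> real (steps \<sigma> + T)" "real (cells \<tau>) \<le> real (max (cells \<sigma>) B)"
      using D(3,4)[OF \<tau>] by (simp_all only: of_nat_le_iff)
    then show "real (steps \<tau>) \<le> T' (f (imem \<tau>) (cmem \<tau>) (out \<tau>))"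
      "real (cells \<tau>) \<le> S (f (imem \<tau>) (cmem \<tau>) (out \<tau>))"
      using assms(3,4)[OF x] by linarith+
  qed
  then show ?thesis unfolding samples_def using D(1,2) assms(2) by blast
qed

definition number_steps :: "nat \<Rightarrow> real \<Rightarrow> real \<Rightarrow> nat" where
  "number_steps m r c = 300 + half_most m r * 30 + range_card m r c * 150"

lemma number_steps_le:
  assumes "c > 0"
  shows "real (number_steps m r c) \<le> (450 + 150 * c) * (real m * (sinh r)\<^sup>2 + 1)"
proof -
  let ?s = "real m * (sinh r)\<^sup>2"
  have s: "0 \<le> ?s" by simp
  have M: "real (half_most m r) \<le> ?s"
  proof (cases "0 \<le> \<lfloor>(real m / 2 - 1) * (sinh r)\<^sup>2\<rfloor>")
    case True
    then have "real (half_most m r) \<le> (real m / 2 - 1) * (sinh r)\<^sup>2"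
      by (simp add: half_most_def)
    also have "\<dots> \<le> ?s" by (intro mult_right_mono) auto
    finally show ?thesis .
  next
    case False
    then have "half_most m r = 0" by (simp add: half_most_def)
    then show ?thesis using s by simp
  qed
  have "real (range_card m r c) = 1 + of_int \<lfloor>c * real (half_most m r)\<rfloor>"
    using assms by (simp add: range_card_def)
  also have "\<dots> \<le> 1 + c * real (half_most m r)" by simp
  also have "\<dots> \<le> 1 + c * ?s" using M assms by (intro add_left_mono mult_left_mono) auto
  finally have K: "real (range_card m r c) \<le> 1 + c * ?s" .
  have "real (number_steps m r c) \<le> 300 + ?s * 30 + (1 + c * ?s) * 150"
    unfolding number_steps_def using M K by simp
  also have "\<dots> \<le> (450 + 150 * c) * (?s + 1)"
    using assms s by (simp add: algebra_simps)
  finally show ?thesis .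
qed

lemma samples_Number:
  assumes "dim_row (network P) = m" "squeezing P = r" "cutoff P = c" "c > 0"
    and "\<And>n. real (number_steps m r c) \<le> T n" "\<And>n. 21 \<le> S n"
  shows "samples P Number (start 0) (\<lambda>\<tau>. imem \<tau> 0) (truncated_photon_prob m r c) T S"
proof -
  obtain E where "run_dist P 21 Number (number_steps m r c) (imem (start 0)) (cmem (start 0)) (out (start 0))
      (\<lambda>I C W. I 0) E (\<lambda>J D V. even (J 0) \<and> V = out (start 0))"
    and "\<And>n. pmf E n = truncated_photon_prob m r c n"
    unfolding number_steps_def
    by (rule run_dist_Number[OF assms(1-4), of 21 "imem (start 0)" "cmem (start 0)" "out (start 0)"]) auto
  then show ?thesis by (rule samples_of_run_dist) (use assms(5,6) in \<open>simp_all add: start_def\<close>)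
qed

lemma samples_Config:
  assumes "network P \<in> carrier_mat m m" "unitary (network P)" "1 \<le> m" "even n"
    and "\<And>s. real (config_steps m n) \<le> T s" "\<And>s. real (21 + 2 * n) \<le> S s"
  shows "samples P Config (start n) out (config_prob (network P) n) T S"
proof -
  obtain E where "run_dist P (21 + 2 * n) Config (config_steps m n) (imem (start n)) (cmem (start n)) (out (start n))
      (\<lambda>I C W. W) E (\<lambda>J D V. sum_list V = n)"
    and "\<And>s. pmf E s = config_prob (network P) n s"
    by (rule run_dist_Config[OF assms(1,2), of "imem (start n)" n "21 + 2 * n" "out (start n)" "cmem (start n)"])
      (use assms(3,4) in \<open>auto simp: start_def\<close>)
  then show ?thesis by (rule samples_of_run_dist) (use assms(5,6) in \<open>simp_all add: start_def\<close>)
qed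

lemma truncated_gbs_prob_eq:
  "truncated_gbs_prob U r c s
    = truncated_photon_prob (dim_row U) r c (sum_list s) * config_prob U (sum_list s) s"
  by (simp add: truncated_gbs_prob_def truncated_photon_prob_def gbs_prob_def)

lemma samples_Number_Config:
  assumes U: "network P \<in> carrier_mat m m" "unitary (network P)" and m: "1 \<le> m"
    and P: "squeezing P = r" "cutoff P = c" "c > 0"
    and T: "\<And>s. real (number_steps m r c + config_steps m (sum_list s)) \<le> T s"
    and S: "\<And>s. real (21 + 2 * sum_list s) \<le> S s"
  shows "samples P (Seq Number Config) (start 0) out (truncated_gbs_prob (network P) r c) T S"
proof -
  let ?U = "network P"
  have dim: "dim_row ?U = m" using U by simp
  obtain E where E: "run_dist P 21 Number (number_steps m r c) (imem (start 0)) (cmem (start 0)) (out (start 0))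
      (\<lambda>I C W. I 0) E (\<lambda>J D V. even (J 0) \<and> V = out (start 0))"
    "\<And>n. pmf E n = truncated_photon_prob m r c n"
    unfolding number_steps_def
    by (rule run_dist_Number[OF dim P, of 21 "imem (start 0)" "cmem (start 0)" "out (start 0)"]) auto
  obtain D where D: "exec P Number (start 0) D" "map_pmf (\<lambda>\<tau>. imem \<tau> 0) D = E"
    and D': "\<And>\<tau>. \<tau> \<in> set_pmf D \<Longrightarrow> even (imem \<tau> 0) \<and> out \<tau> = out (start 0)"
      "\<And>\<tau>. \<tau> \<in> set_pmf D \<Longrightarrow> steps \<tau> \<le> steps (start 0) + number_steps m r c"
      "\<And>\<tau>. \<tau> \<in> set_pmf D \<Longrightarrow> cells \<tau> \<le> max (cells (start 0)) 21"
    using run_distD[OF E(1) refl refl refl] by blast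
  have "\<exists>L. exec P Config \<tau> L \<and> (\<forall>s. pmf (map_pmf out L) s = config_prob ?U (imem \<tau> 0) s)
     \<and> (\<forall>\<tau>'\<in>set_pmf L. sum_list (out \<tau>') = imem \<tau> 0 \<and> steps \<tau>' \<le> steps \<tau> + config_steps m (imem \<tau> 0)
          \<and> cells \<tau>' \<le> max (cells \<tau>) (21 + 2 * imem \<tau> 0))" if \<tau>: "\<tau> \<in> set_pmf D" for \<tau>
  proof -
    let ?n = "imem \<tau> 0"
    obtain F where F: "run_dist P (21 + 2 * ?n) Config (config_steps m ?n) (imem \<tau>) (cmem \<tau>) (out \<tau>)
        (\<lambda>I C W. W) F (\<lambda>J D V. sum_list V = ?n)"
      "\<And>s. pmf F s = config_prob ?U ?n s"
      by (rule run_dist_Config[OF U, of "imem \<tau>" ?n "21 + 2 * ?n" "out \<tau>" "cmem \<tau>"])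
        (use m D'(1)[OF \<tau>] in \<open>auto simp: start_def\<close>)
    obtain L where "exec P Config \<tau> L" "map_pmf (\<lambda>\<tau>. out \<tau>) L = F"
      "\<And>\<tau>'. \<tau>' \<in> set_pmf L \<Longrightarrow> sum_list (out \<tau>') = ?n"
      "\<And>\<tau>'. \<tau>' \<in> set_pmf L \<Longrightarrow> steps \<tau>' \<le> steps \<tau> + config_steps m ?n"
      "\<And>\<tau>'. \<tau>' \<in> set_pmf L \<Longrightarrow> cells \<tau>' \<le> max (cells \<tau>) (21 + 2 * ?n)"
      using run_distD[OF F(1) refl refl refl] by blast
    then show ?thesis using F(2) by blast
  qed
  then obtain L where L: "\<And>\<tau>. \<tau> \<in> set_pmf D \<Longrightarrow> exec P Config \<tau> (L \<tau>)"
    "\<And>\<tau> s. \<tau> \<in> set_pmf D \<Longrightarrow> pmf (map_pmf out (L \<tau>)) s = config_prob ?U (imem \<tau> 0) s"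
    "\<And>\<tau> \<tau>'. \<tau> \<in> set_pmf D \<Longrightarrow> \<tau>' \<in> set_pmf (L \<tau>) \<Longrightarrow> sum_list (out \<tau>') = imem \<tau> 0
      \<and> steps \<tau>' \<le> steps \<tau> + config_steps m (imem \<tau> 0) \<and> cells \<tau>' \<le> max (cells \<tau>) (21 + 2 * imem \<tau> 0)"
    by metis
  have "exec P (Seq Number Config) (start 0) (bind_pmf D L)"
    by (rule exec.Seq[OF D(1) L(1)])
  moreover have "pmf (map_pmf out (bind_pmf D L)) s = truncated_gbs_prob ?U r c s" for s
  proof -
    have "pmf (map_pmf out (bind_pmf D L)) s = (\<integral>\<tau>. pmf (map_pmf out (L \<tau>)) s \<partial>measure_pmf D)"
      by (simp add: map_bind_pmf pmf_bind)
    also have "\<dots> = (\<integral>\<tau>. config_prob ?U (imem \<tau> 0) s \<partial>measure_pmf D)"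
      using L(2) by (intro integral_cong_AE) (auto simp: AE_measure_pmf_iff)
    also have "\<dots> = (\<integral>n. config_prob ?U n s \<partial>measure_pmf E)"
      unfolding D(2)[symmetric] by simp
    also have "\<dots> = (\<Sum>n\<in>{sum_list s}. pmf E n *\<^sub>R config_prob ?U n s)"
      by (rule integral_measure_pmf) (auto simp: config_prob_def split: if_splits)
    finally show ?thesis by (simp add: E(2) truncated_gbs_prob_eq dim)
  qed
  moreover have "real (steps \<tau>') \<le> T (out \<tau>')" "real (cells \<tau>') \<le> S (out \<tau>')"
    if \<tau>': "\<tau>' \<in> set_pmf (bind_pmf D L)" for \<tau>'
  proof -
    obtain \<tau> where \<tau>: "\<tau> \<in> set_pmf D" "\<tau>' \<in> set_pmf (L \<tau>)" using \<tau>' by auto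
    have "steps \<tau>' \<le> number_steps m r c + config_steps m (sum_list (out \<tau>'))"
      "cells \<tau>' \<le> 21 + 2 * sum_list (out \<tau>')"
      using L(3)[OF \<tau>] D'(2,3)[OF \<tau>(1)] by (simp_all add: start_def)
    then have "real (steps \<tau>') \<le> real (number_steps m r c + config_steps m (sum_list (out \<tau>')))"
      "real (cells \<tau>') \<le> real (21 + 2 * sum_list (out \<tau>'))"
      by (simp_all only: of_nat_le_iff)
    then show "real (steps \<tau>') \<le> T (out \<tau>')" "real (cells \<tau>') \<le> S (out \<tau>')"
      using T[of "out \<tau>'"] S[of "out \<tau>'"] by linarith+
  qed
  ultimately show ?thesis unfolding samples_def by blast
qed

theorem mainTheorem2:
  fixes c :: real
  assumes "c > 0"
  shows "\<exists>(number :: com) (config :: com) (config' :: com) (C :: real) (p :: real poly) (q :: real poly).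
    \<forall>(m :: nat) (U :: complex mat) (r :: real).
      m \<ge> 1 \<and> U \<in> carrier_mat m m \<and> unitary U \<longrightarrow>
      (let P = \<lparr>network = U, squeezing = r, cutoff = c\<rparr>;
           poly_space = (\<lambda>n. poly q (real (m + n)));
           exp_space = (\<lambda>n. C * (real m * 2 ^ n))
       in samples P number (start 0) (\<lambda>\<tau>. imem \<tau> 0) (truncated_photon_prob m r c)
            (\<lambda>n. C * (real m * (sinh r)\<^sup>2 + 1)) poly_space
        \<and> (\<forall>n. even n \<longrightarrow>
             samples P config (start n) out (config_prob U n)
               (\<lambda>s. config_time p (8 / 3) m n) (\<lambda>s. poly_space n)
           \<and> samples P config' (start n) out (config_prob U n)
               (\<lambda>s. config_time p (5 / 2) m n) (\<lambda>s. exp_space n))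
        \<and> samples P (Seq number config) (start 0) out (truncated_gbs_prob U r c)
            (\<lambda>s. C * (real m * (sinh r)\<^sup>2 + config_time p (8 / 3) m (sum_list s)))
            (\<lambda>s. poly_space (sum_list s))
        \<and> samples P (Seq number config') (start 0) out (truncated_gbs_prob U r c)
            (\<lambda>s. C * (real m * (sinh r)\<^sup>2 + config_time p (5 / 2) m (sum_list s)))
            (\<lambda>s. exp_space (sum_list s)))"
proof -
  define C where "C = 450 + 150 * c"
  define q :: "real poly" where "q = [:21, 2:]"
  have C: "450 \<le> C" using assms by (simp add: C_def)
  show ?thesis
  proof (rule exI[of _ Number], rule exI[of _ Config], rule exI[of _ Config], rule exI[of _ C],
      rule exI[of _ time_poly], rule exI[of _ q], intro allI impI, elim conjE)
    fix m :: nat and U :: "complex mat" and r :: real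
    assume m: "1 \<le> m" and U: "U \<in> carrier_mat m m" "unitary U"
    let ?P = "\<lparr>network = U, squeezing = r, cutoff = c\<rparr>"
    let ?s = "real m * (sinh r)\<^sup>2"
    have P: "network ?P \<in> carrier_mat m m" "unitary (network ?P)" "dim_row (network ?P) = m"
      "squeezing ?P = r" "cutoff ?P = c" using U by simp_all
    have poly_space: "real (21 + 2 * n) \<le> poly q (real (m + n))" for n by (simp add: q_def)
    have exp_space: "real (21 + 2 * n) \<le> C * (real m * 2 ^ n)" for n
    proof -
      have "real n < 2 ^ n" by (rule of_nat_less_two_power)
      moreover have "(1::real) \<le> 2 ^ n" by simp
      moreover have "real (21 + 2 * n) = 21 + 2 * real n" by simp
      ultimately have "real (21 + 2 * n) \<le> 450 * (1 * 2 ^ n)" by linarith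
      also have "\<dots> \<le> C * (real m * 2 ^ n)" using C m by (intro mult_mono) auto
      finally show ?thesis .
    qed
    have num: "real (number_steps m r c) \<le> C * (?s + 1)"
      unfolding C_def by (rule number_steps_le[OF assms])
    have both: "real (number_steps m r c + config_steps m n) \<le> C * (?s + config_time time_poly a m n)"
      if "2 \<le> a" for a n
    proof -
      let ?t = "config_time time_poly a m n"
      have t: "real (config_steps m n) \<le> ?t" "1000 \<le> ?t"
        using config_steps_le_time[OF m that] config_time_ge[OF m] by auto
      have "(C - 1) * 2 \<le> (C - 1) * ?t" using C t(2) by (intro mult_left_mono) auto
      then have "C + ?t \<le> C * ?t" using C by (simp add: algebra_simps)
      then show ?thesis using num t(1) by (simp add: algebra_simps)
    qed
    have config: "samples ?P Config (start n) out (config_prob U n) (\<lambda>s. config_time time_poly a m n) (\<lambda>s. S)"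
      if "even n" "2 \<le> a" "real (21 + 2 * n) \<le> S" for n a S
      using samples_Config[OF P(1,2) m that(1), of "\<lambda>s. config_time time_poly a m n" "\<lambda>s. S"]
        config_steps_le_time[OF m that(2)] that(3) by simp
    have full: "samples ?P (Seq Number Config) (start 0) out (truncated_gbs_prob U r c)
        (\<lambda>s. C * (?s + config_time time_poly a m (sum_list s))) S"
      if "2 \<le> a" "\<And>s. real (21 + 2 * sum_list s) \<le> S s" for a S
      using samples_Number_Config[OF P(1,2) m P(4,5) assms, of _ S] both[OF that(1)] that(2) by simp
    show "let P = ?P; poly_space = (\<lambda>n. poly q (real (m + n))); exp_space = (\<lambda>n. C * (real m * 2 ^ n))
       in samples P Number (start 0) (\<lambda>\<tau>. imem \<tau> 0) (truncated_photon_prob m r c)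
            (\<lambda>n. C * (?s + 1)) poly_space
        \<and> (\<forall>n. even n \<longrightarrow>
             samples P Config (start n) out (config_prob U n)
               (\<lambda>s. config_time time_poly (8 / 3) m n) (\<lambda>s. poly_space n)
           \<and> samples P Config (start n) out (config_prob U n)
               (\<lambda>s. config_time time_poly (5 / 2) m n) (\<lambda>s. exp_space n))
        \<and> samples P (Seq Number Config) (start 0) out (truncated_gbs_prob U r c)
            (\<lambda>s. C * (?s + config_time time_poly (8 / 3) m (sum_list s)))
            (\<lambda>s. poly_space (sum_list s))
        \<and> samples P (Seq Number Config) (start 0) out (truncated_gbs_prob U r c)
            (\<lambda>s. C * (?s + config_time time_poly (5 / 2) m (sum_list s)))
            (\<lambda>s. exp_space (sum_list s))"
      unfolding Let_def
    proof (intro conjI allI impI)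
      show "samples ?P Number (start 0) (\<lambda>\<tau>. imem \<tau> 0) (truncated_photon_prob m r c)
            (\<lambda>n. C * (?s + 1)) (\<lambda>n. poly q (real (m + n)))"
        by (rule samples_Number[OF P(3-5) assms num]) (simp add: q_def)
    qed (use config full poly_space exp_space in \<open>simp_all\<close>)
  qed
qed

end
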